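(* Let $r\ge1$. For $c\in\mathcal{W}_r$, let $B(c)$ be the set of bilabeled trees $(T,\mathrm{dec},\mathrm{lr})$ with content $c$. Then $$A_c(q)=\sum_{(T,\mathrm{dec},\mathrm{lr})\in B(c)}q^{\ell(u)},$$ where $u\in\mathbb{S}_r$ is the permutation determined by $(T,\mathrm{dec})$.
   Context: $\mathcal{W}_r$ is the set of sequences $(c_1,\dots,c_r)$ of nonnegative integers with $c_1+\cdots+c_r=r$. $\mathbb{S}_n$ is the symmetric group and $\ell(u)$ is the number of inversions of $u$. Definition of $A_c(q)$. Let $\mathbb{S}_{r+1}$ act on $\mathbb{C}[q,x_1,\dots,x_{r+1}]$ by permuting the indices of the $x_i$, and set $$\partial_{w_o}(f)=\frac{1}{\prod_{1\le i<j\le r+1}(x_i-x_j)}\sum_{\sigma\in\mathbb{S}_{r+1}}\epsilon(\sigma)\sigma(f),$$ with $\epsilon(\sigma)$ the sign of $\sigma$. Put $\langle f\rangle^q_{r+1}=\partial_{w_o}\bigl(f\prod_{1\le i<j-1\le r}(qx_i-x_j)\bigr)$ (product over pairs $(i,j)$ with $1\le i$, $i<j-1$, $j\le r+1$). If $f$ is homogeneous of degree $r$ in the $x_i$, then $\langle f\rangle^q_{r+1}\in\mathbb{C}[q]$. For $c\in\mathcal{W}_r$ the remixed Eulerian number is $$A_c(q)=\bigl\langle x_1^{c_1}(x_1+x_2)^{c_2}\cdots(x_1+\cdots+x_r)^{c_r}\bigr\rangle^q_{r+1}\in\mathbb{C}[q].$$ Bilabeled trees. A bilabeled tree is a triple $(T,\mathrm{dec},\mathrm{lr})$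 where: - $T$ is a complete (rooted, plane) binary tree with $r$ internal nodes and $r+1$ leaves: every internal node has exactly one left child and one right child. - $\mathrm{dec}$ is a bijective labeling of the internal nodes by $\{1,\dots,r\}$ that is decreasing: the label of each internal node is larger than those of all its internal proper descendants. The leaves are not labeled by $\mathrm{dec}$. - $\mathrm{lr}$ is a labeling of all internal nodes and leaves with distinct integers from $\{1,\dots,2r+1\}$ (hence a bijection), such that the label of any internal node is larger than the label of its left child and smaller than the label of its right child, and such that the labels of the leaves increase when read from left to right. If the leaf labels (under $\mathrm{lr}$) are $1=\ell_1<\cdots<\ell_{r+1}=2r+1$, the content of the bilabeled tree is $(c_1,\dots,c_r)$ with $c_i=\ell_{i+1}-\ell_i-1$. The permutation $u\in\mathbb{S}_r$ determined by $(T,\mathrm{dec})$ is the one whose one-line notation is the word of $\mathrm{dec}$-labels of internal nodes read in in-order (left subtree, root, right subtree). *)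

theory Defs
  imports
    "HOL-Library.Poly_Mapping"
    "HOL-Computational_Algebra.Polynomial"
    "HOL-Combinatorics.Permutations"
begin

section \<open>Weight sequences\<close>

text \<open>A sequence \<open>(c\<^sub>1, \<dots>, c\<^sub>r)\<close> is the list with \<open>c\<^sub>i = c ! (i - 1)\<close>.\<close>

definition weight_seqs :: "nat \<Rightarrow> nat list set" where
  "weight_seqs r = {c. length c = r \<and> sum_list c = r}"


section \<open>Remixed Eulerian numbers\<close>

text \<open>
  \<open>qx_poly\<close> is the polynomial ring \<open>\<complex>[q][x\<^sub>0, x\<^sub>1, x\<^sub>2, \<dots>]\<close>: exponent vectors are finitely
  supported functions of the variable index and coefficients are polynomials in \<open>q\<close>.
  Only the variables \<open>x\<^sub>1, \<dots>, x\<^bsub>r+1\<^esub>\<close> are used.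
\<close>

type_synonym qx_poly = "(nat \<Rightarrow>\<^sub>0 nat) \<Rightarrow>\<^sub>0 complex poly"

definition X :: "nat \<Rightarrow> qx_poly" where
  "X i = Poly_Mapping.single (Poly_Mapping.single i 1) 1"

definition of_qpoly :: "complex poly \<Rightarrow> qx_poly" where
  "of_qpoly p = Poly_Mapping.single 0 p"

definition q_var :: "complex poly" where
  "q_var = [:0, 1:]"

text \<open>
  The coefficient of \<open>permute_vars \<sigma> f\<close> at the monomial \<open>m\<close> is that of \<open>f\<close> at \<open>m \<circ> \<sigma>\<close>;
  for a permutation \<open>\<sigma>\<close> this is the substitution \<open>x\<^sub>i \<mapsto> x\<^bsub>\<sigma>(i)\<^esub>\<close>,
  see \<open>permute_vars_X\<close>.
\<close>

definition permute_vars :: "(nat \<Rightarrow> nat) \<Rightarrow> qx_poly \<Rightarrow> qx_poly" where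
  "permute_vars \<sigma> f = Poly_Mapping.map_key (Poly_Mapping.map_key \<sigma>) f"

definition vandermonde :: "nat \<Rightarrow> qx_poly" where
  "vandermonde n = (\<Prod>(i, j) \<in> {(i, j). 1 \<le> i \<and> i < j \<and> j \<le> n}. X i - X j)"

text \<open>
  The quotient is taken in the polynomial ring, which is an integral domain; it is unique by
  \<open>divided_difference_eqI\<close> below.
\<close>

definition divided_difference :: "nat \<Rightarrow> qx_poly \<Rightarrow> qx_poly" where
  "divided_difference n f =
     (THE g. vandermonde n * g = (\<Sum>\<sigma> | \<sigma> permutes {1..n}. of_int (sign \<sigma>) * permute_vars \<sigma> f))"

definition q_bracket :: "nat \<Rightarrow> qx_poly \<Rightarrow> qx_poly" where
  "q_bracket n f = divided_difference n
     (f * (\<Prod>(i, j) \<in> {(i, j). 1 \<le> i \<and> i + 1 < j \<and> j \<le> n}. of_qpoly q_var * X i - X j))"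

text \<open>
  \<open>A\<^sub>c(q)\<close> is kept as an element of the ambient ring \<open>qx_poly\<close>; that it lies in \<open>\<complex>[q]\<close> means
  that it is of the form \<open>of_qpoly p\<close>.
\<close>

definition remixed_eulerian :: "nat \<Rightarrow> nat list \<Rightarrow> qx_poly" where
  "remixed_eulerian r c =
     q_bracket (r + 1) (\<Prod>i = 1..r. (\<Sum>j = 1..i. X j) ^ (c ! (i - 1)))"


section \<open>Bilabeled trees\<close>

text \<open>
  A complete plane binary tree together with its two labelings: \<open>Leaf l\<close> is a leaf with
  lr-label \<open>l\<close>, and \<open>Node a d m b\<close> is an internal node with dec-label \<open>d\<close> and lr-label \<open>m\<close>.
\<close>

datatype ltree = Leaf nat | Node ltree nat nat ltree

primrec lr_root :: "ltree \<Rightarrow> nat" where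
  "lr_root (Leaf l) = l"
| "lr_root (Node a d m b) = m"

primrec dec_word :: "ltree \<Rightarrow> nat list" where
  "dec_word (Leaf l) = []"
| "dec_word (Node a d m b) = dec_word a @ d # dec_word b"

primrec lr_word :: "ltree \<Rightarrow> nat list" where
  "lr_word (Leaf l) = [l]"
| "lr_word (Node a d m b) = lr_word a @ m # lr_word b"

primrec leaf_word :: "ltree \<Rightarrow> nat list" where
  "leaf_word (Leaf l) = [l]"
| "leaf_word (Node a d m b) = leaf_word a @ leaf_word b"

primrec dec_decreasing :: "ltree \<Rightarrow> bool" where
  "dec_decreasing (Leaf l) \<longleftrightarrow> True"
| "dec_decreasing (Node a d m b) \<longleftrightarrow>
     (\<forall>e \<in> set (dec_word a) \<union> set (dec_word b). e < d) \<and> dec_decreasing a \<and> dec_decreasing b"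

primrec lr_local :: "ltree \<Rightarrow> bool" where
  "lr_local (Leaf l) \<longleftrightarrow> True"
| "lr_local (Node a d m b) \<longleftrightarrow>
     lr_root a < m \<and> m < lr_root b \<and> lr_local a \<and> lr_local b"

definition bilabeled :: "nat \<Rightarrow> ltree \<Rightarrow> bool" where
  "bilabeled r t \<longleftrightarrow>
     length (dec_word t) = r \<and>
     distinct (dec_word t) \<and> set (dec_word t) = {1..r} \<and> dec_decreasing t \<and>
     distinct (lr_word t) \<and> set (lr_word t) = {1..2 * r + 1} \<and> lr_local t \<and>
     sorted_wrt (<) (leaf_word t)"

definition content :: "ltree \<Rightarrow> nat list" where
  "content t = (let ls = leaf_word t in map (\<lambda>i. ls ! (i + 1) - ls ! i - 1) [0..<length ls - 1])"

definition bilabeled_trees :: "nat \<Rightarrow> nat list \<Rightarrow> ltree set" where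
  "bilabeled_trees r c = {t. bilabeled r t \<and> content t = c}"

definition tree_perm :: "ltree \<Rightarrow> nat \<Rightarrow> nat" where
  "tree_perm t i = (if i \<in> {1..length (dec_word t)} then dec_word t ! (i - 1) else i)"

definition inversions :: "nat \<Rightarrow> (nat \<Rightarrow> nat) \<Rightarrow> nat" where
  "inversions n u = card {(i, j). 1 \<le> i \<and> i < j \<and> j \<le> n \<and> u i > u j}"


section \<open>Well-definedness\<close>

lemma inj_map_key:
  fixes \<sigma> :: "nat \<Rightarrow> nat"
  assumes "bij \<sigma>"
  shows "inj (Poly_Mapping.map_key \<sigma> :: (nat \<Rightarrow>\<^sub>0 nat) \<Rightarrow> _)"
proof (rule injI)
  fix p p' :: "nat \<Rightarrow>\<^sub>0 nat"
  assume eq: "Poly_Mapping.map_key \<sigma> p = Poly_Mapping.map_key \<sigma> p'"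
  show "p = p'"
  proof (rule poly_mapping_eqI)
    fix k
    have "Poly_Mapping.lookup p (\<sigma> (inv \<sigma> k)) = Poly_Mapping.lookup p' (\<sigma> (inv \<sigma> k))"
      using eq map_key.rep_eq[OF bij_is_inj[OF assms]] by (metis comp_apply)
    then show "Poly_Mapping.lookup p k = Poly_Mapping.lookup p' k"
      using assms by (simp add: bij_is_surj surj_f_inv_f)
  qed
qed

lemma permute_vars_X:
  assumes "bij \<sigma>"
  shows "permute_vars \<sigma> (X i) = X (\<sigma> i)"
proof -
  have "Poly_Mapping.map_key \<sigma> (Poly_Mapping.single (\<sigma> i) 1) = Poly_Mapping.single i (1::nat)"
    by (rule map_key_single[OF bij_is_inj[OF assms]])
  then show ?thesis
    unfolding permute_vars_def X_def
    by (metis map_key_single[OF inj_map_key[OF assms]])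
qed

lemma X_eq_iff: "X i = X j \<longleftrightarrow> i = j"
proof
  assume "X i = X j"
  then have "Poly_Mapping.keys (X i) = Poly_Mapping.keys (X j)" by simp
  then have "Poly_Mapping.single i (1::nat) = Poly_Mapping.single j 1"
    by (simp add: X_def)
  then have "Poly_Mapping.keys (Poly_Mapping.single i (1::nat)) =
      Poly_Mapping.keys (Poly_Mapping.single j (1::nat))" by simp
  then show "i = j" by simp
qed simp

lemma vandermonde_nonzero: "vandermonde n \<noteq> 0"
proof -
  have "finite {(i::nat, j). 1 \<le> i \<and> i < j \<and> j \<le> n}"
    by (rule finite_subset[of _ "{..n} \<times> {..n}"]) auto
  then show ?thesis
    unfolding vandermonde_def by (auto simp: prod_zero_iff X_eq_iff)
qed

lemma divided_difference_eqI:
  assumes "vandermonde n * g = (\<Sum>\<sigma> | \<sigma> permutes {1..n}. of_int (sign \<sigma>) * permute_vars \<sigma> f)"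
  shows "divided_difference n f = g"
  unfolding divided_difference_def
proof (rule the_equality, rule assms)
  fix h
  assume "vandermonde n * h = (\<Sum>\<sigma> | \<sigma> permutes {1..n}. of_int (sign \<sigma>) * permute_vars \<sigma> f)"
  then have "vandermonde n * h = vandermonde n * g" using assms by simp
  then show "h = g" using vandermonde_nonzero by simp
qed

lemma finite_bounded_ltrees:
  "finite {t. length (dec_word t) \<le> n \<and> set (dec_word t) \<subseteq> {..N} \<and> set (lr_word t) \<subseteq> {..N}}"
    (is "finite (?S n)")
proof (induction n)
  case 0
  have "?S 0 \<subseteq> Leaf ` {..N}"
  proof
    fix t assume "t \<in> ?S 0"
    then show "t \<in> Leaf ` {..N}" by (cases t) auto
  qed
  then show ?case by (rule finite_subset) simp
next
  case (Suc n)
  have "?S (Suc n) \<subseteq> Leaf ` {..N} \<union>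
      (\<lambda>(a, d, m, b). Node a d m b) ` (?S n \<times> {..N} \<times> {..N} \<times> ?S n)"
  proof
    fix t assume "t \<in> ?S (Suc n)"
    then show "t \<in> Leaf ` {..N} \<union>
        (\<lambda>(a, d, m, b). Node a d m b) ` (?S n \<times> {..N} \<times> {..N} \<times> ?S n)"
      by (cases t) (auto simp: image_iff)
  qed
  then show ?case by (rule finite_subset) (use Suc in simp)
qed

lemma finite_bilabeled_trees: "finite (bilabeled_trees r c)"
  by (rule finite_subset[OF _ finite_bounded_ltrees[of r "2 * r + 1"]])
    (auto simp: bilabeled_trees_def bilabeled_def)

lemma tree_perm_permutes:
  assumes "bilabeled r t"
  shows "tree_perm t permutes {1..r}"
proof (rule bij_imp_permutes)
  have len: "length (dec_word t) = r" and dist: "distinct (dec_word t)"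
    and set: "set (dec_word t) = {1..r}"
    using assms by (auto simp: bilabeled_def)
  have "inj_on (tree_perm t) {1..r}"
    using len dist by (auto simp: inj_on_def tree_perm_def nth_eq_iff_index_eq)
  moreover have "tree_perm t ` {1..r} \<subseteq> {1..r}"
  proof
    fix y assume "y \<in> tree_perm t ` {1..r}"
    then obtain i where "i \<in> {1..r}" "y = dec_word t ! (i - 1)"
      using len by (auto simp: tree_perm_def)
    then have "y \<in> set (dec_word t)" using len by auto
    then show "y \<in> {1..r}" using set by simp
  qed
  ultimately show "bij_betw (tree_perm t) {1..r} {1..r}"
    by (simp add: bij_betw_def endo_inj_surj)
  show "tree_perm t i = i" if "i \<notin> {1..r}" for i
    using that len unfolding tree_perm_def by presburger
qed

end

theory Submission
  imports
    "HOL-Computational_Algebra.Polynomial_Factorial"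
    "HOL-Combinatorics.Multiset_Permutations"
    Defs
begin

text \<open>
  Both sides of the identity satisfy one linear recurrence in the weight sequence. Let
  \<open>d\<close> have length \<open>r\<close> and sum \<open>r - 1\<close>, let \<open>A\<^sub>i\<close> be the value at \<open>d\<close> with its \<open>i\<close>-th entry
  increased by one, and put \<open>A\<^sub>0 = A\<^bsub>r+1\<^esub> = 0\<close>. Then, for \<open>1 \<le> i \<le> r\<close>,
  \<open>(1 + q) A\<^sub>i - q A\<^bsub>i-1\<^esub> - A\<^bsub>i+1\<^esub>\<close> vanishes unless \<open>d\<^sub>i = 0\<close> and the entries to the left of \<open>d\<^sub>i\<close> sum
  to \<open>i - 1\<close>; in that case it is the \<open>q\<close>-binomial coefficient \<open>r + 1\<close> over \<open>i\<close> times the values at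
  \<open>(d\<^sub>1, \<dots>, d\<^bsub>i-1\<^esub>)\<close> and \<open>(d\<^bsub>i+1\<^esub>, \<dots>, d\<^sub>r)\<close>. For fixed \<open>d\<close> this is a tridiagonal system with determinant
  \<open>1 + q + \<dots> + q\<^sup>r\<close> (\<open>recurrence_unique\<close>), so the recurrence determines all values by induction
  on \<open>r\<close>.

  For the symmetrised products the recurrence is short (\<open>shifted_bracket_relation\<close>). With
  \<open>y\<^sub>i = x\<^sub>1 + \<dots> + x\<^sub>i\<close> one has \<open>(1 + q) y\<^sub>i - q y\<^bsub>i-1\<^esub> - y\<^bsub>i+1\<^esub> = q x\<^sub>i - x\<^bsub>i+1\<^esub>\<close>, which is the one factor
  \<open>q x\<^sub>a - x\<^sub>b\<close> with \<open>a \<le> i < b\<close> that is absent from the symmetrised product. Hence the sum over all orderings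
  of the variables splits into a sum over the set \<open>I\<close> of the first \<open>i\<close> variables of a left and a
  right factor, weighted by the product of \<open>(q x - y) / (x - y)\<close> over \<open>x \<in> I\<close>, \<open>y \<notin> I\<close>. These weights
  sum to the \<open>q\<close>-binomial coefficient (\<open>sum_cross\<close>), by Lagrange interpolation.

  For the trees, a content is read as a word of leaves and balls, a ball being the label of an
  internal node. Choosing the root ball and deleting it cuts the rest of the word into the
  words of the two subtrees, and the decreasing labelings contribute \<open>q\<close>-factorials
  (\<open>sum_rooted_below\<close>). What remains is a recursion on words in which the root of a left
  subtree lies before the root ball, and that of a right subtree behind it; it is therefore
  necessary to treat trees whose root lies before a given cut of the word. The recurrence then
  compares words that differ by exchanging a leaf with an adjacent ball. It holds in a form that
  includes the cut (\<open>relator_below\<close>), and is proved by moving the cut through the word from left to right: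
  each time the cut passes a ball, the two sides change by sums over shorter words, which the
  induction hypothesis and two expansions for a ball next to an end of the word
  (\<open>last_ball\<close>, \<open>first_ball\<close>) evaluate.

  Finally the polynomial identity is obtained in the field of fractions of \<open>\<complex>[q][x\<^sub>1, x\<^sub>2, \<dots>]\<close>, where
  no \<open>q\<close>-number vanishes.
\<close>

section \<open>q-numbers and cuts of lists\<close>

text \<open>
  Division by all \<open>q\<close>-numbers is possible, so that the tree weights below can be normalised by
  \<open>q\<close>-factorials; no \<open>q\<close>-binomial coefficient then enters the recursion on words.
\<close>

locale q_field =
  fixes q :: "'a :: field"
  assumes q_number_nonzero: "0 < n \<Longrightarrow> (\<Sum>i<n. q ^ i) \<noteq> 0"
begin

text \<open>
  The \<open>q\<close>-number \<open>[n]\<close>.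
\<close>

definition qn :: "nat \<Rightarrow> 'a" where "qn n = (\<Sum>i<n. q ^ i)"

lemma qn_nonzero [simp]: "qn (Suc n) \<noteq> 0"
  using q_number_nonzero[of "Suc n"] by (simp add: qn_def del: sum.lessThan_Suc)

lemma qn_0 [simp]: "qn 0 = 0" by (simp add: qn_def)

lemma qn_Suc: "qn (Suc n) = qn n + q ^ n" by (simp add: qn_def)

lemma qn_add: "qn (m + n) = qn n + q ^ n * qn m"
  by (induction m) (simp_all add: qn_Suc algebra_simps power_add)

lemma qn_geometric: "(q - 1) * qn n = q ^ n - 1"
  by (induction n) (simp_all add: qn_Suc algebra_simps)

definition qfact :: "nat \<Rightarrow> 'a" where "qfact n = (\<Prod>i<n. qn (Suc i))"

lemma qfact_0 [simp]: "qfact 0 = 1" by (simp add: qfact_def)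
lemma qfact_Suc: "qfact (Suc n) = qn (Suc n) * qfact n" by (simp add: qfact_def)
lemma qfact_nonzero [simp]: "qfact n \<noteq> 0" by (simp add: qfact_def)

definition splits :: "'b list \<Rightarrow> ('b list \<Rightarrow> 'b list \<Rightarrow> 'a) \<Rightarrow> 'a" where
  "splits w \<phi> = (\<Sum>j\<le>length w. \<phi> (take j w) (drop j w))"

lemma splits_cong: "(\<And>a b. a @ b = w \<Longrightarrow> \<phi> a b = \<psi> a b) \<Longrightarrow> splits w \<phi> = splits w \<psi>"
  by (simp add: splits_def)

lemma splits_add: "splits w (\<lambda>a b. \<phi> a b + \<psi> a b) = splits w \<phi> + splits w \<psi>"
  by (simp add: splits_def sum.distrib)

lemma splits_diff: "splits w (\<lambda>a b. \<phi> a b - \<psi> a b) = splits w \<phi> - splits w \<psi>"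
  by (simp add: splits_def sum_subtractf)

lemma splits_mult: "splits w (\<lambda>a b. c * \<phi> a b) = c * splits w \<phi>"
  by (simp add: splits_def sum_distrib_left)

lemma splits_mult_right: "splits w (\<lambda>a b. \<phi> a b * c) = splits w \<phi> * c"
  by (simp add: splits_def sum_distrib_right)

lemma splits_0 [simp]: "splits w (\<lambda>a b. 0) = 0" by (simp add: splits_def)

lemma splits_Nil [simp]: "splits [] \<phi> = \<phi> [] []" by (simp add: splits_def)

lemma splits_Cons: "splits (x # w) \<phi> = \<phi> [] (x # w) + splits w (\<lambda>a b. \<phi> (x # a) b)"
  unfolding splits_def by (simp add: sum.atMost_Suc_shift del: sum.atMost_Suc)

lemma splits_append:
  "splits (u @ v) \<phi> = splits u (\<lambda>a b. \<phi> a (b @ v)) + splits v (\<lambda>a b. \<phi> (u @ a) b) - \<phi> u v"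
  by (induction u arbitrary: \<phi>) (simp_all add: splits_Cons)

text \<open>
  Both sides range over all ways to cut the list into three.
\<close>

lemma splits_assoc:
  "splits w (\<lambda>z y. splits z (\<lambda>a x. \<phi> a x y)) = splits w (\<lambda>a z. splits z (\<lambda>x y. \<phi> a x y))"
proof (induction w arbitrary: \<phi>)
  case (Cons x w)
  show ?case by (simp add: splits_Cons splits_add Cons algebra_simps)
qed simp

lemma splits_middle:
  assumes "m \<noteq> []"
  shows "splits (u @ m @ v) \<phi> = splits u (\<lambda>a b. \<phi> a (b @ m @ v)) +
    (\<Sum>j = 1..<length m. \<phi> (u @ take j m) (drop j m @ v)) + splits v (\<lambda>a b. \<phi> (u @ m @ a) b)"
proof -
  obtain k where k: "length m = Suc k" using assms by (cases m) auto
  have "{..length m} = insert 0 (insert (length m) {1..<length m})" using k by auto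
  then have "splits m (\<lambda>a b. \<phi> (u @ a) (b @ v)) =
    \<phi> u (m @ v) + \<phi> (u @ m) v + (\<Sum>j = 1..<length m. \<phi> (u @ take j m) (drop j m @ v))"
    unfolding splits_def using assms by (simp add: algebra_simps)
  then show ?thesis by (simp add: splits_append)
qed

lemma splits_snoc: "splits (w @ [x]) \<phi> = splits w (\<lambda>a b. \<phi> a (b @ [x])) + \<phi> (w @ [x]) []"
  by (simp add: splits_append splits_Cons)

section \<open>Words of leaves and balls\<close>

abbreviation balls :: "bool list \<Rightarrow> nat" where "balls w \<equiv> count_list w False"

definition remove_at :: "nat \<Rightarrow> bool list \<Rightarrow> bool list" where
  "remove_at i w = take i w @ drop (Suc i) w"

text \<open>
  A word lists the kinds of the labels \<open>1, 2, \<dots>\<close>: \<open>True\<close> for a leaf, \<open>False\<close> for a ball, which is the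
  label of an internal node. For a word with \<open>n\<close> balls, \<open>below w s\<close> is the sum of \<open>q\<close> to the number of
  inversions over all bilabeled trees with word \<open>w\<close> whose root is among the first \<open>s\<close> letters, divided
  by the \<open>q\<close>-factorial of \<open>n\<close> (see \<open>sum_rooted_below\<close>). The recursion chooses the
  position \<open>i\<close> of the root and a cut \<open>j\<close> of the remaining word into the words of the subtrees. The
  root of the left subtree then lies before position \<open>i\<close> and that of the right subtree behind it.
  The root label has an inversion with every label of the right subtree, which gives the
  power of \<open>q\<close>; the inversions between the two subtrees give a \<open>q\<close>-binomial coefficient, which the
  normalisation turns into the division by \<open>[n]\<close>.
\<close>

function below :: "bool list \<Rightarrow> nat \<Rightarrow> 'a" where
  "below w s =
    (if False \<in> set w then
       (\<Sum>i | i < s \<and> i < length w \<and> \<not> w ! i.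
          (\<Sum>j\<le>length w - 1.
             q ^ balls (drop j (remove_at i w)) * below (take j (remove_at i w)) i *
             (below (drop j (remove_at i w)) (length w - 1 - j) - below (drop j (remove_at i w)) (i - j)))
          / qn (balls w))
     else if w = [True] \<and> 0 < s then 1 else 0)"
  by auto
termination by (relation "measure (\<lambda>(w, s). length w)") (auto simp: remove_at_def min_def)

declare below.simps [simp del]

abbreviation total where "total w \<equiv> below w (length w)"

definition above :: "bool list \<Rightarrow> nat \<Rightarrow> 'a" where "above w s = total w - below w s"

text \<open>
  The contribution to \<open>below\<close> of the trees whose root is a ball inserted into \<open>w\<close> at the cut \<open>s\<close>.
\<close>

definition root_weight :: "bool list \<Rightarrow> nat \<Rightarrow> 'a" where
  "root_weight w s = splits w (\<lambda>a b. q ^ balls b * below a s * above b (s - length a)) / qn (Suc (balls w))"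

lemma balls_remove: "i < length w \<Longrightarrow> \<not> w ! i \<Longrightarrow> Suc (balls (remove_at i w)) = balls w"
proof -
  assume "i < length w" "\<not> w ! i"
  then have "w = take i w @ False # drop (Suc i) w" using id_take_nth_drop by force
  then have "balls w = balls (take i w @ False # drop (Suc i) w)" by simp
  then show ?thesis by (simp add: remove_at_def)
qed

lemma length_remove: "i < length w \<Longrightarrow> length (remove_at i w) = length w - 1"
  by (simp add: remove_at_def)

lemma below_ball:
  assumes "False \<in> set w"
  shows "below w s = (\<Sum>i | i < s \<and> i < length w \<and> \<not> w ! i. root_weight (remove_at i w) i)"
proof -
  have "(\<Sum>j\<le>length w - 1.
             q ^ balls (drop j (remove_at i w)) * below (take j (remove_at i w)) i *
             (below (drop j (remove_at i w)) (length w - 1 - j) - below (drop j (remove_at i w)) (i - j)))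
          / qn (balls w) = root_weight (remove_at i w) i"
    if "i < length w" "\<not> w ! i" for i
  proof -
    have l: "length (remove_at i w) = length w - 1" using that by (simp add: length_remove)
    show ?thesis
      unfolding root_weight_def splits_def balls_remove[OF that] l above_def
      by (intro arg_cong2[of _ _ _ _ "(/)"] refl sum.cong)
         (use l that in \<open>auto simp: min_def\<close>)
  qed
  then show ?thesis using assms by (subst below.simps) (auto intro!: sum.cong)
qed

lemma below_no_ball:
  assumes "False \<notin> set w"
  shows "below w s = (if w = [True] \<and> 0 < s then 1 else 0)"
  using assms by (subst below.simps) auto

lemma below_0 [simp]: "below w 0 = 0"
  by (cases "False \<in> set w") (simp_all add: below_ball below_no_ball)

lemma below_saturated: "length w \<le> s \<Longrightarrow> below w s = total w"
proof (cases "False \<in> set w")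
  case True
  assume "length w \<le> s"
  then show ?thesis using True
    by (auto simp: below_ball intro!: sum.cong)
next
  case False
  assume "length w \<le> s"
  then show ?thesis using False by (auto simp: below_no_ball)
qed

lemma below_beyond [simp]: "length w < s \<Longrightarrow> below w s = total w"
  by (rule below_saturated) simp

lemma below_plus [simp]: "below w (length w + k) = total w" "below w (k + length w) = total w"
  by (rule below_saturated, simp)+

lemma below_Nil [simp]: "below [] s = 0" by (simp add: below_no_ball)

lemma below_leaf [simp]: "below [True] s = (if 0 < s then 1 else 0)" by (simp add: below_no_ball)

lemma above_saturated [simp]: "length w \<le> s \<Longrightarrow> above w s = 0"
  using below_saturated[of w s] by (simp add: above_def)

lemma above_0 [simp]: "above w 0 = total w" by (simp add: above_def)

lemma above_Nil [simp]: "above [] s = 0" by (simp add: above_def)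

lemma root_weight_0 [simp]: "root_weight w 0 = 0" by (simp add: root_weight_def splits_def)

lemma root_weight_saturated: "length w \<le> s \<Longrightarrow> root_weight w s = 0"
  by (auto simp add: root_weight_def splits_def intro!: sum.neutral)

lemma below_Suc:
  assumes "w \<noteq> [True]"
  shows "below w (Suc s) = below w s + (if s < length w \<and> \<not> w ! s then root_weight (remove_at s w) s else 0)"
proof (cases "False \<in> set w")
  case True
  have "{i. i < Suc s \<and> i < length w \<and> \<not> w ! i} =
    (if s < length w \<and> \<not> w ! s then insert s {i. i < s \<and> i < length w \<and> \<not> w ! i} else {i. i < s \<and> i < length w \<and> \<not> w ! i})"
    by (auto simp: less_Suc_eq)
  then show ?thesis by (simp add: below_ball[OF True] add.commute)
next
  case False
  then have "\<not> (s < length w \<and> \<not> w ! s)" using nth_mem by force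
  then show ?thesis using False assms by (auto simp: below_no_ball)
qed

text \<open>
  The first and the last letter of the word of a tree are leaves: a split that deletes a ball at
  an end of the word leaves an empty side, and any other split leaves the end untouched.
\<close>

lemma below_edges:
  "(w = [] \<or> \<not> hd w \<or> \<not> last w) \<Longrightarrow> below w s = 0"
proof (induction "length w" arbitrary: w s rule: less_induct)
  case less
  consider "w = []" | "w \<noteq> []" "\<not> hd w" | "w \<noteq> []" "hd w" "\<not> last w" using less.prems by blast
  then show ?case
  proof cases
    case 2
    have False: "False \<in> set w" using 2 hd_in_set by force
    have "root_weight (remove_at i w) i = 0" if i: "i < length w" "\<not> w ! i" for i
    proof (cases i)
      case (Suc i')
      let ?v = "remove_at i w"
      have l: "length ?v = length w - 1" using i by (simp add: length_remove)
      have "hd ?v = hd w" using 2 Suc i by (cases w) (auto simp: remove_at_def)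
      have "below (take j ?v) i = 0" for j
        using 2 \<open>hd ?v = hd w\<close> l i by (intro less.hyps) (cases j; cases ?v; auto)+
      then show ?thesis by (simp add: root_weight_def splits_def)
    qed simp
    then show ?thesis by (auto simp: below_ball[OF False])
  next
    case 3
    have False: "False \<in> set w" using 3 last_in_set by force
    have "root_weight (remove_at i w) i = 0" if i: "i < length w" "\<not> w ! i" for i
    proof (cases "Suc i = length w")
      case True
      then show ?thesis using i by (intro root_weight_saturated) (simp add: length_remove)
    next
      case False
      let ?v = "remove_at i w"
      have l: "length ?v = length w - 1" using i by (simp add: length_remove)
      have lv: "last ?v = last w" using 3 False i by (auto simp: remove_at_def)
      have z: "below (drop j ?v) t = 0" for j t
        using 3 l i lv by (intro less.hyps) (cases "j < length ?v"; auto simp: last_drop)+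
      have "above (drop j ?v) t = 0" for j t
        unfolding above_def using z by simp
      then show ?thesis by (simp add: root_weight_def splits_def)
    qed
    then show ?thesis by (auto simp: below_ball[OF False])
  qed simp
qed

lemma above_edges: "(w = [] \<or> \<not> hd w \<or> \<not> last w) \<Longrightarrow> above w s = 0"
  by (simp add: above_def below_edges)

lemma below_Suc_leaf:
  assumes "w ! s" "s < length w" "w \<noteq> [True]"
  shows "below w (Suc s) = below w s"
  using assms by (simp add: below_Suc)

lemma below_cross_leaf:
  assumes "u \<noteq> [] \<or> v \<noteq> []"
  shows "below (u @ True # v) (Suc (length u)) = below (u @ True # v) (length u)"
  using assms by (subst below_Suc) (auto simp: append_eq_Cons_conv)

text \<open>
  How \<open>below\<close> changes as the cut moves is the tool of all later proofs: the cut passes a leaf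
  freely, and it picks up \<open>root_weight\<close> when it passes a ball.
\<close>

lemma below_cross_ball:
  "below (u @ False # v) (Suc (length u)) = below (u @ False # v) (length u) + root_weight (u @ v) (length u)"
  by (subst below_Suc) (auto simp: append_eq_Cons_conv remove_at_def)

lemma above_cross_ball:
  "above (u @ False # v) (Suc (length u)) = above (u @ False # v) (length u) - root_weight (u @ v) (length u)"
  unfolding above_def below_cross_ball by simp

lemma above_cross_leaf:
  assumes "u \<noteq> [] \<or> v \<noteq> []"
  shows "above (u @ True # v) (Suc (length u)) = above (u @ True # v) (length u)"
  using below_cross_leaf[OF assms] by (simp add: above_def)

lemma splits_cross_ball_below:
  "splits (u @ False # v) (\<lambda>x y. below x (Suc (length u)) * f y) =
   splits (u @ False # v) (\<lambda>x y. below x (length u) * f y) +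
   splits (u @ v) (\<lambda>x y. root_weight x (length u) * f y)"
proof -
  have 1: "splits u (\<lambda>x y. below x (Suc (length u)) * f (y @ False # v)) =
    splits u (\<lambda>x y. below x (length u) * f (y @ False # v))"
    by (rule splits_cong) (auto simp: below_beyond)
  have 2: "splits u (\<lambda>x y. root_weight x (length u) * f (y @ v)) = splits u (\<lambda>x y. 0 * f y)"
    by (rule splits_cong) (auto simp: root_weight_saturated)
  have 3: "splits v (\<lambda>x y. below (u @ False # x) (Suc (length u)) * f y) =
    splits v (\<lambda>x y. below (u @ False # x) (length u) * f y) + splits v (\<lambda>x y. root_weight (u @ x) (length u) * f y)"
    unfolding splits_add[symmetric] by (simp add: below_cross_ball distrib_right)
  show ?thesis
    unfolding splits_append splits_Cons 1 2 3
    by (simp add: root_weight_saturated)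
qed

lemma splits_cross_ball_above:
  "splits (u @ False # v) (\<lambda>x y. f x * above y (Suc (length u) - length x)) =
   splits (u @ False # v) (\<lambda>x y. f x * above y (length u - length x)) -
   splits (u @ v) (\<lambda>x y. f x * root_weight y (length u - length x))"
proof -
  have 1: "splits u (\<lambda>x y. f x * above (y @ False # v) (Suc (length u) - length x)) =
    splits u (\<lambda>x y. f x * above (y @ False # v) (length u - length x)) -
    splits u (\<lambda>x y. f x * root_weight (y @ v) (length u - length x))"
    unfolding splits_diff[symmetric]
  proof (rule splits_cong)
    fix a b assume "a @ b = u"
    then show "f a * above (b @ False # v) (Suc (length u) - length a) =
      f a * above (b @ False # v) (length u - length a) - f a * root_weight (b @ v) (length u - length a)"
      by (auto simp: above_cross_ball algebra_simps Suc_diff_le)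
  qed
  show ?thesis
    unfolding splits_append splits_Cons
    unfolding 1 by simp
qed

text \<open>
  Discrete product rule: of the two factors in each split, one contains the ball that the cut passes.
\<close>

lemma root_weight_cross_ball:
  "root_weight (u @ False # v) (Suc (length u)) = root_weight (u @ False # v) (length u) +
   splits (u @ v) (\<lambda>x y. q ^ balls y * root_weight x (length u) * above y (length u - length x) -
     q ^ Suc (balls y) * below x (length u) * root_weight y (length u - length x)) / qn (Suc (Suc (balls (u @ v))))"
proof -
  let ?s = "length u"
  let ?\<phi> = "\<lambda>s a b. q ^ balls b * below a s * above b (s - length a)"
  have 1: "splits u (\<lambda>a b. ?\<phi> (Suc ?s) a (b @ False # v)) =
    splits u (\<lambda>a b. ?\<phi> ?s a (b @ False # v)) -
    splits u (\<lambda>a b. q ^ Suc (balls (b @ v)) * below a ?s * root_weight (b @ v) (?s - length a))"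
    unfolding splits_diff[symmetric]
  proof (rule splits_cong)
    fix a b assume ab: "a @ b = u"
    then have "below a (Suc ?s) = total a" "below a ?s = total a"
      by (intro below_saturated, force)+
    then show "?\<phi> (Suc ?s) a (b @ False # v) = ?\<phi> ?s a (b @ False # v) -
      q ^ Suc (balls (b @ v)) * below a ?s * root_weight (b @ v) (?s - length a)"
      using ab by (auto simp: above_cross_ball algebra_simps Suc_diff_le)
  qed
  have 2: "splits v (\<lambda>a b. ?\<phi> (Suc ?s) (u @ False # a) b) =
    splits v (\<lambda>a b. ?\<phi> ?s (u @ False # a) b) + splits v (\<lambda>a b. q ^ balls b * root_weight (u @ a) ?s * total b)"
    by (simp add: splits_add[symmetric] below_cross_ball algebra_simps)
  have 3: "splits u (\<lambda>a b. q ^ balls (b @ v) * root_weight a ?s * above (b @ v) (?s - length a) -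
       q ^ Suc (balls (b @ v)) * below a ?s * root_weight (b @ v) (?s - length a)) =
     - splits u (\<lambda>a b. q ^ Suc (balls (b @ v)) * below a ?s * root_weight (b @ v) (?s - length a))"
  proof -
    have "splits u (\<lambda>a b. q ^ balls (b @ v) * root_weight a ?s * above (b @ v) (?s - length a)) = splits u (\<lambda>a b. 0 * 0)"
      by (rule splits_cong) (auto simp: root_weight_saturated)
    then show ?thesis by (simp add: splits_diff splits_mult)
  qed
  have 4: "splits (u @ False # v) (?\<phi> (Suc ?s)) = splits (u @ False # v) (?\<phi> ?s) +
    splits (u @ v) (\<lambda>x y. q ^ balls y * root_weight x ?s * above y (?s - length x) -
     q ^ Suc (balls y) * below x ?s * root_weight y (?s - length x))"
    unfolding splits_append splits_Cons 1 3 append_Nil2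
    using 2 by (simp add: root_weight_saturated)
  show ?thesis unfolding root_weight_def[of "u @ False # v"] 4 by (simp add: add_divide_distrib)
qed

lemma splits_cross_leaf_below:
  assumes "w ! s" "s < length w"
  shows "splits w (\<lambda>x y. below x (Suc s) * f x y) = splits w (\<lambda>x y. below x s * f x y) +
    (if s = 0 then f [True] (tl w) else 0)"
proof (cases s)
  case 0
  then obtain v where w: "w = True # v" using assms by (cases w) auto
  have "splits v (\<lambda>x y. below (True # x) (Suc 0) * f (True # x) y) = f [True] v"
  proof (cases v)
    case (Cons c v')
    have *: "below (True # c # x) (Suc 0) = 0" for x by (subst below_Suc) auto
    show ?thesis unfolding Cons splits_Cons * by (simp add: splits_mult)
  qed simp
  then show ?thesis unfolding w 0 splits_Cons by (simp add: splits_mult)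
next
  case (Suc s')
  have "splits w (\<lambda>x y. below x (Suc s) * f x y) = splits w (\<lambda>x y. below x s * f x y)"
  proof (rule splits_cong)
    fix a b assume ab: "a @ b = w"
    have "below a (Suc s) = below a s"
    proof (cases "a = [True]")
      case False
      then show ?thesis using assms ab by (subst below_Suc) (auto simp: nth_append)
    qed (use Suc in simp)
    then show "below a (Suc s) * f a b = below a s * f a b" by simp
  qed
  then show ?thesis using Suc by simp
qed

lemma splits_cross_leaf_above:
  assumes "w ! s" "s < length w"
  shows "splits w (\<lambda>x y. f x y * above y (Suc s - length x)) = splits w (\<lambda>x y. f x y * above y (s - length x)) -
    (if Suc s = length w then f (butlast w) [True] else 0)"
proof -
  have "take s w @ True # drop (Suc s) w = w"
    using assms(1) id_take_nth_drop[OF assms(2)] by metis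
  moreover have "length (take s w) = s" using assms by simp
  ultimately obtain u v where w: "w = u @ True # v" and u: "length u = s" by metis
  have 1: "splits u (\<lambda>x y. f x (y @ True # v) * above (y @ True # v) (Suc s - length x)) =
    splits u (\<lambda>x y. f x (y @ True # v) * above (y @ True # v) (s - length x)) - (if v = [] then f u [True] else 0)"
  proof (cases v)
    case Nil
    have "above (y @ [True]) (Suc s - length x) = 0" if "x @ y = u" for x y using that u by auto
    then have "splits u (\<lambda>x y. f x (y @ True # v) * above (y @ True # v) (Suc s - length x)) = splits u (\<lambda>a b. 0 * 0)"
      using Nil by (intro splits_cong) auto
    also have "\<dots> = 0" by (simp only: splits_mult) simp
    finally have z: "splits u (\<lambda>x y. f x (y @ True # v) * above (y @ True # v) (Suc s - length x)) = 0" .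
    show ?thesis
    proof (cases u rule: rev_cases)
      case (snoc u' c)
      have "above (y @ c # [True]) (Suc (length u') - length x) = 0" if "x @ y = u'" for x y
      proof -
        have "above ((y @ [c]) @ True # []) (Suc (length (y @ [c]))) = above ((y @ [c]) @ True # []) (length (y @ [c]))"
          by (rule above_cross_leaf) simp
        moreover have "length u' = length x + length y" using that by auto
        ultimately show ?thesis by simp
      qed
      then have "splits u' (\<lambda>x y. f x (y @ [c, True]) * above (y @ c # [True]) (Suc (length u') - length x)) = splits u' (\<lambda>a b. 0 * 0)"
        by (intro splits_cong) auto
      also have "\<dots> = 0" by (simp only: splits_mult) simp
      finally show ?thesis using z Nil snoc u by (simp add: splits_snoc above_def)
    qed (use z Nil u in \<open>simp add: above_def\<close>)
  next
    case (Cons c v')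
    have "splits u (\<lambda>x y. f x (y @ True # v) * above (y @ True # v) (Suc s - length x)) =
    splits u (\<lambda>x y. f x (y @ True # v) * above (y @ True # v) (s - length x))"
    proof (rule splits_cong)
      fix a b assume "a @ b = u"
      then show "f a (b @ True # v) * above (b @ True # v) (Suc s - length a) =
        f a (b @ True # v) * above (b @ True # v) (s - length a)"
        using above_cross_leaf[of b v] Cons u by (auto simp: Suc_diff_le)
    qed
    then show ?thesis using Cons by simp
  qed
  have 2: "splits v (\<lambda>a. (\<lambda>b. f (u @ True # a) b * above b (Suc s - length (u @ True # a)))) =
    splits v (\<lambda>a b. f (u @ True # a) b * above b (s - length (u @ True # a)))"
    using u by simp
  show ?thesis unfolding w splits_append splits_Cons
    unfolding 1 2 by (simp add: u butlast_append)
qed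

text \<open>
  Only a subtree that is a single leaf notices when the cut passes a leaf. It is the left
  subtree if the leaf is the first letter, and the right subtree if it is the last.
\<close>

lemma root_weight_cross_leaf:
  assumes "w ! s" "s < length w"
  shows "root_weight w (Suc s) = root_weight w s + ((if s = 0 then q ^ balls w * total (tl w) else 0) -
    (if Suc s = length w then total (butlast w) else 0)) / qn (Suc (balls w))"
proof -
  have "splits w (\<lambda>a b. below a (Suc s) * (q ^ balls b * above b (Suc s - length a))) =
    splits w (\<lambda>a b. below a s * (q ^ balls b * above b (Suc s - length a))) +
    (if s = 0 then q ^ balls (tl w) * total (tl w) else 0)"
    by (subst splits_cross_leaf_below[OF assms]) simp
  moreover have "splits w (\<lambda>a b. (below a s * q ^ balls b) * above b (Suc s - length a)) =
    splits w (\<lambda>a b. (below a s * q ^ balls b) * above b (s - length a)) -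
    (if Suc s = length w then total (butlast w) else 0)"
  proof -
    have "below (butlast w) s = total (butlast w)" if "Suc s = length w"
      by (rule below_saturated) (use that in simp)
    then show ?thesis by (subst splits_cross_leaf_above[OF assms]) auto
  qed
  moreover have "balls (tl w) = balls w" if "s = 0" using that assms by (cases w) auto
  ultimately have "splits w (\<lambda>a b. q ^ balls b * below a (Suc s) * above b (Suc s - length a)) =
    splits w (\<lambda>a b. q ^ balls b * below a s * above b (s - length a)) +
    ((if s = 0 then q ^ balls w * total (tl w) else 0) - (if Suc s = length w then total (butlast w) else 0))"
    by (auto simp: mult_ac)
  then show ?thesis by (simp add: root_weight_def add_divide_distrib)
qed

lemma splits_root_weight:
  "splits w (\<lambda>a b. q ^ balls b * (below a s * above b (s - length a))) = qn (Suc (balls w)) * root_weight w s"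
  by (simp add: root_weight_def mult.assoc)

section \<open>A ball next to the first or last leaf\<close>

text \<open>
  Since \<open>root_weight z s\<close> vanishes unless the cut \<open>s\<close> falls inside \<open>z\<close>, what follows \<open>z\<close> lies behind the cut.
\<close>

lemma root_weight_times_total_above:
  "c * root_weight z s * above y (s - length z) = c * root_weight z s * total y"
  by (cases "length z \<le> s") (simp_all add: root_weight_saturated)

lemma total_times_root_weight:
  "c * below x s * root_weight y (s - length x) = c * total x * root_weight y (s - length x)"
proof (cases "length x \<le> s")
  case True
  show ?thesis by (simp only: below_saturated[OF True])
qed simp

text \<open>
  Expansion of a word whose last ball directly precedes its last leaf. For \<open>s > length a\<close> the
  correction term vanishes, and the statement expresses the total weight of \<open>a @ [False, True]\<close>
  through shorter words.
  Both sides vanish at \<open>s = 0\<close>. When the cut passes a ball of \<open>a\<close>, the change of the left side is a sum over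
  splits to which the statement for shorter words applies; this gives cuts into
  three pieces, and \<open>[m + n] = [n] + q\<^sup>n [m]\<close> matches the coefficients. When the cut passes the last ball, the
  left side grows by just the correction term.
\<close>

lemma last_ball:
  "below (a @ [False, True]) s =
    splits a (\<lambda>x y. below x s * (q ^ balls y / qn (Suc (balls y)) * total (y @ [True]))) - root_weight (a @ [True]) s"
proof (induction "length a" arbitrary: a s rule: less_induct)
  case less
  let ?g = "\<lambda>y. q ^ balls y / qn (Suc (balls y)) * total (y @ [True])"
  (* The cut is taken through a, letter by letter. *)
  have initial: "below (a @ [False, True]) s = splits a (\<lambda>x y. below x s * ?g y) - root_weight (a @ [True]) s"
    if "s \<le> length a" for s
    using that
  proof (induction s)
    case (Suc s)
    then have s: "s < length a" by simp
    define u v where "u = take s a" and "v = drop (Suc s) a"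
    have a: "a = u @ a ! s # v" and u: "length u = s"
      using s id_take_nth_drop[of s a] by (simp_all add: u_def v_def)
    show ?case
    proof (cases "a ! s")
      case True
      have 1: "below (a @ [False, True]) (Suc s) = below (a @ [False, True]) s"
        using True s by (intro below_Suc_leaf) (auto simp: nth_append)
      have 2: "root_weight (a @ [True]) (Suc s) = root_weight (a @ [True]) s + (if s = 0 then ?g (tl a) else 0)"
      proof -
        have "s = 0 \<Longrightarrow> balls (tl a) = balls a" using True s by (cases a) auto
        then show ?thesis
          using True s by (subst root_weight_cross_leaf) (auto simp: nth_append)
      qed
      show ?thesis unfolding 1 2 splits_cross_leaf_below[OF True s] using Suc by simp
    next
      case False
      define a0 where "a0 = u @ v"
      have a: "a = u @ False # v" using a False by simp
      have l0: "length a0 < length a" by (simp add: a a0_def)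
      have 1: "below (a @ [False, True]) (Suc s) = below (a @ [False, True]) s + root_weight (a0 @ [False, True]) s"
        using below_cross_ball[of u "v @ [False, True]"] by (simp add: a u[symmetric] a0_def)
      have 2: "splits a (\<lambda>x y. below x (Suc s) * ?g y) = splits a (\<lambda>x y. below x s * ?g y) + splits a0 (\<lambda>x y. root_weight x s * ?g y)"
        unfolding a u[symmetric] a0_def by (rule splits_cross_ball_below)
      let ?N = "qn (Suc (Suc (balls a0)))"
      have 3: "root_weight (a @ [True]) (Suc s) = root_weight (a @ [True]) s +
        splits a0 (\<lambda>x y. q ^ balls y * root_weight x s * total (y @ [True])  -
          q ^ Suc (balls y) * below x s * root_weight (y @ [True]) (s - length x)) / ?N"
        using root_weight_cross_ball[of u "v @ [True]"] unfolding append_assoc[symmetric] splits_snoc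
        by (simp add: a u[symmetric] a0_def root_weight_saturated root_weight_times_total_above)
      have IH: "above (y @ [False, True]) t =
        splits y (\<lambda>x y. above x t * ?g y) + root_weight (y @ [True]) t" if "length y \<le> length a0" "t \<le> length y" for y t
      proof -
        have ly: "length y < length a" using that l0 by simp
        have t: "total (y @ [False, True]) = splits y (\<lambda>x' y'. total x' * ?g y')"
        proof -
          have "splits y (\<lambda>x y'. below x (Suc (Suc (length y))) * ?g y') = splits y (\<lambda>x y. total x * ?g y)"
          proof (rule splits_cong)
            fix a b assume "a @ b = y"
            then have "length a \<le> Suc (Suc (length y))" by auto
            then show "below a (Suc (Suc (length y))) * ?g b = total a * ?g b"
              by (simp only: below_saturated[OF \<open>length a \<le> Suc (Suc (length y))\<close>])
          qed
          then show ?thesis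
            using less.hyps[of y "length y + 2", OF ly] by (simp add: root_weight_saturated)
        qed
        show ?thesis
          unfolding above_def t left_diff_distrib splits_diff
          using less.hyps[of y t, OF ly] that by simp
      qed
      (* It remains to expand the change of the left side. The sum over x, x', y' with
         x @ x' = z collapses to the root weight of z. *)
      have 4: "?N * root_weight (a0 @ [False, True]) s =
         splits a0 (\<lambda>x y. q ^ Suc (balls y) * below x s * above (y @ [False, True]) (s - length x))"
      proof -
        have "below (a0 @ [False]) s = 0" by (intro below_edges) simp
        then show ?thesis unfolding root_weight_def
          using splits_middle[of "[False, True]" a0 "[]"] by (simp add: below_edges)
      qed
      also have "\<dots> = splits a0 (\<lambda>x y. splits y (\<lambda>x' y'. q ^ Suc (balls y) * below x s * (above x' (s - length x) * ?g y'))
           + q ^ Suc (balls y) * below x s * root_weight (y @ [True]) (s - length x))"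
      proof (rule splits_cong)
        fix x y assume "x @ y = a0"
        then have "length x + length y = length a0" by auto
        moreover have "s \<le> length a0" by (simp add: a0_def u)
        ultimately have "length y \<le> length a0" "s - length x \<le> length y" by simp_all
        show "q ^ Suc (balls y) * below x s * above (y @ [False, True]) (s - length x) =
          splits y (\<lambda>x' y'. q ^ Suc (balls y) * below x s * (above x' (s - length x) * ?g y'))
           + q ^ Suc (balls y) * below x s * root_weight (y @ [True]) (s - length x)"
          unfolding IH[OF \<open>length y \<le> length a0\<close> \<open>s - length x \<le> length y\<close>] splits_mult distrib_left ..
      qed
      also have "\<dots> = splits a0 (\<lambda>x y. splits y (\<lambda>x' y'. q ^ Suc (balls y) * below x s * (above x' (s - length x) * ?g y')))
           + splits a0 (\<lambda>x y. q ^ Suc (balls y) * below x s * root_weight (y @ [True]) (s - length x))"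
        by (simp only: splits_add)
      also have "splits a0 (\<lambda>x y. splits y (\<lambda>x' y'. q ^ Suc (balls y) * below x s * (above x' (s - length x) * ?g y'))) =
        splits a0 (\<lambda>x y. splits y (\<lambda>x' y'. (q ^ Suc (balls y') * ?g y') * (q ^ balls x' * (below x s * above x' (s - length x)))))"
      proof (intro splits_cong)
        fix x y x' y' :: "bool list" assume y: "x' @ y' = y"
        show "q ^ Suc (balls y) * below x s * (above x' (s - length x) * ?g y') =
          (q ^ Suc (balls y') * ?g y') * (q ^ balls x' * (below x s * above x' (s - length x)))"
          unfolding y[symmetric] count_list_append power_Suc power_add by (simp only: mult_ac)
      qed
      also have "\<dots> = splits a0 (\<lambda>z y'. splits z (\<lambda>x x'. (q ^ Suc (balls y') * ?g y') * (q ^ balls x' * (below x s * above x' (s - length x)))))"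
        by (rule splits_assoc[symmetric])
      also have "\<dots> = splits a0 (\<lambda>z y'. root_weight z s * ?g y' * (q ^ Suc (balls y') * qn (Suc (balls z))))"
        unfolding splits_mult splits_root_weight by (simp add: mult_ac)
      also have "\<dots> = splits a0 (\<lambda>z y'. ?N * (root_weight z s * ?g y') - q ^ balls y' * root_weight z s * total (y' @ [True]))"
      proof (rule splits_cong)
        fix z y assume "z @ y = a0"
        then have "?N = qn (Suc (balls z) + Suc (balls y))" by auto
        then have N: "?N = qn (Suc (balls y)) + q ^ Suc (balls y) * qn (Suc (balls z))" by (simp only: qn_add)
        show "root_weight z s * ?g y * (q ^ Suc (balls y) * qn (Suc (balls z))) = ?N * (root_weight z s * ?g y) - q ^ balls y * root_weight z s * total (y @ [True])"
          unfolding N by (simp add: field_simps)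
      qed
      finally have "?N * root_weight (a0 @ [False, True]) s = ?N * splits a0 (\<lambda>z y'. root_weight z s * ?g y') -
        splits a0 (\<lambda>x y. q ^ balls y * root_weight x s * total (y @ [True]) -
          q ^ Suc (balls y) * below x s * root_weight (y @ [True]) (s - length x))"
        unfolding splits_diff splits_mult by simp
      then have "root_weight (a0 @ [False, True]) s = splits a0 (\<lambda>z y'. root_weight z s * ?g y') -
        splits a0 (\<lambda>x y. q ^ balls y * root_weight x s * total (y @ [True]) -
          q ^ Suc (balls y) * below x s * root_weight (y @ [True]) (s - length x)) / ?N"
        by (simp add: field_simps)
      then show ?thesis unfolding 1 2 3 using Suc by simp
    qed
  qed simp
  show ?case
  proof (cases "s \<le> length a")
    case False
    then have s: "length a < s" by simp
    have "below (a @ [False, True]) s = below (a @ [False, True]) (Suc (length a))"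
    proof (cases "s = Suc (length a)")
      case False
      then have "below (a @ [False, True]) s = below (a @ [False, True]) (Suc (Suc (length a)))"
        using s below_saturated[of "a @ [False, True]" s] by simp
      then show ?thesis using below_cross_leaf[of "a @ [False]" "[]"] by simp
    qed simp
    also have "\<dots> = below (a @ [False, True]) (length a) + root_weight (a @ [True]) (length a)"
      by (rule below_cross_ball)
    also have "\<dots> = splits a (\<lambda>x y. below x (length a) * ?g y)"
      by (simp add: initial)
    also have "\<dots> = splits a (\<lambda>x y. below x s * ?g y)"
    proof (rule splits_cong)
      fix x y assume "x @ y = a"
      then have "length x \<le> length a" "length x \<le> s" using s by auto
      then show "below x (length a) * ?g y = below x s * ?g y"
        using below_saturated[of x s] below_saturated[of x "length a"] by metis
    qed
    finally show ?thesis using s by (simp add: root_weight_saturated)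
  qed (rule initial)
qed

text \<open>
  The mirror image of \<open>last_ball\<close>: the first ball directly follows the first leaf, and the cut
  moves from right to left.
\<close>

lemma first_ball_within:
  assumes "t \<le> length b"
  shows "above (True # False # b) (Suc (Suc t)) =
    splits b (\<lambda>x y. total (True # x) / qn (Suc (balls x)) * above y (t - length x)) - root_weight (True # b) (Suc t)"
  using assms
proof (induction "length b" arbitrary: b t rule: less_induct)
  case less
  let ?h = "\<lambda>x. total (True # x) / qn (Suc (balls x))"
  show ?case using less.prems
  proof (induction rule: inc_induct)
    case base
    have "splits b (\<lambda>x y. ?h x * above y (length b - length x)) = splits b (\<lambda>x y. 0)"
    proof (rule splits_cong)
      fix x y assume "x @ y = b"
      then have "length y \<le> length b - length x" by auto
      then show "?h x * above y (length b - length x) = 0" by (simp only: above_saturated mult_zero_right)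
    qed
    then show ?case by (simp add: root_weight_saturated)
  next
    case (step t)
    then have t: "t < length b" by simp
    define u v where "u = take t b" and "v = drop (Suc t) b"
    have b: "b = u @ b ! t # v" and u: "length u = t"
      using t id_take_nth_drop[of t b] by (simp_all add: u_def v_def)
    show ?case
    proof (cases "b ! t")
      case True
      have 1: "above (True # False # b) (Suc (Suc (Suc t))) = above (True # False # b) (Suc (Suc t))"
        using above_cross_leaf[of "True # False # u" v] True u b by simp
      have 2: "root_weight (True # b) (Suc (Suc t)) = root_weight (True # b) (Suc t) -
        (if Suc t = length b then ?h (butlast b) else 0)"
      proof -
        have "balls (butlast b) = balls b" if "Suc t = length b"
          using that True t by (cases b rule: rev_cases) auto
        then show ?thesis using root_weight_cross_leaf[of "True # b" "Suc t"] True t by auto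
      qed
      show ?thesis using step.IH unfolding 1 2 splits_cross_leaf_above[OF True t]
        by (simp add: algebra_simps split: if_splits)
    next
      case False
      define b0 where "b0 = u @ v"
      have b: "b = u @ False # v" using b False by simp
      have l0: "length b0 < length b" by (simp add: b b0_def)
      have 1: "above (True # False # b) (Suc (Suc t)) = above (True # False # b) (Suc (Suc (Suc t))) + root_weight (True # False # b0) (Suc (Suc t))"
        using above_cross_ball[of "True # False # u" v] by (simp add: b u[symmetric] b0_def)
      have 2: "splits b (\<lambda>x y. ?h x * above y (Suc t - length x)) =
        splits b (\<lambda>x y. ?h x * above y (t - length x)) - splits b0 (\<lambda>x y. ?h x * root_weight y (t - length x))"
        unfolding b u[symmetric] b0_def by (rule splits_cross_ball_above)
      let ?N = "qn (Suc (Suc (balls b0)))"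
      have 3: "root_weight (True # b) (Suc (Suc t)) = root_weight (True # b) (Suc t) +
        splits b0 (\<lambda>x y. q ^ balls y * root_weight (True # x) (Suc t) * above y (t - length x) -
          q ^ Suc (balls y) * total (True # x) * root_weight y (t - length x)) / ?N"
      proof -
        have *: "c * below (True # x) (Suc t) * root_weight y (t - length x) = c * total (True # x) * root_weight y (t - length x)" for c x y
          using total_times_root_weight[of c "True # x" "Suc t" y] by simp
        show ?thesis
          using root_weight_cross_ball[of "True # u" v]
          by (simp add: b u[symmetric] b0_def splits_Cons root_weight_saturated *[unfolded u[symmetric]])
      qed
      have IH: "below (True # False # x) (Suc (Suc t)) =
        splits x (\<lambda>x' y'. ?h x' * below y' (t - length x')) + root_weight (True # x) (Suc t)"
        if "length x \<le> length b0" for x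
      proof -
        have lx: "length x < length b" using that l0 by simp
        have tot: "total (True # False # x) = splits x (\<lambda>x' y'. ?h x' * total y')"
        proof -
          have "below (True # False # x) (Suc (Suc 0)) = root_weight (True # x) (Suc 0)"
            using below_cross_leaf[of "[]" "False # x"] below_cross_ball[of "[True]" x] by simp
          then show ?thesis using less.hyps[of x 0, OF lx] by (simp add: above_def)
        qed
        show ?thesis
        proof (cases "t \<le> length x")
          case True
          have "below (True # False # x) (Suc (Suc t)) = total (True # False # x) - above (True # False # x) (Suc (Suc t))"
            by (simp add: above_def)
          also have "\<dots> = splits x (\<lambda>x' y'. ?h x' * total y' - ?h x' * above y' (t - length x')) + root_weight (True # x) (Suc t)"
            unfolding tot splits_diff less.hyps[OF lx True] by simp
          also have "splits x (\<lambda>x' y'. ?h x' * total y' - ?h x' * above y' (t - length x')) = splits x (\<lambda>x' y'. ?h x' * below y' (t - length x'))"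
            by (simp add: above_def right_diff_distrib)
          finally show ?thesis .
        next
          case False
          have "splits x (\<lambda>x' y'. ?h x' * total y') = splits x (\<lambda>x' y'. ?h x' * below y' (t - length x'))"
          proof (rule splits_cong)
            fix a c assume "a @ c = x"
            then have "length c \<le> t - length a" using False by auto
            then show "?h a * total c = ?h a * below c (t - length a)"
              by (simp only: below_saturated[OF \<open>length c \<le> t - length a\<close>])
          qed
          moreover have "below (True # False # x) (Suc (Suc t)) = total (True # False # x)"
            by (rule below_saturated) (use False in simp)
          ultimately show ?thesis unfolding tot using False by (simp add: root_weight_saturated)
        qed
      qed
      have "?N * root_weight (True # False # b0) (Suc (Suc t)) =
        splits b0 (\<lambda>x y. q ^ balls y * below (True # False # x) (Suc (Suc t)) * above y (t - length x))"
        using splits_middle[of "[True, False]" "[]" b0] unfolding root_weight_def by (simp add: above_edges)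
      also have "\<dots> = splits b0 (\<lambda>x y. splits x (\<lambda>x' y'. q ^ balls y * (?h x' * below y' (t - length x')) * above y (t - length x)) +
        q ^ balls y * root_weight (True # x) (Suc t) * above y (t - length x))"
      proof (rule splits_cong)
        fix x y assume "x @ y = b0"
        then have "length x \<le> length b0" by auto
        show "q ^ balls y * below (True # False # x) (Suc (Suc t)) * above y (t - length x) =
          splits x (\<lambda>x' y'. q ^ balls y * (?h x' * below y' (t - length x')) * above y (t - length x)) +
          q ^ balls y * root_weight (True # x) (Suc t) * above y (t - length x)"
          unfolding IH[OF \<open>length x \<le> length b0\<close>] splits_mult splits_mult_right distrib_left distrib_right ..
      qed
      also have "\<dots> = splits b0 (\<lambda>x y. splits x (\<lambda>x' y'. q ^ balls y * (?h x' * below y' (t - length x')) * above y (t - length x))) +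
        splits b0 (\<lambda>x y. q ^ balls y * root_weight (True # x) (Suc t) * above y (t - length x))"
        by (simp only: splits_add)
      also have "splits b0 (\<lambda>x y. splits x (\<lambda>x' y'. q ^ balls y * (?h x' * below y' (t - length x')) * above y (t - length x))) =
        splits b0 (\<lambda>x y. splits x (\<lambda>x' y'. ?h x' * (q ^ balls y * (below y' (t - length x') * above y (t - length x' - length y')))))"
      proof (intro splits_cong)
        fix x y x' y' :: "bool list" assume x: "x' @ y' = x"
        have "t - length x = t - length x' - length y'" using x by auto
        then show "q ^ balls y * (?h x' * below y' (t - length x')) * above y (t - length x) =
          ?h x' * (q ^ balls y * (below y' (t - length x') * above y (t - length x' - length y')))"
          by (simp only: mult_ac)
      qed
      also have "\<dots> = splits b0 (\<lambda>x' z. ?h x' * (qn (Suc (balls z)) * root_weight z (t - length x')))"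
        unfolding splits_assoc splits_mult splits_root_weight ..
      also have "\<dots> = splits b0 (\<lambda>x z. ?N * (?h x * root_weight z (t - length x)) - q ^ Suc (balls z) * total (True # x) * root_weight z (t - length x))"
      proof (rule splits_cong)
        fix x z assume "x @ z = b0"
        then have "?N = qn (Suc (balls x) + Suc (balls z))" by auto
        then have N: "?N = qn (Suc (balls z)) + q ^ Suc (balls z) * qn (Suc (balls x))" by (simp only: qn_add)
        show "?h x * (qn (Suc (balls z)) * root_weight z (t - length x)) = ?N * (?h x * root_weight z (t - length x)) - q ^ Suc (balls z) * total (True # x) * root_weight z (t - length x)"
          unfolding N by (simp add: field_simps)
      qed
      finally have "?N * root_weight (True # False # b0) (Suc (Suc t)) = ?N * splits b0 (\<lambda>x z. ?h x * root_weight z (t - length x)) +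
        splits b0 (\<lambda>x y. q ^ balls y * root_weight (True # x) (Suc t) * above y (t - length x) -
          q ^ Suc (balls y) * total (True # x) * root_weight y (t - length x))"
        unfolding splits_diff splits_mult by simp
      then have 4: "root_weight (True # False # b0) (Suc (Suc t)) = splits b0 (\<lambda>x z. ?h x * root_weight z (t - length x)) +
        splits b0 (\<lambda>x y. q ^ balls y * root_weight (True # x) (Suc t) * above y (t - length x) -
          q ^ Suc (balls y) * total (True # x) * root_weight y (t - length x)) / ?N"
        by (simp add: field_simps)
      show ?thesis using step.IH unfolding 1 2 3 4 by simp
    qed
  qed
qed

lemma first_ball_total:
  "total (True # False # b) = splits b (\<lambda>x y. total (True # x) / qn (Suc (balls x)) * total y)"
proof -
  have "below (True # False # b) (Suc (Suc 0)) = root_weight (True # b) (Suc 0)"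
    using below_cross_leaf[of "[]" "False # b"] below_cross_ball[of "[True]" b] by simp
  then show ?thesis using first_ball_within[of 0 b] by (simp add: above_def)
qed

lemma first_ball:
  "above (True # False # b) (Suc (Suc t)) =
    splits b (\<lambda>x y. total (True # x) / qn (Suc (balls x)) * above y (t - length x)) - root_weight (True # b) (Suc t)"
proof (cases "t \<le> length b")
  case False
  have "splits b (\<lambda>x y. total (True # x) / qn (Suc (balls x)) * above y (t - length x)) = splits b (\<lambda>x y. 0)"
  proof (rule splits_cong)
    fix x y assume "x @ y = b"
    then have "length y \<le> t - length x" using False by auto
    then show "total (True # x) / qn (Suc (balls x)) * above y (t - length x) = 0" by (simp only: above_saturated mult_zero_right)
  qed
  then show ?thesis using False by (simp add: root_weight_saturated)
qed (rule first_ball_within)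

section \<open>Moving a leaf past a ball\<close>

text \<open>
  In the notation of words let \<open>L\<close> be a leaf, \<open>o\<close> a ball and \<open>z = o L - L o\<close> the formal difference that
  exchanges a leaf with a ball. The combination studied here is \<open>L o\<^sup>d z - q z o\<^sup>d L\<close>. Expanding \<open>z\<close> gives
  the three words \<open>ball_inside d\<close> (twice), \<open>ball_right d\<close> and \<open>ball_left d\<close>.
\<close>

abbreviation ball_inside :: "nat \<Rightarrow> bool list" where
  "ball_inside d \<equiv> True # replicate (Suc d) False @ [True]"

abbreviation ball_right :: "nat \<Rightarrow> bool list" where
  "ball_right d \<equiv> True # replicate d False @ [True, False]"

abbreviation ball_left :: "nat \<Rightarrow> bool list" where
  "ball_left d \<equiv> False # True # replicate d False @ [True]"

text \<open>
  Value of a functional of words with a cut at \<open>a (L o\<^sup>d z - q z o\<^sup>d L) b\<close>. The cut position is \<open>s\<close> in the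
  terms of \<open>L o\<^sup>d z\<close> and \<open>s'\<close> in those of \<open>z o\<^sup>d L\<close>: a cut inside \<open>o\<^sup>d\<close> has one letter \<open>L\<close> before it
  in the former, but the two letters of \<open>z\<close> in the latter.
\<close>

definition relator :: "(bool list \<Rightarrow> nat \<Rightarrow> 'a) \<Rightarrow> bool list \<Rightarrow> nat \<Rightarrow> bool list \<Rightarrow> nat \<Rightarrow> nat \<Rightarrow> 'a" where
  "relator f a d b s s' =
    f (a @ ball_inside d @ b) s - f (a @ ball_right d @ b) s
    - q * f (a @ ball_left d @ b) s' + q * f (a @ ball_inside d @ b) s'"

text \<open>
  The cut lies in front of the combination, between the balls of \<open>o\<^sup>d\<close> (after \<open>e\<close> of them), or behind it;
  it never separates the two letters of \<open>z\<close>.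
\<close>

definition admissible :: "bool list \<Rightarrow> nat \<Rightarrow> nat \<Rightarrow> nat \<Rightarrow> bool" where
  "admissible a d s s' \<longleftrightarrow> s = s' \<and> s \<le> length a \<or> (\<exists>e\<le>d. s = length a + 1 + e \<and> s' = Suc s) \<or> s = s' \<and> length a + d + 3 \<le> s"

text \<open>
  The claimed value. For \<open>d > 0\<close> it vanishes; for \<open>d = 0\<close> it factors at the place where the two leaves
  meet. The functional is applied to each factor in turn. If the cut lies behind \<open>a @ [True]\<close>, the first summand
  sees all of this word in front of it. The subtraction \<open>s' - length a - 2\<close>, truncated at
  zero, is the position of the cut within \<open>True # b\<close>.
\<close>

definition relator_value :: "(bool list \<Rightarrow> nat \<Rightarrow> 'a) \<Rightarrow> bool list \<Rightarrow> nat \<Rightarrow> bool list \<Rightarrow> nat \<Rightarrow> nat \<Rightarrow> 'a" where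
  "relator_value f a d b s s' = (if d = 0 then
     q ^ Suc (balls b) / qn (Suc (balls b)) * (f (a @ [True]) s * total (True # b)) +
     1 / qn (Suc (balls a)) * (total (a @ [True]) * f (True # b) (s' - length a - 2)) else 0)"

lemma admissible_drop:
  assumes "admissible a d s s'" "x @ y = a"
  shows "admissible y d (s - length x) (s' - length x)"
  using assms unfolding admissible_def by auto

lemma relator_above:
  assumes "\<And>s s'. admissible a d s s' \<Longrightarrow> relator below a d b s s' = relator_value below a d b s s'"
  assumes "admissible a d s s'"
  shows "relator above a d b s s' = relator_value above a d b s s'"
proof -
  let ?S = "length a + d + 3 + length b"
  have "admissible a d ?S ?S" by (simp add: admissible_def)
  note 1 = assms(1)[OF this]
  have L: "length (a @ ball_inside d @ b) = ?S"
    "length (a @ ball_right d @ b) = ?S"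
    "length (a @ ball_left d @ b) = ?S" by simp_all
  have "relator above a d b s s' = relator below a d b ?S ?S - relator below a d b s s'"
    unfolding relator_def above_def L by (simp only: algebra_simps)
  also have "\<dots> = relator_value below a d b ?S ?S - relator_value below a d b s s'"
    unfolding 1 assms(1)[OF assms(2)] ..
  also have "\<dots> = relator_value above a d b s s'"
  proof -
    have "below (a @ [True]) ?S = total (a @ [True])" by (rule below_saturated) simp
    moreover have "below (True # b) (?S - length a - 2) = total (True # b)" by (rule below_saturated) simp
    ultimately show ?thesis unfolding relator_value_def above_def by (simp only: algebra_simps) simp
  qed
  finally show ?thesis .
qed

lemma nth_ball_run: "\<not> (False # replicate n False @ v) ! n"
proof -
  have "(replicate (Suc n) False @ v) ! n = False" by (subst nth_append) (simp del: replicate_Suc)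
  then show ?thesis by simp
qed

text \<open>
  The step of the induction. Split each word in two. A split inside \<open>a\<close> or inside \<open>b\<close> leaves
  the combination intact in one of the parts, where it is already known; a split strictly inside the combination can
  only separate two adjacent leaves, since parts must start and end with leaves, and this requires
  \<open>d = 0\<close>. In that case \<open>last_ball\<close> and \<open>first_ball\<close> cancel these inner splits, and
  \<open>[m + n] = [n] + q\<^sup>n [m]\<close> gives the coefficients.
\<close>

lemma relator_root_weight:
  assumes IH: "\<And>a' b' s s'. length a' + length b' < length a + length b \<Longrightarrow> admissible a' d s s' \<Longrightarrow>
     relator below a' d b' s s' = relator_value below a' d b' s s'"
  assumes adm: "admissible a d s s'"
  shows "relator root_weight a d b s s' = relator_value root_weight a d b s s'"
proof -
  let ?m1 = "ball_inside d"
  let ?m2 = "ball_right d"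
  let ?m3 = "ball_left d"
  let ?\<phi> = "\<lambda>s x y. q ^ balls y * below x s * above y (s - length x)"
  let ?N = "qn (Suc (Suc (balls a + balls b + d)))"
  (* ?A, ?M and ?B collect the cuts of a @ m @ b inside a, strictly inside m, and inside b. *)
  let ?A = "\<lambda>s m. splits a (\<lambda>x y. ?\<phi> s x (y @ m @ b))"
  let ?B = "\<lambda>s m. splits b (\<lambda>x y. ?\<phi> s (a @ m @ x) y)"
  let ?M = "\<lambda>s m. \<Sum>j = 1..<length m. ?\<phi> s (a @ take j m) (drop j m @ b)"
  have rep: "balls (replicate k False) = k" for k by (induction k) auto
  have N: "?N * root_weight (a @ m @ b) s = ?A s m + ?M s m + ?B s m" if "m \<noteq> []" "balls m = Suc d" for m s
    unfolding root_weight_def splits_middle[OF that(1)] using that(2) by (simp add: add_ac)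
  have "?N * relator root_weight a d b s s' =
     (?A s ?m1 - ?A s ?m2 - q * ?A s' ?m3 + q * ?A s' ?m1) +
     (?M s ?m1 - ?M s ?m2 - q * ?M s' ?m3 + q * ?M s' ?m1) +
     (?B s ?m1 - ?B s ?m2 - q * ?B s' ?m3 + q * ?B s' ?m1)"
  proof -
    have "?N * relator root_weight a d b s s' = ?N * root_weight (a @ ?m1 @ b) s - ?N * root_weight (a @ ?m2 @ b) s
      - q * (?N * root_weight (a @ ?m3 @ b) s') + q * (?N * root_weight (a @ ?m1 @ b) s')"
      unfolding relator_def by (simp only: algebra_simps)
    also have "?N * root_weight (a @ ?m1 @ b) s = ?A s ?m1 + ?M s ?m1 + ?B s ?m1" by (rule N) (simp_all add: rep)
    also have "?N * root_weight (a @ ?m2 @ b) s = ?A s ?m2 + ?M s ?m2 + ?B s ?m2" by (rule N) (simp_all add: rep)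
    also have "?N * root_weight (a @ ?m3 @ b) s' = ?A s' ?m3 + ?M s' ?m3 + ?B s' ?m3" by (rule N) (simp_all add: rep)
    also have "?N * root_weight (a @ ?m1 @ b) s' = ?A s' ?m1 + ?M s' ?m1 + ?B s' ?m1" by (rule N) (simp_all add: rep)
    finally show ?thesis by (simp only: algebra_simps)
  qed
  also have "?A s ?m1 - ?A s ?m2 - q * ?A s' ?m3 + q * ?A s' ?m1 =
    splits a (\<lambda>x y. q ^ (Suc (balls b) + d + balls y) * below x s * relator above y d b (s - length x) (s' - length x))"
    unfolding splits_mult[symmetric] splits_diff[symmetric] splits_add[symmetric]
  proof (rule splits_cong)
    fix x y assume "x @ y = a"
    then have "below x s' = below x s" using adm below_saturated[of x s] below_saturated[of x s']
      unfolding admissible_def by auto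
    then show "?\<phi> s x (y @ ?m1 @ b) - ?\<phi> s x (y @ ?m2 @ b) - q * ?\<phi> s' x (y @ ?m3 @ b) + q * ?\<phi> s' x (y @ ?m1 @ b) =
      q ^ (Suc (balls b) + d + balls y) * below x s * relator above y d b (s - length x) (s' - length x)"
      unfolding relator_def by (simp add: rep power_add algebra_simps)
  qed
  also have "\<dots> = splits a (\<lambda>x y. q ^ (Suc (balls b) + d + balls y) * below x s * relator_value above y d b (s - length x) (s' - length x))"
  proof (rule splits_cong)
    fix x y assume xy: "x @ y = a"
    show "q ^ (Suc (balls b) + d + balls y) * below x s * relator above y d b (s - length x) (s' - length x) =
      q ^ (Suc (balls b) + d + balls y) * below x s * relator_value above y d b (s - length x) (s' - length x)"
    proof (cases "x = []")
      case False
      then have l: "length y + length b < length a + length b" using xy by auto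
      have "relator above y d b (s - length x) (s' - length x) = relator_value above y d b (s - length x) (s' - length x)"
        by (rule relator_above[OF IH[OF l] admissible_drop[OF adm xy]])
      then show ?thesis by simp
    qed simp
  qed
  also have "?B s ?m1 - ?B s ?m2 - q * ?B s' ?m3 + q * ?B s' ?m1 =
    splits b (\<lambda>x y. q ^ balls y * relator below a d x s s' * above y (s - (length a + d + 3 + length x)))"
    unfolding splits_mult[symmetric] splits_diff[symmetric] splits_add[symmetric]
  proof (rule splits_cong)
    fix x y assume "x @ y = b"
    have "s' - (length a + d + 3 + length x) = s - (length a + d + 3 + length x)"
      using adm unfolding admissible_def by auto
    then have "s' - length (a @ m @ x) = s - (length a + d + 3 + length x)"
      "s - length (a @ m @ x) = s - (length a + d + 3 + length x)" if "length m = d + 3" for m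
      using that by (simp_all add: add_ac)
    note * = this[of ?m1] this[of ?m2] this[of ?m3]
    show "?\<phi> s (a @ ?m1 @ x) y - ?\<phi> s (a @ ?m2 @ x) y - q * ?\<phi> s' (a @ ?m3 @ x) y + q * ?\<phi> s' (a @ ?m1 @ x) y =
      q ^ balls y * relator below a d x s s' * above y (s - (length a + d + 3 + length x))"
    proof -
      have "length ?m1 = d + 3" "length ?m2 = d + 3" "length ?m3 = d + 3" by simp_all
      note ** = *(1,2)[OF this(1)] *(3,4)[OF this(2)] *(5,6)[OF this(3)]
      show ?thesis unfolding ** relator_def by (simp only: algebra_simps)
    qed
  qed
  also have "\<dots> = splits b (\<lambda>x y. q ^ balls y * relator_value below a d x s s' * above y (s - (length a + d + 3 + length x)))"
  proof (rule splits_cong)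
    fix x y assume xy: "x @ y = b"
    show "q ^ balls y * relator below a d x s s' * above y (s - (length a + d + 3 + length x)) =
      q ^ balls y * relator_value below a d x s s' * above y (s - (length a + d + 3 + length x))"
    proof (cases "y = []")
      case False
      then have l: "length a + length x < length a + length b" using xy by auto
      show ?thesis by (simp only: IH[OF l adm])
    qed simp
  qed
  also have "?M s ?m1 - ?M s ?m2 - q * ?M s' ?m3 + q * ?M s' ?m1 = (if d = 0 then
     - (q ^ Suc (balls b) * below (a @ [True]) s * above (True # False # b) (s - length a - 1))
     - q * (q ^ balls b * below (a @ [False, True]) s' * above (True # b) (s' - length a - 2)) else 0)"
  proof -
    have z: "?\<phi> s (a @ take j m) (drop j m @ b) = 0" if "0 < j" "j < length m" "\<not> m ! (j - 1) \<or> \<not> m ! j" for s j m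
    proof -
      have "last (a @ take j m) = m ! (j - 1)" "a @ take j m \<noteq> []" using that by (auto simp: last_append last_conv_nth)
      moreover have "hd (drop j m @ b) = m ! j" "drop j m @ b \<noteq> []" using that by (auto simp: hd_append hd_drop_conv_nth)
      ultimately show ?thesis using that(3) below_edges[of "a @ take j m" s] above_edges[of "drop j m @ b" "s - length (a @ take j m)"] by auto
    qed
    have 1: "?M s ?m1 = 0" for s
    proof (rule sum.neutral, rule ballI)
      fix j assume "j \<in> {1..<length ?m1}"
      then have j: "0 < j" "j < d + 3" by auto
      show "?\<phi> s (a @ take j ?m1) (drop j ?m1 @ b) = 0"
      proof (rule z)
        show "\<not> ?m1 ! (j - 1) \<or> \<not> ?m1 ! j"
        proof (cases "j = Suc (Suc d)")
          case False
          then have "?m1 ! j = False" using j by (cases j) (auto simp: nth_append nth_Cons split: nat.splits)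
          then show ?thesis by simp
        qed (use nth_ball_run[of d "[True]"] in simp)
      qed (use j in auto)
    qed
    show ?thesis
    proof (cases d)
      case 0
      have "{Suc 0..<3} = {Suc 0, Suc (Suc 0)}" by auto
      then have I: "sum f {Suc 0..<3} = f (Suc 0) + f (Suc (Suc 0))" for f :: "nat \<Rightarrow> 'a" by simp
      have 2: "?M s ?m2 = q ^ Suc (balls b) * below (a @ [True]) s * above (True # False # b) (s - length a - 1)"
        using z[of "Suc (Suc 0)" ?m2 s] by (simp add: 0 I)
      have 3: "?M s' ?m3 = q ^ balls b * below (a @ [False, True]) s' * above (True # b) (s' - length a - 2)"
        using z[of "Suc 0" ?m3 s'] by (simp add: 0 I numeral_2_eq_2)
      show ?thesis unfolding 1 2 3 by (simp add: 0)
    next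
      case (Suc d')
      have 2: "?M s ?m2 = 0"
      proof (rule sum.neutral, rule ballI)
        fix j assume "j \<in> {1..<length ?m2}"
        then have j: "0 < j" "j < d + 3" by auto
        show "?\<phi> s (a @ take j ?m2) (drop j ?m2 @ b) = 0"
        proof (rule z)
          show "\<not> ?m2 ! (j - 1) \<or> \<not> ?m2 ! j"
          proof (cases "j = Suc d")
            case False
            then have "?m2 ! j = False" using j by (cases j) (auto simp: nth_append nth_Cons split: nat.splits)
            then show ?thesis by simp
          qed (use nth_ball_run[of d' "[True, False]"] Suc in simp)
        qed (use j in auto)
      qed
      have 3: "?M s' ?m3 = 0"
      proof (rule sum.neutral, rule ballI)
        fix j assume "j \<in> {1..<length ?m3}"
        then have j: "0 < j" "j < d + 3" by auto
        show "?\<phi> s' (a @ take j ?m3) (drop j ?m3 @ b) = 0"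
        proof (rule z)
          show "\<not> ?m3 ! (j - 1) \<or> \<not> ?m3 ! j"
          proof (cases "j = 1 \<or> j = d + 2")
            case True
            then show ?thesis using nth_ball_run[of d' "[True]"] by (auto simp: Suc)
          next
            case False
            then have "?m3 ! j = False" using j by (cases j) (auto simp: nth_append nth_Cons split: nat.splits)
            then show ?thesis by simp
          qed
        qed (use j in auto)
      qed
      show ?thesis unfolding 1 2 3 by (simp add: Suc)
    qed
  qed
  finally have main: "?N * relator root_weight a d b s s' =
    splits a (\<lambda>x y. q ^ (Suc (balls b) + d + balls y) * below x s * relator_value above y d b (s - length x) (s' - length x)) +
    (if d = 0 then
     - (q ^ Suc (balls b) * below (a @ [True]) s * above (True # False # b) (s - length a - 1))
     - q * (q ^ balls b * below (a @ [False, True]) s' * above (True # b) (s' - length a - 2)) else 0) +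
    splits b (\<lambda>x y. q ^ balls y * relator_value below a d x s s' * above y (s - (length a + d + 3 + length x)))" .
  show ?thesis
  proof (cases d)
    case (Suc d')
    then have "?N * relator root_weight a d b s s' = 0" using main by (simp add: relator_value_def)
    then show ?thesis using Suc by (simp add: relator_value_def)
  next
    case 0
    define \<sigma> where "\<sigma> = s' - length a - 2"
    let ?Q = "q ^ Suc (balls b)"
    let ?nb = "qn (Suc (balls b))"
    let ?na = "qn (Suc (balls a))"
    have xs: "below x s' = below x s" if "length x \<le> length a" for x
      using that adm below_saturated[of x s] below_saturated[of x s'] unfolding admissible_def by auto
    have A1: "splits a (\<lambda>x y. q ^ balls y * (below x s * above (y @ [True]) (s - length x))) = ?na * root_weight (a @ [True]) s"
      using splits_root_weight[of "a @ [True]" s] by (simp add: splits_snoc)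
    have A2: "splits a (\<lambda>x y. below x s * (q ^ balls y / qn (Suc (balls y)) * total (y @ [True]))) =
       below (a @ [False, True]) s' + root_weight (a @ [True]) s"
    proof -
      note last_ball[of a s']
      moreover have "splits a (\<lambda>x y. below x s' * (q ^ balls y / qn (Suc (balls y)) * total (y @ [True]))) =
        splits a (\<lambda>x y. below x s * (q ^ balls y / qn (Suc (balls y)) * total (y @ [True])))"
      proof (rule splits_cong)
        fix x y assume "x @ y = a"
        then have "length x \<le> length a" by auto
        then show "below x s' * (q ^ balls y / qn (Suc (balls y)) * total (y @ [True])) =
          below x s * (q ^ balls y / qn (Suc (balls y)) * total (y @ [True]))"
          by (simp only: xs)
      qed
      moreover have "root_weight (a @ [True]) s' = root_weight (a @ [True]) s"
        using adm by (auto simp: admissible_def root_weight_saturated)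
      ultimately show ?thesis by (simp add: algebra_simps)
    qed
    have A: "splits a (\<lambda>x y. q ^ (Suc (balls b) + d + balls y) * below x s * relator_value above y d b (s - length x) (s' - length x)) =
      ?Q * (?Q / ?nb * (?na * root_weight (a @ [True]) s) * total (True # b) + (below (a @ [False, True]) s' + root_weight (a @ [True]) s) * above (True # b) \<sigma>)"
      unfolding A1[symmetric] A2[symmetric] splits_mult[symmetric] splits_mult_right[symmetric] splits_add[symmetric]
    proof (rule splits_cong)
      fix x y assume "x @ y = a"
      then have "s' - length x - length y - 2 = \<sigma>" by (auto simp: \<sigma>_def)
      then show "q ^ (Suc (balls b) + d + balls y) * below x s * relator_value above y d b (s - length x) (s' - length x) =
         ?Q * (?Q / ?nb * (q ^ balls y * (below x s * above (y @ [True]) (s - length x))) * total (True # b) +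
          below x s * (q ^ balls y / qn (Suc (balls y)) * total (y @ [True])) * above (True # b) \<sigma>)"
        unfolding relator_value_def 0 by (simp add: power_add distrib_left mult_ac)
    qed
    have B1: "splits b (\<lambda>x y. total (True # x) / qn (Suc (balls x)) * above y (\<sigma> - Suc (length x))) =
       above (True # False # b) (s - length a - 1) + root_weight (True # b) \<sigma>"
    proof (cases \<sigma>)
      case z: 0
      then have "s - length a - 1 = 0" using adm by (auto simp: \<sigma>_def admissible_def 0)
      then show ?thesis using z first_ball_total by simp
    next
      case (Suc t)
      then have "s - length a - 1 = Suc (Suc t)" using adm by (auto simp: \<sigma>_def admissible_def 0)
      then show ?thesis using Suc first_ball[of b t] by simp
    qed
    have B2: "splits b (\<lambda>x y. q ^ balls y * (below (True # x) \<sigma> * above y (\<sigma> - Suc (length x)))) = ?nb * root_weight (True # b) \<sigma>"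
      using splits_root_weight[of "True # b" \<sigma>] by (simp add: splits_Cons)
    have B: "splits b (\<lambda>x y. q ^ balls y * relator_value below a d x s s' * above y (s - (length a + d + 3 + length x))) =
      ?Q * (below (a @ [True]) s * (above (True # False # b) (s - length a - 1) + root_weight (True # b) \<sigma>)) +
      1 / ?na * (total (a @ [True]) * (?nb * root_weight (True # b) \<sigma>))"
      unfolding B1[symmetric] B2[symmetric] splits_mult[symmetric] splits_mult_right[symmetric] splits_add[symmetric]
    proof (rule splits_cong)
      fix x y assume "x @ y = b"
      then have Q: "?Q = q * (q ^ balls x * q ^ balls y)" by (auto simp: power_add)
      have s: "s - (length a + d + 3 + length x) = \<sigma> - Suc (length x)"
        using adm by (auto simp: \<sigma>_def admissible_def 0)
      show "q ^ balls y * relator_value below a d x s s' * above y (s - (length a + d + 3 + length x)) =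
        ?Q * (below (a @ [True]) s * (total (True # x) / qn (Suc (balls x)) * above y (\<sigma> - Suc (length x)))) +
        1 / ?na * (total (a @ [True]) * (q ^ balls y * (below (True # x) \<sigma> * above y (\<sigma> - Suc (length x)))))"
        unfolding relator_value_def s Q \<sigma>_def[symmetric] using 0 by (simp add: distrib_left distrib_right mult_ac)
    qed
    (* A nonzero root weight locates the cut, so one factor is not affected by it. *)
    have C1: "root_weight (a @ [True]) s * above (True # b) \<sigma> = root_weight (a @ [True]) s * total (True # b)"
    proof (cases "s \<le> length a")
      case True
      then have "\<sigma> = 0" using adm by (auto simp: \<sigma>_def admissible_def)
      then show ?thesis by simp
    qed (simp add: root_weight_saturated)
    have C2: "below (a @ [True]) s * root_weight (True # b) \<sigma> = total (a @ [True]) * root_weight (True # b) \<sigma>"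
    proof (cases "\<sigma> = 0")
      case False
      then have "length (a @ [True]) \<le> s" using adm by (auto simp: \<sigma>_def admissible_def)
      then have "below (a @ [True]) s = total (a @ [True])" by (rule below_saturated)
      then show ?thesis by (simp only:)
    qed simp
    define ra rb Pa Pb where "ra = root_weight (a @ [True]) s" and "rb = root_weight (True # b) \<sigma>"
      and "Pa = total (a @ [True])" and "Pb = total (True # b)"
    define fa faf gb gbf where "fa = below (a @ [True]) s" and "faf = below (a @ [False, True]) s'"
      and "gb = above (True # b) \<sigma>" and "gbf = above (True # False # b) (s - length a - 1)"
    define Q where "Q = ?Q"
    have "?N * relator root_weight a d b s s' = Q * (Q / ?nb * (?na * ra) * Pb + (faf + ra) * gb) +
       (- (Q * fa * gbf) - q * (q ^ balls b * faf * gb)) +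
       (Q * (fa * (gbf + rb)) + 1 / ?na * (Pa * (?nb * rb)))"
      unfolding main A B \<sigma>_def[symmetric] ra_def[symmetric] rb_def[symmetric] Pa_def[symmetric] Pb_def[symmetric]
        fa_def[symmetric] faf_def[symmetric] gb_def[symmetric] gbf_def[symmetric] Q_def[symmetric] using 0 by simp
    also have "q * (q ^ balls b * faf * gb) = Q * (faf * gb)" by (simp add: Q_def)
    also have "Q * (Q / ?nb * (?na * ra) * Pb + (faf + ra) * gb) + (- (Q * fa * gbf) - Q * (faf * gb)) +
       (Q * (fa * (gbf + rb)) + 1 / ?na * (Pa * (?nb * rb))) =
       Q * (Q / ?nb * (?na * ra) * Pb + ra * gb + fa * rb) + 1 / ?na * (Pa * (?nb * rb))"
      by (simp only: algebra_simps) simp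
    also have "ra * gb = ra * Pb" unfolding ra_def gb_def Pb_def by (rule C1)
    also have "fa * rb = Pa * rb" unfolding fa_def rb_def Pa_def by (rule C2)
    finally have "?N * relator root_weight a d b s s' = ?Q * (?Q / ?nb * (?na * ra) * Pb + ra * Pb + Pa * rb) + 1 / ?na * (Pa * (?nb * rb))"
      unfolding Q_def .
    moreover have "?N = ?nb + ?Q * ?na"
      using qn_add[of "Suc (balls a)" "Suc (balls b)"] by (simp add: 0)
    ultimately have "?N * relator root_weight a d b s s' = ?N * (?Q / ?nb * (ra * Pb) + 1 / ?na * (Pa * rb))"
      by (simp only:) (simp add: field_simps)
    then have "relator root_weight a d b s s' = ?Q / ?nb * (ra * Pb) + 1 / ?na * (Pa * rb)"
      by (metis mult_left_cancel qn_nonzero)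
    then show ?thesis unfolding relator_value_def ra_def rb_def Pa_def Pb_def \<sigma>_def using 0 by simp
  qed
qed

lemma below_leaf_step:
  assumes "w = u @ True # v" "s = length u" "u \<noteq> [] \<or> v \<noteq> []"
  shows "below w (Suc s) = below w s"
  unfolding assms(1,2) by (rule below_cross_leaf[OF assms(3)])

lemma below_ball_step:
  assumes "w = u @ False # v" "s = length u" "u @ v = w'"
  shows "below w (Suc s) = below w s + root_weight w' s"
  unfolding assms(1,2) assms(3)[symmetric] by (rule below_cross_ball)

text \<open>
  The recurrence on words, by moving the cut from the far left, where everything vanishes, to the
  far right. Each ball that is passed contributes the same combination for \<open>root_weight\<close> of words with one ball
  less, which \<open>relator_root_weight\<close> evaluates. On entering and on leaving the combination the cut
  passes the ball of \<open>z\<close>, at two places that are separated by one leaf; by \<open>root_weight_cross_leaf\<close> the two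
  contributions cancel unless \<open>a\<close>, respectively \<open>b\<close>, is empty.
\<close>

theorem relator_below:
  assumes "admissible a d s s'"
  shows "relator below a d b s s' = relator_value below a d b s s'"
  using assms
proof (induction "length a + length b + d" arbitrary: a d b s s' rule: less_induct)
  case less
  have root_weight: "relator root_weight a' d' b' t t' = relator_value root_weight a' d' b' t t'"
    if "length a' + length b' + d' < length a + length b + d" "admissible a' d' t t'" for a' d' b' t t'
  proof (rule relator_root_weight)
    fix a'' b'' :: "bool list" and t t' assume "length a'' + length b'' < length a' + length b'" "admissible a'' d' t t'"
    then show "relator below a'' d' b'' t t' = relator_value below a'' d' b'' t t'"
      using that(1) by (intro less.hyps) auto
  qed fact
  let ?inside = "a @ ball_inside d @ b" and ?right = "a @ ball_right d @ b" and ?left = "a @ ball_left d @ b"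
  have rep: "replicate (Suc k) False = replicate i False @ False # replicate (k - i) False" if "i \<le> k" for i k
    using that by (metis Suc_diff_le le_add_diff_inverse replicate_Suc replicate_add add_Suc_right)
  have init: "relator below a d b s s = relator_value below a d b s s" if "s \<le> length a" for s
    using that
  proof (induction s)
    case 0
    show ?case by (simp add: relator_def relator_value_def)
  next
    case (Suc s)
    then have s: "s < length a" by simp
    define u v where "u = take s a" and "v = drop (Suc s) a"
    have a: "a = u @ a ! s # v" and u: "length u = s"
      using s id_take_nth_drop[of s a] by (simp_all add: u_def v_def)
    show ?case
    proof (cases "a ! s")
      case True
      have step: "below (a @ x) (Suc s) = below (a @ x) s" if "x \<noteq> []" for x
        by (rule below_leaf_step[of _ u "v @ x"]) (use a True u that in auto)
      have "relator below a d b (Suc s) (Suc s) = relator below a d b s s"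
        unfolding relator_def by (simp add: step)
      then show ?thesis using Suc by (simp add: relator_value_def step)
    next
      case False
      then have a: "a = u @ False # v" using a by simp
      have step: "below (a @ x) (Suc s) = below (a @ x) s + root_weight ((u @ v) @ x) s" for x
        by (rule below_ball_step[of _ u "v @ x"]) (use a u in auto)
      have "relator below a d b (Suc s) (Suc s) = relator below a d b s s + relator root_weight (u @ v) d b s s"
        unfolding relator_def step by (simp only: algebra_simps)
      also have "relator root_weight (u @ v) d b s s = relator_value root_weight (u @ v) d b s s"
        by (rule root_weight) (use a u in \<open>auto simp: admissible_def\<close>)
      finally show ?thesis using Suc unfolding relator_value_def step by (simp add: u distrib_left distrib_right)
    qed
  qed
  let ?X = "a @ True # replicate d False @ True # b"
  (* The cut enters the combination and moves through the balls between its leaves. *)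
  have mid: "relator below a d b (length a + 1 + e) (length a + 2 + e) =
    relator_value below a d b (length a + 1 + e) (length a + 2 + e)" if "e \<le> d" for e
    using that
  proof (induction e)
    case 0
    let ?n = "length a"
    have 1: "below ?inside (Suc ?n) = below ?inside ?n"
      by (rule below_leaf_step[of _ a]) auto
    have 2: "below ?right (Suc ?n) = below ?right ?n"
      by (rule below_leaf_step[of _ a]) auto
    have 3: "below ?left (Suc (Suc ?n)) =
       below ?left ?n + root_weight ?X ?n"
    proof -
      have "below ?left (Suc (Suc ?n)) = below ?left (Suc ?n)"
        by (rule below_leaf_step[of _ "a @ [False]"]) auto
      also have "\<dots> = below ?left ?n + root_weight ?X ?n"
        by (rule below_ball_step[of _ a]) auto
      finally show ?thesis .
    qed
    have 4: "below ?inside (Suc (Suc ?n)) =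
      below ?inside ?n + root_weight ?X (Suc ?n)"
      unfolding 1[symmetric] by (rule below_ball_step[of _ "a @ [True]"]) auto
    have 5: "q * (root_weight ?X (Suc ?n) - root_weight ?X ?n) = (if d = 0 \<and> a = [] then q ^ Suc (balls b) / qn (Suc (balls b)) * total (True # b) else 0)"
    proof -
      have "root_weight ?X (Suc ?n) - root_weight ?X ?n = (if a = [] then q ^ balls ?X * total (tl ?X) else 0) / qn (Suc (balls ?X))"
        by (subst root_weight_cross_leaf) auto
      note diff = this
      have z: "total (replicate d False @ True # b) = 0" if "d \<noteq> 0"
        using that by (intro below_edges) (cases d; auto)
      consider "a = []" "d = 0" | "a = []" "d \<noteq> 0" | "a \<noteq> []" by blast
      then show ?thesis
      proof cases
        case 1
        then show ?thesis using diff by simp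
      next
        case 2
        then show ?thesis using diff z[OF 2(2)] by simp
      next
        case 3
        then show ?thesis unfolding diff by simp
      qed
    qed
    have 6: "below (a @ [True]) (Suc ?n) = below (a @ [True]) ?n + (if a = [] then 1 else 0)"
    proof (cases "a = []")
      case False
      then have "below (a @ [True]) (Suc ?n) = below (a @ [True]) ?n" by (intro below_leaf_step[of _ a "[]"]) auto
      then show ?thesis using False by simp
    qed simp
    have "relator below a d b (?n + 1 + 0) (?n + 2 + 0) = relator below a d b ?n ?n + q * (root_weight ?X (Suc ?n) - root_weight ?X ?n)"
      unfolding relator_def using 1 2 3 4 by (simp add: algebra_simps)
    then show ?case unfolding init[of ?n, simplified] 5 relator_value_def by (simp add: 6 distrib_left distrib_right)
  next
    case (Suc e)
    then have e: "e \<le> d - 1" "d = Suc (d - 1)" by auto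
    define d' where "d' = d - 1"
    let ?inside' = "a @ ball_inside d' @ b" and ?right' = "a @ ball_right d' @ b" and ?left' = "a @ ball_left d' @ b"
    have d: "d = Suc d'" and e: "e \<le> d'" using e by (auto simp: d'_def)
    let ?s = "length a + 1 + e"
    have 1: "below ?inside (Suc ?s) =
      below ?inside ?s + root_weight ?inside' ?s"
    proof (rule below_ball_step)
      show "?inside = (a @ True # replicate e False) @ False # (replicate (d - e) False @ True # b)"
        using rep[of e d] e d by simp
      show "(a @ True # replicate e False) @ (replicate (d - e) False @ True # b) = a @ ball_inside d' @ b"
        using e d by (simp add: replicate_add[symmetric] del: replicate_Suc)
    qed simp
    have 2: "below ?right (Suc ?s) =
      below ?right ?s + root_weight ?right' ?s"
    proof (rule below_ball_step)
      show "?right = (a @ True # replicate e False) @ False # (replicate (d' - e) False @ True # False # b)"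
        using rep[of e d'] e d by simp
      show "(a @ True # replicate e False) @ (replicate (d' - e) False @ True # False # b) = a @ ball_right d' @ b"
        using e by (simp add: replicate_add[symmetric])
    qed simp
    have 3: "below ?left (Suc (Suc ?s)) =
      below ?left (Suc ?s) + root_weight ?left' (Suc ?s)"
    proof (rule below_ball_step)
      show "?left = (a @ False # True # replicate e False) @ False # (replicate (d' - e) False @ True # b)"
        using rep[of e d'] e d by simp
      show "(a @ False # True # replicate e False) @ (replicate (d' - e) False @ True # b) = a @ ball_left d' @ b"
        using e by (simp add: replicate_add[symmetric])
    qed simp
    have 4: "below ?inside (Suc (Suc ?s)) =
      below ?inside (Suc ?s) + root_weight ?inside' (Suc ?s)"
    proof (rule below_ball_step)
      show "?inside = (a @ True # replicate (Suc e) False) @ False # (replicate (d - Suc e) False @ True # b)"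
        using rep[of "Suc e" d] e d by simp
      show "(a @ True # replicate (Suc e) False) @ (replicate (d - Suc e) False @ True # b) = a @ ball_inside d' @ b"
        using e d by (simp add: replicate_add[symmetric] del: replicate_Suc)
    qed simp
    have "relator root_weight a d' b ?s (Suc ?s) = relator_value root_weight a d' b ?s (Suc ?s)"
      by (rule root_weight) (use e d in \<open>auto simp: admissible_def\<close>)
    also have "\<dots> = 0" using e by (cases "d' = 0") (simp_all add: relator_value_def root_weight_saturated)
    finally have 5: "relator root_weight a d' b ?s (Suc ?s) = 0" .
    have "relator below a d b (Suc ?s) (Suc (Suc ?s)) = relator below a d b ?s (Suc ?s) + relator root_weight a d' b ?s (Suc ?s)"
      unfolding relator_def 1 2 3 4 by (simp only: algebra_simps)
    then have "relator below a d b (Suc ?s) (Suc (Suc ?s)) = relator below a d b ?s (Suc ?s)"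
      unfolding 5 by simp
    then show ?case using Suc e d by (simp add: relator_value_def)
  qed
  (* The cut leaves the combination and moves through b. *)
  have final: "relator below a d b (length a + d + 3 + i) (length a + d + 3 + i) =
    relator_value below a d b (length a + d + 3 + i) (length a + d + 3 + i)" for i
  proof (induction i)
    case 0
    let ?s = "length a + 1 + d"
    have 1: "below ?inside (Suc (Suc ?s)) =
      below ?inside ?s + root_weight ?X ?s"
    proof -
      have "below ?inside (Suc (Suc ?s)) = below ?inside (Suc ?s)"
        by (rule below_leaf_step[of _ "a @ True # replicate (Suc d) False"]) auto
      also have "\<dots> = below ?inside ?s + root_weight ?X ?s"
        by (rule below_ball_step[of _ "a @ True # replicate d False"]) (auto simp: replicate_append_same)
      finally show ?thesis .
    qed
    have 2: "below ?right (Suc (Suc ?s)) =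
      below ?right ?s + root_weight ?X (Suc ?s)"
    proof -
      have "below ?right (Suc ?s) = below ?right ?s"
        by (rule below_leaf_step[of _ "a @ True # replicate d False"]) auto
      moreover have "below ?right (Suc (Suc ?s)) =
          below ?right (Suc ?s) + root_weight ?X (Suc ?s)"
        by (rule below_ball_step[of _ "a @ True # replicate d False @ [True]"]) auto
      ultimately show ?thesis by simp
    qed
    have 3: "below ?left (Suc (Suc ?s)) =
       below ?left (Suc ?s)"
      by (rule below_leaf_step[of _ "a @ False # True # replicate d False"]) auto
    have 4: "below ?inside (Suc (Suc ?s)) =
        below ?inside (Suc ?s)"
      by (rule below_leaf_step[of _ "a @ True # replicate (Suc d) False"]) auto
    have 5: "root_weight ?X ?s - root_weight ?X (Suc ?s) = (if d = 0 \<and> b = [] then 1 / qn (Suc (balls a)) * total (a @ [True]) else 0)"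
    proof -
      have "root_weight ?X (Suc ?s) = root_weight ?X ?s - (if b = [] then total (butlast ?X) else 0) / qn (Suc (balls ?X))"
        by (subst root_weight_cross_leaf) (auto simp: nth_append)
      note diff = this
      have z: "total (a @ True # replicate d False) = 0" if "d \<noteq> 0"
        using that by (intro below_edges) (auto simp: last_replicate)
      have X: "butlast ?X = a @ True # replicate d False" if "b = []" using that by (simp add: butlast_append)
      consider "b = []" "d = 0" | "b = []" "d \<noteq> 0" | "b \<noteq> []" by blast
      then show ?thesis
      proof cases
        case 1
        then show ?thesis unfolding diff X[OF 1(1)] by simp
      next
        case 2
        then show ?thesis unfolding diff X[OF 2(1)] z[OF 2(2)] by simp
      next
        case 3
        then show ?thesis unfolding diff by simp
      qed
    qed
    have 6: "below (True # b) (Suc 0) = (if b = [] then 1 else 0)"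
      using below_leaf_step[of "True # b" "[]" b 0] by auto
    have 7: "below (a @ [True]) ?s = total (a @ [True])" "below (a @ [True]) (Suc (Suc ?s)) = total (a @ [True])"
      by (rule below_saturated; simp)+
    have "relator below a d b (Suc (Suc ?s)) (Suc (Suc ?s)) = relator below a d b ?s (Suc ?s) + (root_weight ?X ?s - root_weight ?X (Suc ?s))"
      unfolding relator_def 3 4[symmetric] unfolding 1 2 by (simp only: algebra_simps)
    moreover have "length a + 2 + d = Suc ?s" "length a + d + 3 + 0 = Suc (Suc ?s)" by simp_all
    ultimately have "relator below a d b (length a + d + 3 + 0) (length a + d + 3 + 0) = relator_value below a d b ?s (Suc ?s) + (root_weight ?X ?s - root_weight ?X (Suc ?s))"
      using mid[of d] by (simp only:)
    also have "\<dots> = relator_value below a d b (Suc (Suc ?s)) (Suc (Suc ?s))"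
      unfolding 5 relator_value_def 7 by (simp add: 6)
    also have "Suc (Suc ?s) = length a + d + 3 + 0" by simp
    finally show ?case .
  next
    case (Suc i)
    let ?s = "length a + d + 3 + i"
    show ?case
    proof (cases "i < length b")
      case False
      have "below w (Suc ?s) = below w ?s" if "length w \<le> length a + d + 3 + length b" for w
        using that False below_saturated[of w ?s] below_saturated[of w "Suc ?s"] by simp
      then have "relator below a d b (Suc ?s) (Suc ?s) = relator below a d b ?s ?s"
        "relator_value below a d b (Suc ?s) (Suc ?s) = relator_value below a d b ?s ?s"
      proof -
        assume *: "\<And>w. length w \<le> length a + d + 3 + length b \<Longrightarrow> below w (Suc ?s) = below w ?s"
        show "relator below a d b (Suc ?s) (Suc ?s) = relator below a d b ?s ?s"
          unfolding relator_def by (subst (1 2 3 4) *) simp_all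
        have "below (True # b) (Suc ?s - length a - 2) = total (True # b)" "below (True # b) (?s - length a - 2) = total (True # b)"
          by (rule below_saturated; use False in simp)+
        moreover have "below (a @ [True]) (Suc ?s) = below (a @ [True]) ?s" by (rule *) simp
        ultimately show "relator_value below a d b (Suc ?s) (Suc ?s) = relator_value below a d b ?s ?s"
          unfolding relator_value_def by (simp only:)
      qed
      then show ?thesis using Suc by simp
    next
      case True
      define u v where "u = take i b" and "v = drop (Suc i) b"
      have b: "b = u @ b ! i # v" and u: "length u = i"
        using True id_take_nth_drop[of i b] by (simp_all add: u_def v_def)
      have 7: "below (a @ [True]) ?s = total (a @ [True])" "below (a @ [True]) (Suc ?s) = total (a @ [True])"
        by (rule below_saturated; simp)+
      have idx: "Suc ?s - length a - 2 = Suc (Suc (d + i))" "?s - length a - 2 = Suc (d + i)" by simp_all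
      show ?thesis
      proof (cases "b ! i")
        case True
        have step: "below (a @ x @ b) (Suc ?s) = below (a @ x @ b) ?s" if "length x = d + 3" for x
          by (rule below_leaf_step[of _ "a @ x @ u" v]) (use b True u that in auto)
        have "relator below a d b (Suc ?s) (Suc ?s) = relator below a d b ?s ?s"
          unfolding relator_def by (subst (1 2 3 4) step) simp_all
        moreover have "below (True # b) (Suc (Suc i)) = below (True # b) (Suc i)"
          by (rule below_leaf_step[of _ "True # u" v]) (use b True u in auto)
        ultimately show ?thesis using Suc unfolding relator_value_def 7 idx by (simp add: 7)
      next
        case False
        then have b: "b = u @ False # v" using b by simp
        have step: "below (a @ x @ b) (Suc ?s) = below (a @ x @ b) ?s + root_weight (a @ x @ (u @ v)) ?s" if "length x = d + 3" for x
          by (rule below_ball_step[of _ "a @ x @ u" v]) (use b u that in auto)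
        have "relator below a d b (Suc ?s) (Suc ?s) = relator below a d b ?s ?s + relator root_weight a d (u @ v) ?s ?s"
          unfolding relator_def by (subst (1 2 3 4) step) (simp_all add: algebra_simps)
        also have "relator root_weight a d (u @ v) ?s ?s = relator_value root_weight a d (u @ v) ?s ?s"
          by (rule root_weight) (use b u in \<open>auto simp: admissible_def\<close>)
        also have "root_weight (a @ [True]) ?s = 0" by (simp add: root_weight_saturated)
        moreover have "below (True # b) (Suc (Suc i)) = below (True # b) (Suc i) + root_weight (True # u @ v) (Suc i)"
          by (rule below_ball_step[of _ "True # u" v]) (use b u in auto)
        ultimately show ?thesis using Suc unfolding relator_value_def 7 idx
          by (simp add: 7 root_weight_saturated distrib_left distrib_right)
      qed
    qed
  qed
  show ?case
    using less.prems unfolding admissible_def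
  proof (elim disjE exE conjE)
    assume "s = s'" "s \<le> length a"
    then show ?thesis using init by simp
  next
    fix e assume "e \<le> d" "s = length a + 1 + e" "s' = Suc s"
    then show ?thesis using mid[of e] by simp
  next
    assume "s = s'" "length a + d + 3 \<le> s"
    then show ?thesis using final[of "s - (length a + d + 3)"] by simp
  qed
qed

end

section \<open>The recurrence for the tree weights\<close>

fun word :: "nat list \<Rightarrow> bool list" where
  "word [] = [True]"
| "word (k # d) = True # replicate k False @ word d"

lemma word_append: "word (d @ k # e) = word d @ replicate k False @ word e"
  by (induction d) simp_all

lemma word_nonempty [simp]: "word d \<noteq> []" by (cases d) simp_all
lemma hd_word: "hd (word d)" by (cases d) simp_all
lemma last_word: "last (word d)" by (induction d) simp_all

lemma count_replicate_False [simp]: "count_list (replicate k False) False = k"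
  by (induction k) simp_all

lemma count_replicate_True [simp]: "count_list (replicate k False) True = 0"
  by (induction k) simp_all

lemma balls_word: "count_list (word d) False = sum_list d"
  by (induction d) simp_all

lemma leaves_word: "count_list (word d) True = Suc (length d)"
  by (induction d) simp_all

lemma length_word: "length (word d) = Suc (length d + sum_list d)"
  by (induction d) simp_all

abbreviation increment :: "nat list \<Rightarrow> nat \<Rightarrow> nat list" where
  "increment d j \<equiv> d[j := Suc (d ! j)]"

context q_field
begin

text \<open>
  A binary tree has one leaf more than it has internal nodes.
\<close>

lemma below_unbalanced: "count_list w True \<noteq> Suc (balls w) \<Longrightarrow> below w s = 0"
proof (induction "length w" arbitrary: w s rule: less_induct)
  case less
  show ?case
  proof (cases "False \<in> set w")
    case True
    have "root_weight (remove_at i w) i = 0" if i: "i < length w" "\<not> w ! i" for i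
    proof -
      let ?v = "remove_at i w"
      have l: "length ?v < length w" using i by (simp add: length_remove)
      have "w = take i w @ False # drop (Suc i) w" using i id_take_nth_drop by force
      then have "count_list w True = count_list (take i w @ False # drop (Suc i) w) True" by simp
      then have v: "count_list ?v True \<noteq> balls ?v + 2"
        using less.prems balls_remove[OF i] by (simp add: remove_at_def)
      have "splits ?v (\<lambda>a b. q ^ balls b * below a i * above b (i - length a)) = splits ?v (\<lambda>a b. 0)"
      proof (rule splits_cong)
        fix a b assume ab: "a @ b = ?v"
        then have "count_list a True \<noteq> Suc (balls a) \<or> count_list b True \<noteq> Suc (balls b)"
          using v by (metis add_Suc add_Suc_right count_list_append add_2_eq_Suc')
        moreover have "length (a @ b) < length w" using ab l by simp
        ultimately have "below a i = 0 \<or> (\<forall>t. below b t = 0)" using less.hyps by auto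
        then show "q ^ balls b * below a i * above b (i - length a) = 0" by (auto simp: above_def)
      qed
      then show ?thesis by (simp add: root_weight_def)
    qed
    then show ?thesis by (simp add: below_ball[OF True])
  next
    case False
    then show ?thesis using less.prems by (auto simp: below_no_ball)
  qed
qed

definition content_total :: "nat list \<Rightarrow> 'a" where
  "content_total d = total (word d)"

lemma total_relation:
  "(1 + q) * total (a @ True # replicate (Suc d) False @ True # b) - total (a @ True # replicate d False @ True # False # b)
    - q * total (a @ False # True # replicate d False @ True # b) =
   (if d = 0 then qn (balls a + balls b + 2) / (qn (Suc (balls a)) * qn (Suc (balls b))) * (total (a @ [True]) * total (True # b)) else 0)"
proof -
  let ?S = "length a + d + 3 + length b"
  have L: "length (a @ ball_inside d @ b) = ?S"
    "length (a @ ball_right d @ b) = ?S"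
    "length (a @ ball_left d @ b) = ?S" by simp_all
  have 1: "below (a @ [True]) ?S = total (a @ [True])" by (rule below_saturated) simp
  have 2: "below (True # b) (?S - length a - 2) = total (True # b)" by (rule below_saturated) simp
  have "relator below a d b ?S ?S = relator_value below a d b ?S ?S"
    by (rule relator_below) (simp add: admissible_def)
  then have "total (a @ ball_inside d @ b) - total (a @ ball_right d @ b)
    - q * total (a @ ball_left d @ b) + q * total (a @ ball_inside d @ b) =
    (if d = 0 then q ^ Suc (balls b) / qn (Suc (balls b)) * (total (a @ [True]) * total (True # b)) +
     1 / qn (Suc (balls a)) * (total (a @ [True]) * total (True # b)) else 0)"
    unfolding relator_def relator_value_def L 1 2 .
  moreover have "q ^ Suc (balls b) / qn (Suc (balls b)) * X + 1 / qn (Suc (balls a)) * X =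
     qn (balls a + balls b + 2) / (qn (Suc (balls a)) * qn (Suc (balls b))) * X" for X
  proof -
    have "qn (balls a + balls b + 2) = qn (Suc (balls a) + Suc (balls b))" by simp
    also have "\<dots> = qn (Suc (balls b)) + q ^ Suc (balls b) * qn (Suc (balls a))" by (rule qn_add)
    finally have N: "qn (balls a + balls b + 2) = qn (Suc (balls b)) + q ^ Suc (balls b) * qn (Suc (balls a))" .
    show ?thesis unfolding N by (simp add: field_simps)
  qed
  moreover have "a @ ball_inside d @ b = a @ True # replicate (Suc d) False @ True # b"
    "a @ ball_right d @ b = a @ True # replicate d False @ True # False # b"
    "a @ ball_left d @ b = a @ False # True # replicate d False @ True # b" by simp_all
  moreover have "(1 + q) * t1 - t2 - q * t3 = t1 - t2 - q * t3 + q * t1" for t1 t2 t3 :: 'a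
    by (simp add: algebra_simps)
  ultimately show ?thesis by (simp only:)
qed

text \<open>
  The value at \<open>d\<close> with its \<open>j\<close>-th entry, counted from one, increased; the values beyond both ends are zero,
  in accordance with words that start or end with a ball.
\<close>

definition shifted_total :: "nat list \<Rightarrow> nat \<Rightarrow> 'a" where
  "shifted_total d j = (if 1 \<le> j \<and> j \<le> length d then content_total (increment d (j - 1)) else 0)"

lemma shifted_total_relation:
  assumes d: "d = dl @ k # dr"
  defines "i \<equiv> Suc (length dl)"
  shows "(1 + q) * shifted_total d i - q * shifted_total d (i - 1) - shifted_total d (Suc i) =
    (if k = 0 then qn (sum_list dl + sum_list dr + 2) / (qn (Suc (sum_list dl)) * qn (Suc (sum_list dr))) * (content_total dl * content_total dr) else 0)"
proof -
  obtain a where a: "word dl = a @ [True]" using last_word[of dl] by (metis append_butlast_last_id word_nonempty)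
  obtain b where b: "word dr = True # b" using hd_word[of dr] by (metis list.collapse word_nonempty)
  have ca: "balls a = sum_list dl" using arg_cong[OF a, of balls] by (simp add: balls_word)
  have cb: "balls b = sum_list dr" using arg_cong[OF b, of balls] by (simp add: balls_word)
  have 1: "shifted_total d i = total (a @ True # replicate (Suc k) False @ True # b)"
    unfolding shifted_total_def i_def d content_total_def by (simp add: word_append a b)
  have 2: "shifted_total d (Suc i) = total (a @ True # replicate k False @ True # False # b)"
  proof (cases dr)
    case Nil
    then have "b = []" using b by simp
    then have "total (a @ True # replicate k False @ True # False # b) = 0" by (intro below_edges) simp
    then show ?thesis using Nil by (simp add: shifted_total_def i_def d)
  next
    case (Cons k' dr')
    then have "b = replicate k' False @ word dr'" using b by simp
    then have "word (increment d i) = a @ True # replicate k False @ True # False # b"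
      unfolding d i_def Cons by (simp add: word_append a nth_append list_update_append)
    moreover have "shifted_total d (Suc i) = content_total (increment d i)"
      by (simp add: shifted_total_def Cons i_def d)
    ultimately show ?thesis by (simp only: content_total_def)
  qed
  have 3: "shifted_total d (i - 1) = total (a @ False # True # replicate k False @ True # b)"
  proof (cases dl rule: rev_cases)
    case Nil
    then have "a = []" using a by simp
    then have "total (a @ False # True # replicate k False @ True # b) = 0" by (intro below_edges) simp
    then show ?thesis using Nil by (simp add: shifted_total_def i_def)
  next
    case (snoc dl' k')
    then have A: "a = word dl' @ replicate k' False" using a by (simp add: word_append)
    have "word (increment d (i - 2)) = a @ False # True # replicate k False @ True # b"
      unfolding d i_def snoc A by (simp add: word_append nth_append list_update_append b replicate_append_same)
    moreover have "shifted_total d (i - 1) = content_total (increment d (i - 2))"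
    proof -
      have "1 \<le> i - 1 \<and> i - 1 \<le> length d" "i - 1 - 1 = i - 2" using snoc by (simp_all add: i_def d)
      then show ?thesis unfolding shifted_total_def by (simp only: simp_thms if_True)
    qed
    ultimately show ?thesis by (simp only: content_total_def)
  qed
  show ?thesis using total_relation[of a k b] unfolding 1 2 3 ca cb content_total_def a b by (simp only: algebra_simps)
qed

end

section \<open>Lagrange interpolation and Hall--Littlewood sums\<close>

lemma prod_linear:
  fixes c :: "'a :: field"
  assumes "finite S"
  shows "degree (\<Prod>y\<in>S. [:- y, c:]) \<le> card S \<and> coeff (\<Prod>y\<in>S. [:- y, c:]) (card S) = c ^ card S"
  using assms
proof (induction S rule: finite_induct)
  case (insert x S)
  let ?P = "\<Prod>y\<in>S. [:- y, c:]"
  have "degree ([:- x, c:] * ?P) \<le> 1 + degree ?P"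
    by (rule order_trans[OF degree_mult_le]) simp
  moreover have "coeff ?P (Suc (card S)) = 0" using insert by (intro coeff_eq_0) simp
  ultimately show ?case using insert by simp
qed simp

lemma lagrange_interpolation:
  fixes f :: "'a :: field poly"
  assumes "finite S" "degree f < card S"
  shows "f = (\<Sum>x\<in>S. smult (poly f x / (\<Prod>y\<in>S - {x}. x - y)) (\<Prod>y\<in>S - {x}. [:- y, 1:]))" (is "f = ?L")
proof (rule poly_eqI_degree[of S])
  fix z assume z: "z \<in> S"
  have "poly ?L z = (\<Sum>x\<in>S. poly f x / (\<Prod>y\<in>S - {x}. x - y) * (\<Prod>y\<in>S - {x}. z - y))"
    by (simp add: poly_sum poly_prod)
  also have "\<dots> = (\<Sum>x\<in>S. if x = z then poly f x else 0)"
  proof (rule sum.cong)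
    fix x assume "x \<in> S"
    show "poly f x / (\<Prod>y\<in>S - {x}. x - y) * (\<Prod>y\<in>S - {x}. z - y) = (if x = z then poly f x else 0)"
      using assms(1) z by (auto simp: prod_zero_iff)
  qed simp
  also have "\<dots> = poly f z" using z assms(1) by simp
  finally show "poly f z = poly ?L z" by simp
next
  have "degree (smult (poly f x / (\<Prod>y\<in>S - {x}. x - y)) (\<Prod>y\<in>S - {x}. [:- y, 1:])) \<le> card S - 1" if "x \<in> S" for x
    using prod_linear[of "S - {x}" 1] assms(1) that
    by (intro order_trans[OF degree_smult_le]) simp
  then have "degree ?L \<le> card S - 1" using assms(1) by (intro degree_sum_le) auto
  then show "card S > degree ?L" using assms(2) by simp
qed (use assms in auto)

text \<open>
  Compare the leading coefficients in the interpolation formula.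
\<close>

lemma lagrange_coeff:
  fixes f :: "'a :: field poly"
  assumes "finite S" "degree f < card S"
  shows "(\<Sum>x\<in>S. poly f x / (\<Prod>y\<in>S - {x}. x - y)) = coeff f (card S - 1)"
proof -
  have "coeff f (card S - 1) = (\<Sum>x\<in>S. poly f x / (\<Prod>y\<in>S - {x}. x - y) * coeff (\<Prod>y\<in>S - {x}. [:- y, 1:]) (card S - 1))"
    by (subst lagrange_interpolation[OF assms]) (simp add: coeff_sum)
  also have "\<dots> = (\<Sum>x\<in>S. poly f x / (\<Prod>y\<in>S - {x}. x - y))"
  proof (rule sum.cong)
    fix x assume "x \<in> S"
    then show "poly f x / (\<Prod>y\<in>S - {x}. x - y) * coeff (\<Prod>y\<in>S - {x}. [:- y, 1:]) (card S - 1) = poly f x / (\<Prod>y\<in>S - {x}. x - y)"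
      using prod_linear[of "S - {x}" 1] assms(1) by simp
  qed simp
  finally show ?thesis by simp
qed

text \<open>
  Interpolation of the constant polynomial 1, evaluated at \<open>t\<close>.
\<close>

lemma lagrange_one:
  fixes t :: "'a :: field"
  assumes "finite S" "S \<noteq> {}"
  shows "(\<Sum>x\<in>S. \<Prod>y\<in>S - {x}. (t - y) / (x - y)) = 1"
proof -
  have "degree (1 :: 'a poly) < card S" using assms by (simp add: card_gt_0_iff)
  from lagrange_interpolation[OF assms(1) this]
  have "poly (1 :: 'a poly) t = poly (\<Sum>x\<in>S. smult (poly 1 x / (\<Prod>y\<in>S - {x}. x - y)) (\<Prod>y\<in>S - {x}. [:- y, 1:])) t"
    by (rule arg_cong)
  also have "\<dots> = (\<Sum>x\<in>S. 1 / (\<Prod>y\<in>S - {x}. x - y) * (\<Prod>y\<in>S - {x}. t - y))"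
    by (simp add: poly_sum poly_prod)
  finally have "1 = (\<Sum>x\<in>S. 1 / (\<Prod>y\<in>S - {x}. x - y) * (\<Prod>y\<in>S - {x}. t - y))" by simp
  then show ?thesis by (simp add: prod_dividef)
qed

lemma sum_orderings_Cons:
  fixes f :: "'a list \<Rightarrow> 'b :: comm_monoid_add"
  assumes "finite S" "S \<noteq> {}"
  shows "(\<Sum>zs\<in>permutations_of_set S. f zs) = (\<Sum>x\<in>S. \<Sum>xs\<in>permutations_of_set (S - {x}). f (x # xs))"
proof -
  have "(\<Sum>zs\<in>permutations_of_set S. f zs) = (\<Sum>x\<in>S. \<Sum>zs\<in>(#) x ` permutations_of_set (S - {x}). f zs)"
    unfolding permutations_of_set_nonempty[OF assms(2)]
    using assms(1) by (intro sum.UNION_disjoint) auto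
  then show ?thesis by (simp add: sum.reindex)
qed

lemma sum_orderings_append:
  fixes f :: "'a list \<Rightarrow> 'a list \<Rightarrow> 'b :: comm_monoid_add"
  assumes "finite S" "i \<le> card S"
  shows "(\<Sum>zs\<in>permutations_of_set S. f (take i zs) (drop i zs)) =
    (\<Sum>I | I \<subseteq> S \<and> card I = i. \<Sum>xs\<in>permutations_of_set I. \<Sum>ys\<in>permutations_of_set (S - I). f xs ys)"
proof -
  let ?A = "{I. I \<subseteq> S \<and> card I = i}"
  have fin: "finite ?A" using assms(1) by simp
  have "(\<Sum>I\<in>?A. \<Sum>xs\<in>permutations_of_set I. \<Sum>ys\<in>permutations_of_set (S - I). f xs ys) =
    (\<Sum>I\<in>?A. \<Sum>(xs, ys)\<in>permutations_of_set I \<times> permutations_of_set (S - I). f xs ys)"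
    by (simp add: sum.cartesian_product)
  also have "\<dots> = (\<Sum>(I, xs, ys)\<in>(SIGMA I:?A. permutations_of_set I \<times> permutations_of_set (S - I)). f xs ys)"
    using fin assms(1) by (subst sum.Sigma) (auto intro: finite_subset)
  also have "\<dots> = (\<Sum>zs\<in>permutations_of_set S. f (take i zs) (drop i zs))"
  proof (rule sum.reindex_bij_witness[of _ "\<lambda>zs. (set (take i zs), take i zs, drop i zs)" "\<lambda>(I, xs, ys). xs @ ys"])
    fix zs assume zs: "zs \<in> permutations_of_set S"
    then have d: "distinct zs" "set zs = S" "length zs = card S"
      by (auto simp: permutations_of_set_def distinct_card)
    have u: "set (take i zs) \<union> set (drop i zs) = S" using d by (metis append_take_drop_id set_append)
    have dj: "set (take i zs) \<inter> set (drop i zs) = {}" using d(1) by (simp add: set_take_disj_set_drop_if_distinct)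
    have "card (set (take i zs)) = i" using d assms(2) by (simp add: distinct_card)
    then show "(set (take i zs), take i zs, drop i zs) \<in> (SIGMA I:?A. permutations_of_set I \<times> permutations_of_set (S - I))"
      using u dj d(1) by (auto simp: permutations_of_set_def)
  next
    fix w assume w: "w \<in> (SIGMA I:?A. permutations_of_set I \<times> permutations_of_set (S - I))"
    obtain I xs ys where w': "w = (I, xs, ys)" by (cases w)
    have I: "I \<subseteq> S" "card I = i" "distinct xs" "set xs = I" "distinct ys" "set ys = S - I"
      using w by (auto simp: w' permutations_of_set_def)
    have l: "length xs = i" using I(2,4) distinct_card[OF I(3)] by simp
    show "(set (take i (case w of (I, xs, ys) \<Rightarrow> xs @ ys)), take i (case w of (I, xs, ys) \<Rightarrow> xs @ ys), drop i (case w of (I, xs, ys) \<Rightarrow> xs @ ys)) = w"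
      using I l by (simp add: w')
    show "(case w of (I, xs, ys) \<Rightarrow> xs @ ys) \<in> permutations_of_set S"
      using I by (auto simp: w' permutations_of_set_def)
    show "f (take i (case w of (I, xs, ys) \<Rightarrow> xs @ ys)) (drop i (case w of (I, xs, ys) \<Rightarrow> xs @ ys)) = (case w of (I, xs, ys) \<Rightarrow> f xs ys)"
      using l by (simp add: w')
  qed simp
  finally show ?thesis by simp
qed

context q_field
begin

text \<open>
  Lagrange interpolation for the polynomial \<open>H\<close> given by
  \<open>t H(t) = (\<Prod>y\<in>S. q t - y) - (\<Prod>y\<in>S. t - y)\<close>. At a point \<open>x\<close> of \<open>S\<close> the second product vanishes, so
  that \<open>H x\<close> is \<open>(q - 1)\<close> times the product of \<open>q x - y\<close> over the other points \<open>y\<close>. The coefficient of degree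
  \<open>n - 1\<close> in \<open>H\<close> is \<open>q\<^sup>n - 1\<close>, where \<open>n\<close> is the size of \<open>S\<close>.
\<close>

lemma sum_leading_factors:
  assumes S: "finite S" "0 \<notin> S" and q: "q \<noteq> 1"
  shows "(\<Sum>x\<in>S. \<Prod>y\<in>S - {x}. (q * x - y) / (x - y)) = qn (card S)"
proof (cases "S = {}")
  case False
  let ?A = "\<Prod>y\<in>S. [:- y, q:]" and ?B = "\<Prod>y\<in>S. [:- y, 1 :: 'a:]"
  obtain H where H: "?A - ?B = pCons 0 H"
  proof -
    have "coeff (?A - ?B) 0 = 0" by (simp add: poly_0_coeff_0[symmetric] poly_prod)
    then show ?thesis using that by (metis pCons_cases coeff_pCons_0)
  qed
  have card: "0 < card S" using S False by (simp add: card_gt_0_iff)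
  have deg: "degree (?A - ?B) \<le> card S" using prod_linear[OF S(1)] by (metis degree_diff_le)
  have "degree H < card S"
  proof (cases "H = 0")
    case False
    then show ?thesis using deg H by simp
  qed (use card in simp)
  moreover have "coeff H (card S - 1) = q ^ card S - 1"
  proof -
    have "coeff H (card S - 1) = coeff (?A - ?B) (card S)" unfolding H using card by (cases "card S") auto
    then show ?thesis using prod_linear[OF S(1), of q] prod_linear[OF S(1), of 1] by simp
  qed
  ultimately have L: "(\<Sum>x\<in>S. poly H x / (\<Prod>y\<in>S - {x}. x - y)) = q ^ card S - 1"
    using lagrange_coeff[OF S(1)] by simp
  have "(q - 1) * (\<Prod>y\<in>S - {x}. (q * x - y) / (x - y)) = poly H x / (\<Prod>y\<in>S - {x}. x - y)" if x: "x \<in> S" for x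
  proof -
    have "x * poly H x = poly (?A - ?B) x" unfolding H by simp
    also have "\<dots> = (\<Prod>y\<in>S. q * x - y)"
    proof -
      have "(\<Prod>y\<in>S. x - y) = 0" using S(1) x by (auto simp: prod_zero_iff)
      then show ?thesis by (simp add: poly_prod mult.commute)
    qed
    also have "\<dots> = (q * x - x) * (\<Prod>y\<in>S - {x}. q * x - y)" using S(1) x by (rule prod.remove)
    also have "\<dots> = x * ((q - 1) * (\<Prod>y\<in>S - {x}. q * x - y))" by (simp add: algebra_simps)
    finally have "poly H x = (q - 1) * (\<Prod>y\<in>S - {x}. q * x - y)" using x S(2) by (metis mult_left_cancel)
    then show ?thesis by (simp add: prod_dividef)
  qed
  then have "(q - 1) * (\<Sum>x\<in>S. \<Prod>y\<in>S - {x}. (q * x - y) / (x - y)) = q ^ card S - 1"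
    unfolding L[symmetric] sum_distrib_left by (intro sum.cong) auto
  then have "(q - 1) * (\<Sum>x\<in>S. \<Prod>y\<in>S - {x}. (q * x - y) / (x - y)) = (q - 1) * qn (card S)"
    by (simp only: qn_geometric)
  then show ?thesis using q by simp
qed simp

abbreviation set_cross :: "'a set \<Rightarrow> 'a set \<Rightarrow> 'a" where
  "set_cross I J \<equiv> \<Prod>x\<in>I. \<Prod>y\<in>J. (q * x - y) / (x - y)"

definition cross :: "'a list \<Rightarrow> 'a list \<Rightarrow> 'a" where
  "cross xs ys = (\<Prod>x\<leftarrow>xs. \<Prod>y\<leftarrow>ys. (q * x - y) / (x - y))"

text \<open>
  The product of \<open>(q x\<^sub>i - x\<^sub>j) / (x\<^sub>i - x\<^sub>j)\<close> over all \<open>i < j\<close>.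
\<close>

fun full_kernel :: "'a list \<Rightarrow> 'a" where
  "full_kernel [] = 1"
| "full_kernel (x # xs) = cross [x] xs * full_kernel xs"

text \<open>
  The product of \<open>q x\<^sub>i - x\<^sub>j\<close> over \<open>i + 1 < j\<close>, divided by the Vandermonde product; see \<open>kernel_index\<close>.
\<close>

fun kernel :: "'a list \<Rightarrow> 'a" where
  "kernel [] = 1"
| "kernel (x # xs) = (\<Prod>y\<leftarrow>tl xs. q * x - y) / (\<Prod>y\<leftarrow>xs. x - y) * kernel xs"

lemma cross_Cons: "cross (x # xs) ys = cross [x] ys * cross xs ys" by (simp add: cross_def)
lemma cross_Nil [simp]: "cross [] ys = 1" by (simp add: cross_def)

lemma cross_append: "cross xs (ys @ zs) = cross xs ys * cross xs zs"
  by (induction xs) (simp_all add: cross_def mult_ac)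

lemma prod_list_distinct: "distinct xs \<Longrightarrow> (\<Prod>x\<leftarrow>xs. f x) = (\<Prod>x\<in>set xs. f x)"
  for f :: "'b \<Rightarrow> 'a"
  by (simp add: prod.distinct_set_conv_list)

lemma cross_set:
  "distinct xs \<Longrightarrow> distinct ys \<Longrightarrow> cross xs ys = set_cross (set xs) (set ys)"
  by (simp add: cross_def prod_list_distinct)

lemma full_kernel_append: "full_kernel (xs @ ys) = full_kernel xs * full_kernel ys * cross xs ys"
proof (induction xs)
  case (Cons x xs)
  then show ?case unfolding cross_Cons[of x xs ys] by (simp add: cross_append mult_ac)
qed simp

lemma prod_list_divide: "(\<Prod>x\<leftarrow>xs. f x / g x) = (\<Prod>x\<leftarrow>xs. f x) / (\<Prod>x\<leftarrow>xs. g x)" for f g :: "'b \<Rightarrow> 'a"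
  by (induction xs) simp_all

text \<open>
  The kernel of a concatenation lacks exactly the factor of the two entries that meet.
\<close>

lemma kernel_append:
  assumes "xs \<noteq> []" "ys \<noteq> []"
  shows "kernel (xs @ ys) * (q * last xs - hd ys) = kernel xs * kernel ys * cross xs ys"
  using assms(1)
proof (induction xs)
  case (Cons x xs)
  show ?case
  proof (cases "xs = []")
    case True
    obtain y ys' where ys: "ys = y # ys'" using assms(2) by (cases ys) auto
    show ?thesis unfolding True ys by (simp add: cross_def prod_list_divide mult_ac)
  next
    case False
    then have "kernel ((x # xs) @ ys) * (q * last (x # xs) - hd ys) =
      (\<Prod>y\<leftarrow>tl xs @ ys. q * x - y) / (\<Prod>y\<leftarrow>xs @ ys. x - y) * (kernel xs * kernel ys * cross xs ys)"
      using Cons.IH[OF False, symmetric] by (simp add: mult_ac)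
    also have "\<dots> = kernel (x # xs) * kernel ys * (cross [x] ys * cross xs ys)"
      by (simp add: cross_def prod_list_divide mult_ac)
    finally show ?thesis by (simp only: cross_Cons[symmetric])
  qed
qed simp

text \<open>
  Sum over the first entry by \<open>sum_leading_factors\<close>, then over the rest by induction.
\<close>

lemma sum_full_kernel:
  assumes "finite S" "0 \<notin> S" "q \<noteq> 1"
  shows "(\<Sum>xs\<in>permutations_of_set S. full_kernel xs) = qfact (card S)"
  using assms(1,2)
proof (induction "card S" arbitrary: S)
  case (Suc n)
  then have "S \<noteq> {}" by auto
  have "(\<Sum>xs\<in>permutations_of_set S. full_kernel xs) = (\<Sum>x\<in>S. \<Sum>xs\<in>permutations_of_set (S - {x}). cross [x] xs * full_kernel xs)"
    by (subst sum_orderings_Cons) (use Suc \<open>S \<noteq> {}\<close> in auto)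
  also have "\<dots> = (\<Sum>x\<in>S. \<Sum>xs\<in>permutations_of_set (S - {x}). (\<Prod>y\<in>S - {x}. (q * x - y) / (x - y)) * full_kernel xs)"
    by (intro sum.cong refl) (auto simp: cross_set permutations_of_set_def)
  also have "\<dots> = (\<Sum>x\<in>S. (\<Prod>y\<in>S - {x}. (q * x - y) / (x - y)) * qfact n)"
  proof (intro sum.cong refl)
    fix x assume "x \<in> S"
    then have "n = card (S - {x})" using Suc by simp
    then show "(\<Sum>xs\<in>permutations_of_set (S - {x}). (\<Prod>y\<in>S - {x}. (q * x - y) / (x - y)) * full_kernel xs) = (\<Prod>y\<in>S - {x}. (q * x - y) / (x - y)) * qfact n"
      using Suc(1)[of "S - {x}"] Suc.prems by (simp add: sum_distrib_left[symmetric])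
  qed
  also have "\<dots> = qn (Suc n) * qfact n"
    unfolding sum_distrib_right[symmetric] using sum_leading_factors[OF Suc.prems assms(3)] Suc(2) by simp
  finally show ?case using Suc(2)[symmetric] by (simp add: qfact_Suc)
qed simp

text \<open>
  Evaluate \<open>sum_full_kernel\<close> by sorting the orderings by the set \<open>I\<close> of their first \<open>i\<close> entries.
\<close>

lemma sum_cross:
  assumes "finite S" "0 \<notin> S" "q \<noteq> 1" "i \<le> card S"
  shows "(\<Sum>I | I \<subseteq> S \<and> card I = i. set_cross I (S - I)) = qfact (card S) / (qfact i * qfact (card S - i))"
proof -
  have "qfact (card S) = (\<Sum>zs\<in>permutations_of_set S. full_kernel (take i zs @ drop i zs))"
    using sum_full_kernel[OF assms(1-3)] by simp
  also have "\<dots> = (\<Sum>I | I \<subseteq> S \<and> card I = i. \<Sum>xs\<in>permutations_of_set I. \<Sum>ys\<in>permutations_of_set (S - I). full_kernel (xs @ ys))"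
    by (rule sum_orderings_append[OF assms(1,4)])
  also have "\<dots> = (\<Sum>I | I \<subseteq> S \<and> card I = i. set_cross I (S - I) * (qfact i * qfact (card S - i)))"
  proof (intro sum.cong refl)
    fix I assume "I \<in> {I. I \<subseteq> S \<and> card I = i}"
    then have I: "I \<subseteq> S" "card I = i" "finite I" using assms(1) by (auto intro: finite_subset)
    have "(\<Sum>xs\<in>permutations_of_set I. \<Sum>ys\<in>permutations_of_set (S - I). full_kernel (xs @ ys)) =
      (\<Sum>xs\<in>permutations_of_set I. \<Sum>ys\<in>permutations_of_set (S - I). set_cross I (S - I) * (full_kernel xs * full_kernel ys))"
      by (intro sum.cong refl) (auto simp: cross_set permutations_of_set_def full_kernel_append)
    also have "\<dots> = set_cross I (S - I) * ((\<Sum>xs\<in>permutations_of_set I. full_kernel xs) * (\<Sum>ys\<in>permutations_of_set (S - I). full_kernel ys))"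
      unfolding sum_product by (simp add: sum_distrib_left)
    also have "(\<Sum>xs\<in>permutations_of_set I. full_kernel xs) = qfact i"
      using sum_full_kernel[of I] I assms by auto
    also have "(\<Sum>xs\<in>permutations_of_set (S - I). full_kernel xs) = qfact (card S - i)"
      using sum_full_kernel[of "S - I"] I assms by (auto simp: card_Diff_subset)
    finally show "(\<Sum>xs\<in>permutations_of_set I. \<Sum>ys\<in>permutations_of_set (S - I). full_kernel (xs @ ys)) =
      set_cross I (S - I) * (qfact i * qfact (card S - i))" .
  qed
  finally show ?thesis by (simp add: sum_distrib_right[symmetric])
qed

text \<open>
  Induction on the set, with \<open>lagrange_one\<close> at the point \<open>t = q x\<close>.
\<close>

lemma sum_kernel_fixed_head:
  assumes "finite S" "x \<in> S"
  shows "(\<Sum>xs\<in>permutations_of_set (S - {x}). kernel (x # xs)) = 1 / (\<Prod>y\<in>S - {x}. x - y)"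
  using assms
proof (induction "card S" arbitrary: S x)
  case (Suc n)
  let ?T = "S - {x}"
  show ?case
  proof (cases "?T = {}")
    case False
    have fin: "finite ?T" using Suc.prems by simp
    have "(\<Sum>xs\<in>permutations_of_set ?T. kernel (x # xs)) =
      (\<Sum>y\<in>?T. \<Sum>ys\<in>permutations_of_set (?T - {y}). (\<Prod>z\<in>?T - {y}. q * x - z) / (\<Prod>z\<in>?T. x - z) * kernel (y # ys))"
      unfolding sum_orderings_Cons[OF fin False]
    proof (intro sum.cong refl)
      fix y ys assume y: "y \<in> ?T" and ys: "ys \<in> permutations_of_set (?T - {y})"
      have d: "distinct ys" "set ys = ?T - {y}" "distinct (y # ys)" "set (y # ys) = ?T" using y ys by (auto simp: permutations_of_set_def)
      have "(\<Prod>z\<leftarrow>y # ys. x - z) = (\<Prod>z\<in>?T. x - z)" using prod_list_distinct[OF d(3)] d(4) by metis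
      moreover have "(\<Prod>z\<leftarrow>tl (y # ys). q * x - z) = (\<Prod>z\<in>?T - {y}. q * x - z)" using prod_list_distinct[OF d(1)] d(2) by (metis list.sel(3))
      ultimately show "kernel (x # y # ys) = (\<Prod>z\<in>?T - {y}. q * x - z) / (\<Prod>z\<in>?T. x - z) * kernel (y # ys)"
        by (simp only: kernel.simps(2)[of x])
    qed
    also have "\<dots> = (\<Sum>y\<in>?T. (\<Prod>z\<in>?T - {y}. q * x - z) / (\<Prod>z\<in>?T. x - z) * (1 / (\<Prod>z\<in>?T - {y}. y - z)))"
      unfolding sum_distrib_left[symmetric]
      using Suc by (intro sum.cong refl arg_cong2[of _ _ _ _ "(*)"] Suc.hyps(1)) auto
    also have "\<dots> = 1 / (\<Prod>z\<in>?T. x - z) * (\<Sum>y\<in>?T. \<Prod>z\<in>?T - {y}. (q * x - z) / (y - z))"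
      by (simp add: sum_distrib_left prod_dividef)
    also have "\<dots> = 1 / (\<Prod>z\<in>?T. x - z)" using lagrange_one[OF fin False] by simp
    finally show ?thesis .
  next
    case True
    show ?thesis unfolding True by simp
  qed
qed (auto simp: card_eq_0_iff)

text \<open>
  By \<open>sum_kernel_fixed_head\<close> and \<open>lagrange_coeff\<close> this is the coefficient of degree \<open>card S - 1\<close> in the constant polynomial 1.
\<close>

lemma sum_kernel:
  assumes "finite S" "2 \<le> card S"
  shows "(\<Sum>xs\<in>permutations_of_set S. kernel xs) = 0"
proof -
  have "S \<noteq> {}" using assms by auto
  have "(\<Sum>xs\<in>permutations_of_set S. kernel xs) = (\<Sum>x\<in>S. poly 1 x / (\<Prod>y\<in>S - {x}. x - y))"
    unfolding sum_orderings_Cons[OF assms(1) \<open>S \<noteq> {}\<close>] by (intro sum.cong) (simp_all add: sum_kernel_fixed_head assms(1) del: kernel.simps)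
  also have "\<dots> = coeff 1 (card S - 1)" by (rule lagrange_coeff) (use assms in auto)
  also have "\<dots> = 0" using assms by (intro coeff_eq_0) simp
  finally show ?thesis .
qed

end

section \<open>The recurrence for the symmetrised products\<close>

context q_field
begin

text \<open>
  The product of the powers \<open>(s + x\<^sub>1 + \<dots> + x\<^sub>i)\<close> to the \<open>i\<close>-th entry of the list. The offset \<open>s\<close> is needed for
  cutting the product in two: the right part sees the sum of the variables in the left part.
\<close>

fun flag_product :: "nat list \<Rightarrow> 'a \<Rightarrow> 'a list \<Rightarrow> 'a" where
  "flag_product [] s xs = 1"
| "flag_product (k # d) s [] = 1"
| "flag_product (k # d) s (x # xs) = (s + x) ^ k * flag_product d (s + x) xs"

definition bracket :: "nat list \<Rightarrow> 'a \<Rightarrow> 'a set \<Rightarrow> 'a" where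
  "bracket d s S = (\<Sum>xs\<in>permutations_of_set S. flag_product d s xs * kernel xs)"

text \<open>
  For \<open>1 \<le> j \<le> length d\<close> this is again a bracket (\<open>shifted_bracket_inner\<close>); at both ends of the range of
  \<open>j\<close> the additional factor is symmetric and leaves the sum.
\<close>

definition shifted_bracket :: "nat list \<Rightarrow> 'a \<Rightarrow> 'a set \<Rightarrow> nat \<Rightarrow> 'a" where
  "shifted_bracket d s S j =
    (\<Sum>xs\<in>permutations_of_set S. flag_product d s xs * (s + sum_list (take j xs)) * kernel xs)"

lemma flag_product_append:
  "length xs = Suc (length dl) \<Longrightarrow> flag_product (dl @ k # dr) s (xs @ ys) =
    flag_product dl s xs * (s + sum_list xs) ^ k * flag_product dr (s + sum_list xs) ys"
proof (induction dl arbitrary: xs s)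
  case Nil
  then obtain x where "xs = [x]" by (auto simp: length_Suc_conv)
  then show ?case by simp
next
  case (Cons k' dl)
  then obtain x xs' where xs: "xs = x # xs'" "length xs' = Suc (length dl)" by (auto simp: length_Suc_conv)
  show ?case using Cons.IH[OF xs(2)] by (simp add: xs(1) mult_ac add_ac)
qed

lemma flag_product_increment:
  "j < length d \<Longrightarrow> length d \<le> length xs \<Longrightarrow>
    flag_product (increment d j) s xs = flag_product d s xs * (s + sum_list (take (Suc j) xs))"
proof (induction d arbitrary: j xs s)
  case (Cons k d)
  then obtain x xs' where xs: "xs = x # xs'" by (cases xs) auto
  show ?case
  proof (cases j)
    case (Suc j')
    then show ?thesis using Cons.IH[of j' xs' "s + x"] Cons.prems by (simp add: xs mult_ac add_ac)
  qed (simp add: xs mult_ac)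
qed simp

lemma flag_product_zero: "sum_list d = 0 \<Longrightarrow> flag_product d s xs = 1"
  by (induction d s xs rule: flag_product.induct) simp_all

lemma shifted_bracket_inner:
  assumes "1 \<le> j" "j \<le> length d" "card S = Suc (length d)"
  shows "shifted_bracket d s S j = bracket (increment d (j - 1)) s S"
  unfolding shifted_bracket_def bracket_def
proof (intro sum.cong refl)
  fix xs assume "xs \<in> permutations_of_set S"
  then have "length xs = Suc (length d)" using assms(3) by (simp add: length_finite_permutations_of_set)
  then show "flag_product d s xs * (s + sum_list (take j xs)) * kernel xs =
    flag_product (increment d (j - 1)) s xs * kernel xs"
    using flag_product_increment[of "j - 1" d xs s] assms by simp
qed

lemma shifted_bracket_0: "shifted_bracket d s S 0 = s * bracket d s S"
  by (simp add: shifted_bracket_def bracket_def sum_distrib_left mult_ac)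

lemma shifted_bracket_last:
  assumes "card S = Suc (length d)"
  shows "shifted_bracket d s S (Suc (length d)) = (s + \<Sum>S) * bracket d s S"
  unfolding shifted_bracket_def bracket_def sum_distrib_left
proof (intro sum.cong refl)
  fix xs assume xs: "xs \<in> permutations_of_set S"
  then have "length xs = Suc (length d)" using assms by (simp add: length_finite_permutations_of_set)
  moreover have "sum_list xs = \<Sum>S" using xs sum_list_distinct_conv_sum_set[of xs "\<lambda>x. x"] by (auto simp: permutations_of_set_def)
  ultimately show "flag_product d s xs * (s + sum_list (take (Suc (length d)) xs)) * kernel xs =
    (s + \<Sum>S) * (flag_product d s xs * kernel xs)" by simp
qed

text \<open>
  The linear combination of partial sums is \<open>q x\<^sub>i - x\<^bsub>i+1\<^esub>\<close>, the factor missing in \<open>kernel_append\<close>.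
\<close>

lemma shifted_bracket_relation:
  assumes d: "d = dl @ k # dr" and S: "finite S" "card S = Suc (length d)"
  defines "i \<equiv> Suc (length dl)"
  shows "(1 + q) * shifted_bracket d s S i - q * shifted_bracket d s S (i - 1) - shifted_bracket d s S (Suc i) =
    (\<Sum>I | I \<subseteq> S \<and> card I = i. set_cross I (S - I) *
      ((s + \<Sum>I) ^ k * (bracket dl s I * bracket dr (s + \<Sum>I) (S - I))))"
proof -
  have i: "i \<le> card S" using S by (simp add: i_def d)
  let ?f = "\<lambda>xs ys. flag_product d s (xs @ ys) * (q * last xs - hd ys) * kernel (xs @ ys)"
  have "(1 + q) * shifted_bracket d s S i - q * shifted_bracket d s S (i - 1) - shifted_bracket d s S (Suc i) =
    (\<Sum>zs\<in>permutations_of_set S. ?f (take i zs) (drop i zs))"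
    unfolding shifted_bracket_def sum_distrib_left sum_subtractf[symmetric]
  proof (intro sum.cong refl)
    fix zs assume "zs \<in> permutations_of_set S"
    then have l: "length zs = Suc (length d)" using S by (simp add: length_finite_permutations_of_set)
    then have il: "i < length zs" "i - 1 < length zs" by (auto simp: i_def d)
    have 1: "take (Suc i) zs = take i zs @ [hd (drop i zs)]" using il by (simp add: take_Suc_conv_app_nth hd_drop_conv_nth)
    have 2: "take i zs = take (i - 1) zs @ [last (take i zs)]"
    proof -
      have t: "take i zs = take (i - 1) zs @ [zs ! (i - 1)]" using take_Suc_conv_app_nth[OF il(2)] by (simp add: i_def)
      then have "last (take i zs) = zs ! (i - 1)" by (metis last_snoc)
      then show ?thesis using t by simp
    qed
    have a: "sum_list (take (Suc i) zs) = sum_list (take i zs) + hd (drop i zs)" unfolding 1 by simp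
    have b: "sum_list (take (i - 1) zs) = sum_list (take i zs) - last (take i zs)" by (subst 2) simp
    show "(1 + q) * (flag_product d s zs * (s + sum_list (take i zs)) * kernel zs) -
          q * (flag_product d s zs * (s + sum_list (take (i - 1) zs)) * kernel zs) -
          flag_product d s zs * (s + sum_list (take (Suc i) zs)) * kernel zs = ?f (take i zs) (drop i zs)"
      unfolding a b by (simp add: algebra_simps)
  qed
  also have "\<dots> = (\<Sum>I | I \<subseteq> S \<and> card I = i. \<Sum>xs\<in>permutations_of_set I. \<Sum>ys\<in>permutations_of_set (S - I). ?f xs ys)"
    by (rule sum_orderings_append[OF S(1) i])
  also have "\<dots> = (\<Sum>I | I \<subseteq> S \<and> card I = i. set_cross I (S - I) *
      ((s + \<Sum>I) ^ k * (bracket dl s I * bracket dr (s + \<Sum>I) (S - I))))"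
  proof (intro sum.cong refl)
    fix I assume "I \<in> {I. I \<subseteq> S \<and> card I = i}"
    then have I: "I \<subseteq> S" "card I = i" "finite I" using S by (auto intro: finite_subset)
    let ?c = "set_cross I (S - I) * (s + \<Sum>I) ^ k"
    have "(\<Sum>xs\<in>permutations_of_set I. \<Sum>ys\<in>permutations_of_set (S - I). ?f xs ys) =
      (\<Sum>xs\<in>permutations_of_set I. \<Sum>ys\<in>permutations_of_set (S - I).
        ?c * ((flag_product dl s xs * kernel xs) * (flag_product dr (s + \<Sum>I) ys * kernel ys)))"
    proof (intro sum.cong refl)
      fix xs ys assume xs: "xs \<in> permutations_of_set I" and ys: "ys \<in> permutations_of_set (S - I)"
      have lx: "length xs = Suc (length dl)" using length_finite_permutations_of_set[OF xs] I by (simp add: i_def)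
      have ly: "length ys = Suc (length dr)" using length_finite_permutations_of_set[OF ys] I S by (simp add: i_def d card_Diff_subset)
      have ne: "xs \<noteq> []" "ys \<noteq> []" using lx ly by auto
      have sum: "sum_list xs = \<Sum>I" using xs sum_list_distinct_conv_sum_set[of xs "\<lambda>x. x"] by (auto simp: permutations_of_set_def)
      have cr: "cross xs ys = set_cross I (S - I)"
        using xs ys by (auto simp: cross_set permutations_of_set_def)
      have "?f xs ys = flag_product d s (xs @ ys) * (kernel (xs @ ys) * (q * last xs - hd ys))"
        by (simp only: mult_ac)
      also have "\<dots> = ?c * ((flag_product dl s xs * kernel xs) * (flag_product dr (s + \<Sum>I) ys * kernel ys))"
        unfolding kernel_append[OF ne] d flag_product_append[OF lx] sum cr by (simp only: mult_ac)
      finally show "?f xs ys = ?c * ((flag_product dl s xs * kernel xs) * (flag_product dr (s + \<Sum>I) ys * kernel ys))" .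
    qed
    also have "\<dots> = ?c * (bracket dl s I * bracket dr (s + \<Sum>I) (S - I))"
      unfolding bracket_def sum_product by (simp add: sum_distrib_left)
    finally show "(\<Sum>xs\<in>permutations_of_set I. \<Sum>ys\<in>permutations_of_set (S - I). ?f xs ys) =
      set_cross I (S - I) * ((s + \<Sum>I) ^ k * (bracket dl s I * bracket dr (s + \<Sum>I) (S - I)))"
      by (simp only: mult.assoc)
  qed
  finally show ?thesis .
qed

text \<open>
  Starting from 0, the recurrence forces \<open>g i = [i] g 1\<close>, and \<open>[r + 1]\<close> is nonzero.
\<close>

lemma recurrence_unique:
  fixes g :: "nat \<Rightarrow> 'a"
  assumes "g 0 = 0" "g (Suc r) = 0" and rec: "\<And>i. 1 \<le> i \<Longrightarrow> i \<le> r \<Longrightarrow> (1 + q) * g i = q * g (i - 1) + g (Suc i)"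
    and "j \<le> Suc r"
  shows "g j = 0"
proof -
  have g: "g i = qn i * g 1 \<and> g (Suc i) = qn (Suc i) * g 1" if "i \<le> r" for i
    using that
  proof (induction i)
    case (Suc i)
    then have IH: "g i = qn i * g 1" "g (Suc i) = qn (Suc i) * g 1" by simp_all
    have "g (Suc (Suc i)) = (1 + q) * g (Suc i) - q * g i" using rec[of "Suc i"] Suc.prems by simp
    also have "\<dots> = (qn (Suc i) + q * (qn (Suc i) - qn i)) * g 1" unfolding IH by (simp add: algebra_simps)
    also have "qn (Suc i) + q * (qn (Suc i) - qn i) = qn (Suc (Suc i))" by (simp add: qn_Suc)
    finally show ?case using IH by simp
  qed (use assms(1) in \<open>simp add: qn_def\<close>)
  have "qn (Suc r) * g 1 = 0" using g[of r] assms(2) by simp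
  then have z: "g 1 = 0" by simp
  show ?thesis
  proof (cases "j \<le> r")
    case True
    then show ?thesis using g[OF True] z by simp
  next
    case False
    then have "j = Suc r" using assms(4) by simp
    then show ?thesis using assms(2) by simp
  qed
qed

lemma content_total_unbalanced: "sum_list d \<noteq> length d \<Longrightarrow> content_total d = 0"
  unfolding content_total_def by (rule below_unbalanced) (simp add: balls_word leaves_word)

text \<open>
  Symmetrised products of too small degree vanish, and in the critical degree they are constant. Both facts
  are proved together, by induction on the length and, for fixed length, on the degree.
  If the degree of \<open>e\<close> is below its length, then its bracket vanishes by the induction hypothesis,
  so the values with one more factor vanish at both ends
  (\<open>shifted_bracket_0\<close>, \<open>shifted_bracket_last\<close>) and are determined by the
  recurrence. Its right side is a sum of products of brackets of smaller length.
\<close>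

theorem bracket_eq:
  assumes q: "q \<noteq> 1"
  assumes "finite S" "0 \<notin> S" "card S = Suc (length d)" "sum_list d \<le> length d"
  shows "bracket d s S = qfact (length d) * content_total d"
  using assms(2-)
proof (induction "length d" arbitrary: d s S rule: less_induct)
  case less
  let ?r = "length d"
  have "bracket d' s S = qfact ?r * content_total d'" if "length d' = ?r" "sum_list d' = m" "m \<le> ?r" for d' m
    using that
  proof (induction m arbitrary: d')
    case 0
    have "bracket d' s S = (\<Sum>xs\<in>permutations_of_set S. kernel xs)"
      using 0 by (simp add: bracket_def flag_product_zero)
    also have "\<dots> = qfact ?r * content_total d'"
    proof (cases ?r)
      case z: 0
      then obtain x where "S = {x}" using less.prems by (auto simp: card_Suc_eq)
      moreover have "d' = []" using 0 z by simp
      ultimately show ?thesis using z by (simp add: content_total_def)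
    next
      case (Suc r)
      then have "(\<Sum>xs\<in>permutations_of_set S. kernel xs) = 0" using less.prems by (intro sum_kernel) auto
      moreover have "content_total d' = 0" using 0(1,2) Suc by (intro content_total_unbalanced) linarith
      ultimately show ?thesis by simp
    qed
    finally show ?case .
  next
    case (Suc m)
    obtain j where j: "j < length d'" "d' ! j \<noteq> 0"
    proof -
      have "\<exists>k\<in>set d'. k \<noteq> 0" using Suc.prems(2) by (metis sum_list_eq_0_iff nat.distinct(1))
      then show ?thesis using that by (metis in_set_conv_nth)
    qed
    (* Lower one positive entry; then d' is one of the sequences in the recurrence for e. *)
    define e where "e = d'[j := d' ! j - 1]"
    have le: "length e = ?r" using Suc.prems by (simp add: e_def)
    have d': "increment e j = d'" using j by (simp add: e_def)
    have inc: "sum_list (increment e i) = Suc (sum_list e)" if "i < length e" for i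
    proof -
      have "e = take i e @ e ! i # drop (Suc i) e" using that by (rule id_take_nth_drop)
      then have "sum_list e = sum_list (take i e) + e ! i + sum_list (drop (Suc i) e)"
        by (metis sum_list.Cons sum_list.append add.assoc)
      then show ?thesis using that by (simp add: upd_conv_take_nth_drop)
    qed
    have se: "sum_list e = m" using inc[of j] j d' Suc.prems by (simp add: le)
    have cS: "card S = Suc (length e)" using less.prems by (simp add: le)
    have "bracket e s S = qfact ?r * content_total e" using Suc le se by simp
    then have zero: "bracket e s S = 0" using content_total_unbalanced[of e] se le Suc.prems by simp
    (* If sum_list d' < length d', then the second term vanishes for every i, its words being
       unbalanced. *)
    define g where "g i = shifted_bracket e s S i - qfact ?r * shifted_total e i" for i
    have "g (Suc j) = 0"
    proof (rule recurrence_unique)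
      show "g 0 = 0" by (simp add: g_def shifted_bracket_0 zero shifted_total_def)
      show "g (Suc ?r) = 0" using shifted_bracket_last[OF cS, of s] by (simp add: g_def zero shifted_total_def le)
      show "Suc j \<le> Suc ?r" using j Suc.prems by simp
      fix i assume i: "1 \<le> i" "i \<le> ?r"
      define dl k dr where "dl = take (i - 1) e" and "k = e ! (i - 1)" and "dr = drop i e"
      have e: "e = dl @ k # dr" using i id_take_nth_drop[of "i - 1" e] by (simp add: dl_def k_def dr_def le)
      have il: "Suc (length dl) = i" using i le by (simp add: dl_def)
      have lr: "length dr = ?r - i" using le by (simp add: dr_def)
      have sums: "sum_list dl + k + sum_list dr = m" using se e by simp
      let ?V = "if k = 0 then qn (sum_list dl + sum_list dr + 2) / (qn (Suc (sum_list dl)) * qn (Suc (sum_list dr))) * (content_total dl * content_total dr) else 0"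
      let ?c = "\<lambda>I. set_cross I (S - I)"
      have T: "(1 + q) * shifted_total e i - q * shifted_total e (i - 1) - shifted_total e (Suc i) = ?V"
        using shifted_total_relation[OF e] unfolding il .
      have "(\<Sum>I | I \<subseteq> S \<and> card I = i. ?c I * ((s + \<Sum>I) ^ k * (bracket dl s I * bracket dr (s + \<Sum>I) (S - I)))) = qfact ?r * ?V"
      proof -
        have inner: "bracket dl s I = qfact (length dl) * content_total dl" if "sum_list dl \<le> length dl" "I \<subseteq> S" "card I = i" for I
          by (rule less.hyps) (use that less.prems i il le in \<open>auto intro: finite_subset\<close>)
        have outer: "bracket dr t (S - I) = qfact (length dr) * content_total dr" if "sum_list dr \<le> length dr" "I \<subseteq> S" "card I = i" for I t
          by (rule less.hyps) (use that less.prems i il lr in \<open>auto simp: card_Diff_subset finite_subset\<close>)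
        show ?thesis
        proof (cases "sum_list dl = length dl \<and> sum_list dr = length dr \<and> k = 0")
          case True
          have "(\<Sum>I | I \<subseteq> S \<and> card I = i. ?c I * ((s + \<Sum>I) ^ k * (bracket dl s I * bracket dr (s + \<Sum>I) (S - I)))) =
            (\<Sum>I | I \<subseteq> S \<and> card I = i. ?c I) * (qfact (length dl) * content_total dl * (qfact (length dr) * content_total dr))"
            unfolding sum_distrib_right by (intro sum.cong refl) (use True inner outer in auto)
          also have "(\<Sum>I | I \<subseteq> S \<and> card I = i. ?c I) = qfact (Suc ?r) / (qfact i * qfact (Suc ?r - i))"
            using sum_cross[of S i] less.prems q i by simp
          also have "Suc ?r - i = Suc (length dr)" using i lr by simp
          also have "qfact (Suc ?r) / (qfact i * qfact (Suc (length dr))) * (qfact (length dl) * content_total dl * (qfact (length dr) * content_total dr)) =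
            qfact ?r * (qn (Suc ?r) / (qn (Suc (length dl)) * qn (Suc (length dr))) * (content_total dl * content_total dr))"
            unfolding il[symmetric] by (simp add: qfact_Suc field_simps)
          also have "Suc ?r = sum_list dl + sum_list dr + 2" using True il lr i by simp
          finally show ?thesis using True by simp
        next
          case False
          have "content_total dl = 0 \<or> content_total dr = 0 \<or> k \<noteq> 0" using False content_total_unbalanced[of dl] content_total_unbalanced[of dr] by auto
          then have V: "?V = 0" by auto
          have m: "m < ?r" using Suc.prems by simp
          have "sum_list dl < length dl \<or> sum_list dr < length dr"
            using False sums m il lr i by linarith
          then have "bracket dl s I * bracket dr (s + \<Sum>I) (S - I) = 0" if "I \<subseteq> S" "card I = i" for I
            using inner[OF _ that] outer[OF _ that] content_total_unbalanced[of dl] content_total_unbalanced[of dr] by auto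
          then show ?thesis unfolding V by (auto intro!: sum.neutral)
        qed
      qed
      then have "(1 + q) * shifted_bracket e s S i - q * shifted_bracket e s S (i - 1) - shifted_bracket e s S (Suc i) = qfact ?r * ?V"
        using shifted_bracket_relation[OF e less.prems(1) cS, of s] unfolding il by simp
      then have "(1 + q) * g i - q * g (i - 1) - g (Suc i) = 0"
        unfolding g_def T[symmetric] by (simp add: algebra_simps)
      then show "(1 + q) * g i = q * g (i - 1) + g (Suc i)" by (simp add: algebra_simps)
    qed
    then show ?case using shifted_bracket_inner[of "Suc j" e S s] j cS d' Suc.prems
      by (simp add: g_def shifted_total_def le)
  qed
  then show ?case using less.prems by blast
qed

end

section \<open>Decomposing bilabeled trees at the root\<close>

text \<open>
  The bilabeled trees over a word whose letters carry arbitrary labels, with an arbitrary set \<open>D\<close> of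
  decreasing labels. In this generality the subtrees of a tree need no relabeling.
\<close>

definition labelled :: "(nat \<times> bool) list \<Rightarrow> nat set \<Rightarrow> ltree set" where
  "labelled W D = {t. leaf_word t = map fst (filter snd W) \<and> set (lr_word t) = fst ` set W \<and>
     distinct (lr_word t) \<and> lr_local t \<and> dec_decreasing t \<and> distinct (dec_word t) \<and> set (dec_word t) = D}"

abbreviation strict :: "(nat \<times> bool) list \<Rightarrow> bool" where
  "strict W \<equiv> sorted_wrt (<) (map fst W)"

lemma leaf_word_nonempty [simp]: "leaf_word t \<noteq> []" by (induction t) simp_all
lemma lr_root_in: "lr_root t \<in> set (lr_word t)" by (cases t) simp_all
lemma leaf_word_subset: "set (leaf_word t) \<subseteq> set (lr_word t)" by (induction t) auto

lemma hd_le_last: "sorted_wrt (<) xs \<Longrightarrow> x \<in> set xs \<Longrightarrow> hd xs \<le> x \<and> x \<le> last xs" for xs :: "nat list"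
proof (induction xs)
  case (Cons a xs)
  then show ?case by (cases "xs = []") (auto simp: less_imp_le)
qed simp

text \<open>
  The first leaf of a tree carries its smallest label and the last leaf its largest. Hence
  the labels of the left subtree precede those of the right subtree, even though the label of the root
  may lie among either of them.
\<close>

lemma lr_between_leaves:
  "lr_local t \<Longrightarrow> sorted_wrt (<) (leaf_word t) \<Longrightarrow> l \<in> set (lr_word t) \<Longrightarrow>
     hd (leaf_word t) \<le> l \<and> l \<le> last (leaf_word t)"
proof (induction t arbitrary: l)
  case (Node a d m b)
  have s: "sorted_wrt (<) (leaf_word a)" "sorted_wrt (<) (leaf_word b)" "\<forall>x\<in>set (leaf_word a). \<forall>y\<in>set (leaf_word b). x < y"
    using Node.prems(2) by (auto simp: sorted_wrt_append)
  have ia: "hd (leaf_word a) \<le> l \<and> l \<le> last (leaf_word a)" if "l \<in> set (lr_word a)" for l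
    using Node.IH(1)[OF _ s(1) that] Node.prems(1) by simp
  have ib: "hd (leaf_word b) \<le> l \<and> l \<le> last (leaf_word b)" if "l \<in> set (lr_word b)" for l
    using Node.IH(2)[OF _ s(2) that] Node.prems(1) by simp
  have ab: "last (leaf_word a) < hd (leaf_word b)" using s(3) by simp
  have bb: "hd (leaf_word b) \<le> last (leaf_word b)" using hd_le_last[OF s(2), of "last (leaf_word b)"] by simp
  have aa: "hd (leaf_word a) \<le> last (leaf_word a)" using hd_le_last[OF s(1), of "last (leaf_word a)"] by simp
  have r: "hd (leaf_word a) \<le> lr_root a" "lr_root b \<le> last (leaf_word b)" "lr_root a < m" "m < lr_root b"
    using ia[OF lr_root_in] ib[OF lr_root_in] Node.prems(1) by auto
  consider "l \<in> set (lr_word a)" | "l = m" | "l \<in> set (lr_word b)" using Node.prems(3) by auto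
  then have "hd (leaf_word a) \<le> l \<and> l \<le> last (leaf_word b)"
  proof cases
    case 1
    then show ?thesis using ia[OF 1] ab bb by linarith
  next
    case 2
    then show ?thesis using r by linarith
  next
    case 3
    then show ?thesis using ib[OF 3] ab aa by linarith
  qed
  then show ?case by simp
qed simp

lemma strict_distinct: "strict W \<Longrightarrow> distinct (map fst W)"
  by (metis strict_sorted_iff)

lemma strict_remove:
  assumes "strict W"
  shows "strict (take i W @ drop (Suc i) W)"
proof (cases "i < length W")
  case True
  then have "W = take i W @ W ! i # drop (Suc i) W" by (rule id_take_nth_drop)
  then have "strict (take i W @ W ! i # drop (Suc i) W)" using assms by simp
  then show ?thesis by (auto simp: sorted_wrt_append)
qed (use assms in simp)

lemma strict_take_drop: "strict W \<Longrightarrow> strict (take j W)" "strict W \<Longrightarrow> strict (drop j W)"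
  by (simp_all add: take_map[symmetric] drop_map[symmetric] sorted_wrt_take sorted_wrt_drop)

lemma sorted_filter_split:
  assumes "strict W"
  shows "take (length (filter (\<lambda>p. fst p \<le> L) W)) W = filter (\<lambda>p. fst p \<le> L) W"
    "drop (length (filter (\<lambda>p. fst p \<le> L) W)) W = filter (\<lambda>p. \<not> fst p \<le> L) W"
proof -
  have "W = filter (\<lambda>p. fst p \<le> L) W @ filter (\<lambda>p. \<not> fst p \<le> L) W" using assms
  proof (induction W)
    case (Cons p W)
    show ?case
    proof (cases "fst p \<le> L")
      case False
      then have "filter (\<lambda>p. fst p \<le> L) W = []" "filter (\<lambda>p. \<not> fst p \<le> L) W = W"
        using Cons.prems by (auto simp: filter_empty_conv intro!: filter_True)
      then show ?thesis using False by simp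
    qed (use Cons in auto)
  qed simp
  then show "take (length (filter (\<lambda>p. fst p \<le> L) W)) W = filter (\<lambda>p. fst p \<le> L) W"
    "drop (length (filter (\<lambda>p. fst p \<le> L) W)) W = filter (\<lambda>p. \<not> fst p \<le> L) W"
    by (metis append_eq_conv_conj)+
qed

lemma finite_labelled: "finite (labelled W D)"
proof (cases "finite D")
  case True
  let ?N = "Max (insert 0 (fst ` set W \<union> D))"
  have "labelled W D \<subseteq> {t. length (dec_word t) \<le> card D \<and> set (dec_word t) \<subseteq> {..?N} \<and> set (lr_word t) \<subseteq> {..?N}}"
    using True by (auto simp: labelled_def distinct_card[symmetric] intro!: Max_ge)
  then show ?thesis using finite_bounded_ltrees finite_subset by blast
next
  case False
  then have "labelled W D = {}" by (auto simp: labelled_def)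
  then show ?thesis by simp
qed

lemma length_lr_word: "length (lr_word t) = length (leaf_word t) + length (dec_word t)" by (induction t) simp_all

lemma labelled_card:
  assumes "t \<in> labelled W D" "strict W"
  shows "card D = count_list (map snd W) False"
proof -
  have "length (lr_word t) = length W"
    using assms strict_distinct[OF assms(2)] distinct_card[of "lr_word t"] distinct_card[of "map fst W"]
    by (simp add: labelled_def)
  moreover have "length (leaf_word t) = length (filter snd W)" using assms by (simp add: labelled_def)
  moreover have "length (filter snd W) + count_list (map snd W) False = length W" by (induction W) auto
  moreover have "length (dec_word t) = card D" using assms by (auto simp: labelled_def distinct_card)
  ultimately show ?thesis using length_lr_word[of t] by simp
qed

lemma Node_labelledI:
  assumes W: "strict W" and i: "i < length W" "\<not> snd (W ! i)"
  defines "V \<equiv> take i W @ drop (Suc i) W"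
  assumes a: "a \<in> labelled (take j V) E" "lr_root a < fst (W ! i)"
    and b: "b \<in> labelled (drop j V) F" "fst (W ! i) < lr_root b"
    and D: "E \<union> F = D - {d}" "E \<inter> F = {}" "d \<in> D" "\<And>e. e \<in> D \<Longrightarrow> e \<le> d"
  shows "Node a d (fst (W ! i)) b \<in> labelled W D"
proof -
  have Wi: "W = take i W @ W ! i # drop (Suc i) W" using i(1) by (rule id_take_nth_drop)
  have fW: "filter snd W = filter snd V" using i(2) by (subst Wi) (simp add: V_def)
  have sW: "fst ` set W = insert (fst (W ! i)) (fst ` set V)" by (subst Wi) (auto simp: V_def)
  have dV: "distinct (map fst V)" using strict_distinct[OF strict_remove[OF W]] by (simp add: V_def)
  have nV: "fst (W ! i) \<notin> fst ` set V"
  proof -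
    have "distinct (map fst (take i W @ W ! i # drop (Suc i) W))" using strict_distinct[OF W] Wi by simp
    then show ?thesis by (auto simp: V_def)
  qed
  have V: "V = take j V @ drop j V" by simp
  have fV: "map fst (filter snd V) = map fst (filter snd (take j V)) @ map fst (filter snd (drop j V))"
    by (subst V) (simp only: filter_append map_append)
  have uV: "fst ` set V = fst ` set (take j V) \<union> fst ` set (drop j V)" by (subst V) (simp only: set_append image_Un)
  have "distinct (map fst (take j V) @ map fst (drop j V))" using dV by (simp add: map_append[symmetric] del: map_append)
  then have dj: "fst ` set (take j V) \<inter> fst ` set (drop j V) = {}" by simp
  have "\<forall>e\<in>E \<union> F. e < d" using D by (auto simp: le_less)
  moreover have "d \<notin> E" "d \<notin> F" using D by auto
  moreover have "insert d (E \<union> F) = D" using D by auto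
  ultimately show ?thesis using a b dj nV D(2) unfolding labelled_def fW fV sW uV by auto
qed

text \<open>
  After the label of the root is deleted, the word is cut behind the last leaf of the left subtree.
\<close>

lemma Node_labelledD:
  assumes W: "strict W" and t: "Node a d m b \<in> labelled W D"
  shows "\<exists>i j. i < length W \<and> \<not> snd (W ! i) \<and> fst (W ! i) = m \<and> j \<le> length (take i W @ drop (Suc i) W) \<and>
     a \<in> labelled (take j (take i W @ drop (Suc i) W)) (set (dec_word a)) \<and>
     b \<in> labelled (drop j (take i W @ drop (Suc i) W)) (set (dec_word b))"
proof -
  have lw: "leaf_word a @ leaf_word b = map fst (filter snd W)"
    and lr: "insert m (set (lr_word a) \<union> set (lr_word b)) = fst ` set W"
    and dist: "distinct (lr_word a)" "distinct (lr_word b)" "set (lr_word a) \<inter> set (lr_word b) = {}" "m \<notin> set (lr_word a)" "m \<notin> set (lr_word b)"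
    and loc: "lr_local a" "lr_local b"
    and dec: "dec_decreasing a" "dec_decreasing b" "distinct (dec_word a)" "distinct (dec_word b)"
    using t by (auto simp: labelled_def)
  obtain i where i: "i < length W" "fst (W ! i) = m" using lr by (metis imageE in_set_conv_nth insertI1)
  have ns: "\<not> snd (W ! i)"
  proof
    assume "snd (W ! i)"
    then have "W ! i \<in> set (filter snd W)" using i by simp
    then have "m \<in> set (leaf_word a @ leaf_word b)" using i unfolding lw by force
    then show False using dist leaf_word_subset[of a] leaf_word_subset[of b] by auto
  qed
  define V where "V = take i W @ drop (Suc i) W"
  have Wi: "W = take i W @ W ! i # drop (Suc i) W" using i(1) by (rule id_take_nth_drop)
  have fV: "map fst (filter snd V) = leaf_word a @ leaf_word b" unfolding lw using ns by (subst Wi) (simp add: V_def)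
  have strictV: "strict V" unfolding V_def by (rule strict_remove[OF W])
  have sV: "fst ` set V = set (lr_word a) \<union> set (lr_word b)"
  proof -
    have "distinct (map fst (take i W @ W ! i # drop (Suc i) W))" using strict_distinct[OF W] Wi by simp
    then have "m \<notin> fst ` set V" using i by (auto simp: V_def)
    moreover have "insert m (fst ` set V) = insert m (set (lr_word a) \<union> set (lr_word b))"
      unfolding lr using i by (subst Wi) (auto simp: V_def)
    moreover have "m \<notin> set (lr_word a) \<union> set (lr_word b)" using dist by simp
    ultimately show ?thesis using insert_ident[of m "fst ` set V" "set (lr_word a) \<union> set (lr_word b)"] by auto
  qed
  have "sorted_wrt (<) (map fst (filter snd V))" using strictV by (induction V) auto
  then have s: "sorted_wrt (<) (leaf_word a)" "sorted_wrt (<) (leaf_word b)" "\<forall>x\<in>set (leaf_word a). \<forall>y\<in>set (leaf_word b). x < y"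
    unfolding fV by (auto simp: sorted_wrt_append)
  define L where "L = last (leaf_word a)"
  have aL: "l \<le> L" if "l \<in> set (lr_word a)" for l
    using lr_between_leaves[OF loc(1) s(1) that] by (simp add: L_def)
  have bL: "\<not> l \<le> L" if "l \<in> set (lr_word b)" for l
  proof -
    have "L < hd (leaf_word b)" using s(3) by (simp add: L_def)
    then show ?thesis using lr_between_leaves[OF loc(2) s(2) that] by simp
  qed
  define j where "j = length (filter (\<lambda>p. fst p \<le> L) V)"
  note td = sorted_filter_split[OF strictV, of L, folded j_def]
  have la: "leaf_word a = map fst (filter snd (take j V))"
  proof -
    have "map fst (filter snd (filter (\<lambda>p. fst p \<le> L) V)) = filter (\<lambda>l. l \<le> L) (map fst (filter snd V))"
      by (simp add: filter_map o_def conj_commute)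
    also have "\<dots> = leaf_word a"
    proof -
      have "filter (\<lambda>l. l \<le> L) (leaf_word a) = leaf_word a" using aL leaf_word_subset[of a] by (intro filter_True) auto
      moreover have "filter (\<lambda>l. l \<le> L) (leaf_word b) = []" using bL leaf_word_subset[of b] by (intro filter_False) blast
      ultimately show ?thesis unfolding fV by simp
    qed
    finally show ?thesis unfolding td by simp
  qed
  have lb: "leaf_word b = map fst (filter snd (drop j V))"
  proof -
    have "map fst (filter snd (filter (\<lambda>p. \<not> fst p \<le> L) V)) = filter (\<lambda>l. \<not> l \<le> L) (map fst (filter snd V))"
      by (simp add: filter_map o_def conj_commute)
    also have "\<dots> = leaf_word b"
    proof -
      have "filter (\<lambda>l. \<not> l \<le> L) (leaf_word a) = []" using aL leaf_word_subset[of a] by (intro filter_False) auto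
      moreover have "filter (\<lambda>l. \<not> l \<le> L) (leaf_word b) = leaf_word b" using bL leaf_word_subset[of b] by (intro filter_True) blast
      ultimately show ?thesis unfolding fV by simp
    qed
    finally show ?thesis unfolding td by simp
  qed
  have "fst ` set (filter (\<lambda>p. fst p \<le> L) V) = {l \<in> fst ` set V. l \<le> L}" by auto
  also have "\<dots> = set (lr_word a)" unfolding sV using aL bL by auto
  finally have sa: "set (lr_word a) = fst ` set (take j V)" unfolding td ..
  have "fst ` set (filter (\<lambda>p. \<not> fst p \<le> L) V) = {l \<in> fst ` set V. \<not> l \<le> L}" by auto
  also have "\<dots> = set (lr_word b)" unfolding sV using aL bL by blast
  finally have sb: "set (lr_word b) = fst ` set (drop j V)" unfolding td ..
  have "j \<le> length V" by (simp add: j_def)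
  moreover have "a \<in> labelled (take j V) (set (dec_word a))"
    using la sa dist loc dec by (simp add: labelled_def)
  moreover have "b \<in> labelled (drop j V) (set (dec_word b))"
    using lb sb dist loc dec by (simp add: labelled_def)
  ultimately show ?thesis using i ns unfolding V_def by blast
qed

fun list_inversions :: "nat list \<Rightarrow> nat" where
  "list_inversions [] = 0"
| "list_inversions (x # xs) = length (filter (\<lambda>y. y < x) xs) + list_inversions xs"

definition cross_inversions :: "nat set \<Rightarrow> nat set \<Rightarrow> nat" where
  "cross_inversions E F = card {(x, y). x \<in> E \<and> y \<in> F \<and> y < x}"

text \<open>
  The inversions between the two parts depend only on their sets of entries.
\<close>

lemma list_inversions_append:
  "distinct xs \<Longrightarrow> distinct ys \<Longrightarrow>
   list_inversions (xs @ ys) = list_inversions xs + list_inversions ys + cross_inversions (set xs) (set ys)"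
proof (induction xs)
  case Nil
  then show ?case by (simp add: cross_inversions_def)
next
  case (Cons x xs)
  have "{(x', y). x' \<in> set (x # xs) \<and> y \<in> set ys \<and> y < x'} =
    Pair x ` {y \<in> set ys. y < x} \<union> {(x', y). x' \<in> set xs \<and> y \<in> set ys \<and> y < x'}" by auto
  moreover have "card (Pair x ` {y \<in> set ys. y < x} \<union> {(x', y). x' \<in> set xs \<and> y \<in> set ys \<and> y < x'}) =
    card (Pair x ` {y \<in> set ys. y < x}) + card {(x', y). x' \<in> set xs \<and> y \<in> set ys \<and> y < x'}"
  proof (rule card_Un_disjoint)
    show "finite {(x', y). x' \<in> set xs \<and> y \<in> set ys \<and> y < x'}"
      by (rule finite_subset[of _ "set xs \<times> set ys"]) auto
  qed (use Cons.prems in auto)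
  moreover have "card (Pair x ` {y \<in> set ys. y < x}) = length (filter (\<lambda>y. y < x) ys)"
    using Cons.prems distinct_card[of "filter (\<lambda>y. y < x) ys"] by (simp add: card_image inj_on_def)
  ultimately show ?case using Cons by (simp add: cross_inversions_def)
qed

lemma list_inversions_Node:
  assumes "distinct xs" "distinct ys" "\<forall>e\<in>set xs \<union> set ys. e < d"
  shows "list_inversions (xs @ d # ys) = list_inversions xs + list_inversions ys + cross_inversions (set xs) (set ys) + length ys"
proof -
  have "list_inversions (xs @ d # ys) = list_inversions xs + list_inversions (d # ys) + cross_inversions (set xs) (set (d # ys))"
    using assms by (intro list_inversions_append) auto
  moreover have "filter (\<lambda>y. y < d) ys = ys" using assms by (intro filter_True) auto
  moreover have "{(x, y). x \<in> set xs \<and> y \<in> set (d # ys) \<and> y < x} = {(x, y). x \<in> set xs \<and> y \<in> set ys \<and> y < x}"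
    using assms by (auto dest: less_asym)
  ultimately show ?thesis by (simp add: cross_inversions_def)
qed

definition rooted_below :: "(nat \<times> bool) list \<Rightarrow> nat set \<Rightarrow> nat \<Rightarrow> ltree set" where
  "rooted_below W D x = {t \<in> labelled W D. lr_root t < x}"

definition rooted_above :: "(nat \<times> bool) list \<Rightarrow> nat set \<Rightarrow> nat \<Rightarrow> ltree set" where
  "rooted_above W D x = {t \<in> labelled W D. x < lr_root t}"

definition position :: "(nat \<times> bool) list \<Rightarrow> nat \<Rightarrow> nat" where
  "position W x = length (filter (\<lambda>p. fst p < x) W)"

lemma strict_less_position:
  "strict W \<Longrightarrow> i < length W \<Longrightarrow> fst (W ! i) < x \<longleftrightarrow> i < position W x"
proof (induction W arbitrary: i)
  case (Cons p W)
  show ?case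
  proof (cases "fst p < x")
    case True
    then show ?thesis using Cons by (cases i) (auto simp: position_def)
  next
    case False
    then have *: "\<forall>p'\<in>set (p # W). \<not> fst p' < x" using Cons.prems(1) by auto
    then have "filter (\<lambda>p. fst p < x) (p # W) = []" by (auto simp: filter_empty_conv)
    moreover have "\<not> fst ((p # W) ! i) < x" using * nth_mem[OF Cons.prems(2)] by blast
    ultimately show ?thesis by (simp only: position_def) simp
  qed
qed simp

lemma position_append: "position (U @ V) x = position U x + position V x" by (simp add: position_def)

lemma position_all: "(\<And>p. p \<in> set W \<Longrightarrow> fst p < x) \<Longrightarrow> position W x = length W"
  by (simp add: position_def filter_True)

lemma position_none: "(\<And>p. p \<in> set W \<Longrightarrow> \<not> fst p < x) \<Longrightarrow> position W x = 0"
  by (simp add: position_def filter_False)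

lemma position_take_drop:
  assumes "strict W" "i < length W"
  defines "V \<equiv> take i W @ drop (Suc i) W"
  shows "position (take j V) (fst (W ! i)) = min i j" "position (drop j V) (fst (W ! i)) = i - j"
    "\<forall>p\<in>set V. fst p \<noteq> fst (W ! i)"
proof -
  let ?x = "fst (W ! i)"
  have "W = take i W @ W ! i # drop (Suc i) W" using assms(2) by (rule id_take_nth_drop)
  then have s: "strict (take i W @ W ! i # drop (Suc i) W)" using assms(1) by simp
  have lt: "fst p < ?x" if "p \<in> set (take i W)" for p using s that by (auto simp: sorted_wrt_append)
  have gt: "?x < fst p" if "p \<in> set (drop (Suc i) W)" for p using s that by (auto simp: sorted_wrt_append)
  have l: "length (take i W) = i" using assms(2) by simp
  have t: "take j V = take j (take i W) @ take (j - i) (drop (Suc i) W)" unfolding V_def take_append l ..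
  have d: "drop j V = drop j (take i W) @ drop (j - i) (drop (Suc i) W)" unfolding V_def drop_append l ..
  have "position (take j (take i W)) ?x = length (take j (take i W))"
    by (rule position_all) (metis lt in_set_takeD)
  then have "position (take j (take i W)) ?x = min i j" using assms(2) by (simp add: min.commute)
  moreover have "position (take (j - i) (drop (Suc i) W)) ?x = 0"
    by (rule position_none) (metis gt in_set_takeD less_asym)
  ultimately show "position (take j V) ?x = min i j" unfolding t position_append by simp
  have "position (drop j (take i W)) ?x = length (drop j (take i W))"
    by (rule position_all) (metis lt in_set_dropD)
  then have "position (drop j (take i W)) ?x = i - j" using assms(2) by simp
  moreover have "position (drop (j - i) (drop (Suc i) W)) ?x = 0"
    by (rule position_none) (metis gt in_set_dropD less_asym)
  ultimately show "position (drop j V) ?x = i - j" unfolding d position_append by simp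
  show "\<forall>p\<in>set V. fst p \<noteq> ?x" unfolding V_def set_append using lt gt by (metis Un_iff less_irrefl)
qed

lemma Max_dec:
  assumes "Node a d m b \<in> labelled W D"
  shows "d = Max D" "D \<noteq> {}" "finite D"
proof -
  have D: "D = insert d (set (dec_word a) \<union> set (dec_word b))" "\<forall>e\<in>set (dec_word a) \<union> set (dec_word b). e < d"
    using assms by (auto simp: labelled_def)
  show "D \<noteq> {}" "finite D" using D by auto
  show "d = Max D" using D by (intro Max_eqI[symmetric]) (auto intro: less_imp_le)
qed

section \<open>Summing over bilabeled trees\<close>

context q_field
begin

text \<open>
  The \<open>q\<close>-binomial coefficient counts subsets by inversions against the complement. The induction adds
  a new largest element, which has an inversion with every element of the complement if it
  belongs to the subset, and none otherwise.
\<close>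

lemma sum_cross_inversions:
  assumes "finite D" "k \<le> card D"
  shows "(\<Sum>E | E \<subseteq> D \<and> card E = k. q ^ cross_inversions E (D - E)) = qfact (card D) / (qfact k * qfact (card D - k))"
  using assms
proof (induction D arbitrary: k rule: finite_linorder_max_induct)
  case empty
  have "{E :: nat set. E \<subseteq> {} \<and> card E = 0} = {{}}" by auto
  then show ?case using empty by (simp add: cross_inversions_def)
next
  case (insert M D)
  have M: "M \<notin> D" using insert.hyps by auto
  let ?n = "card D"
  have 1: "cross_inversions E (insert M D - E) = cross_inversions E (D - E)" if "E \<subseteq> D" for E
  proof -
    have "{(x, y). x \<in> E \<and> y \<in> insert M D - E \<and> y < x} = {(x, y). x \<in> E \<and> y \<in> D - E \<and> y < x}"
      using that insert.hyps(2) by (auto dest: less_asym)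
    then show ?thesis by (simp add: cross_inversions_def)
  qed
  have 2: "cross_inversions (insert M E) (insert M D - insert M E) = cross_inversions E (D - E) + (?n - card E)" if "E \<subseteq> D" for E
  proof -
    have fE: "finite E" using that insert.hyps(1) finite_subset by blast
    have "{(x, y). x \<in> insert M E \<and> y \<in> insert M D - insert M E \<and> y < x} =
       {(x, y). x \<in> E \<and> y \<in> D - E \<and> y < x} \<union> Pair M ` (D - E)"
      using that insert.hyps(2) M by auto
    moreover have "card ({(x, y). x \<in> E \<and> y \<in> D - E \<and> y < x} \<union> Pair M ` (D - E)) =
       card {(x, y). x \<in> E \<and> y \<in> D - E \<and> y < x} + card (Pair M ` (D - E))"
    proof (rule card_Un_disjoint)
      show "finite {(x, y). x \<in> E \<and> y \<in> D - E \<and> y < x}"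
        by (rule finite_subset[of _ "E \<times> D"]) (use fE insert.hyps(1) in auto)
    qed (use M that insert.hyps(1) in auto)
    moreover have "card (Pair M ` (D - E)) = ?n - card E"
      using that fE by (simp add: card_image inj_on_def card_Diff_subset)
    ultimately show ?thesis by (simp add: cross_inversions_def)
  qed
  have A: "(\<Sum>E | E \<subseteq> D \<and> card E = k. q ^ cross_inversions E (insert M D - E)) =
     (if k \<le> ?n then qfact ?n / (qfact k * qfact (?n - k)) else 0)"
  proof (cases "k \<le> ?n")
    case True
    have "(\<Sum>E | E \<subseteq> D \<and> card E = k. q ^ cross_inversions E (insert M D - E)) = (\<Sum>E | E \<subseteq> D \<and> card E = k. q ^ cross_inversions E (D - E))"
      by (intro sum.cong refl) (simp add: 1)
    then show ?thesis using insert.IH[OF True] True by simp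
  next
    case False
    then have none: "{E. E \<subseteq> D \<and> card E = k} = {}" using insert.hyps(1) card_mono by blast
    show ?thesis unfolding none using False by simp
  qed
  show ?case
  proof (cases k)
    case 0
    have "E \<subseteq> insert M D \<and> card E = 0 \<longleftrightarrow> E = {}" for E
      using insert.hyps(1) by (metis card_0_eq card.empty empty_subsetI finite.insertI finite_subset)
    then show ?thesis using 0 insert.hyps M by (simp add: cross_inversions_def)
  next
    case (Suc k')
    have k': "k' \<le> ?n" using insert.prems Suc M insert.hyps by simp
    have split: "{E. E \<subseteq> insert M D \<and> card E = k} = {E. E \<subseteq> D \<and> card E = k} \<union> insert M ` {E. E \<subseteq> D \<and> card E = k'}"
    proof (intro equalityI subsetI)
      fix E assume E: "E \<in> {E. E \<subseteq> insert M D \<and> card E = k}"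
      show "E \<in> {E. E \<subseteq> D \<and> card E = k} \<union> insert M ` {E. E \<subseteq> D \<and> card E = k'}"
      proof (cases "M \<in> E")
        case True
        have "card (E - {M}) = k'" using E True Suc by simp
        moreover have "E = insert M (E - {M})" using True by auto
        ultimately show ?thesis using E by blast
      qed (use E in auto)
    next
      fix E assume "E \<in> {E. E \<subseteq> D \<and> card E = k} \<union> insert M ` {E. E \<subseteq> D \<and> card E = k'}"
      then show "E \<in> {E. E \<subseteq> insert M D \<and> card E = k}"
      proof
        assume "E \<in> insert M ` {E. E \<subseteq> D \<and> card E = k'}"
        then obtain E' where E': "E = insert M E'" "E' \<subseteq> D" "card E' = k'" by auto
        have "finite E'" "M \<notin> E'" using E' M insert.hyps(1) finite_subset by blast+
        then show ?thesis using E' Suc by auto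
      qed auto
    qed
    have "(\<Sum>E\<in>insert M ` {E. E \<subseteq> D \<and> card E = k'}. q ^ cross_inversions E (insert M D - E)) =
      (\<Sum>E | E \<subseteq> D \<and> card E = k'. q ^ cross_inversions (insert M E) (insert M D - insert M E))"
    proof (subst sum.reindex)
      show "inj_on (insert M) {E. E \<subseteq> D \<and> card E = k'}" using M by (auto simp: inj_on_def)
    qed simp
    also have "\<dots> = (\<Sum>E | E \<subseteq> D \<and> card E = k'. q ^ cross_inversions E (D - E) * q ^ (?n - k'))"
    proof (intro sum.cong refl)
      fix E assume "E \<in> {E. E \<subseteq> D \<and> card E = k'}"
      then have E: "E \<subseteq> D" "card E = k'" by auto
      show "q ^ cross_inversions (insert M E) (insert M D - insert M E) = q ^ cross_inversions E (D - E) * q ^ (?n - k')"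
        unfolding 2[OF E(1)] E(2) by (rule power_add)
    qed
    also have "\<dots> = qfact ?n / (qfact k' * qfact (?n - k')) * q ^ (?n - k')"
      unfolding sum_distrib_right[symmetric] insert.IH[OF k'] ..
    finally have B: "(\<Sum>E\<in>insert M ` {E. E \<subseteq> D \<and> card E = k'}. q ^ cross_inversions E (insert M D - E)) =
       qfact ?n / (qfact k' * qfact (?n - k')) * q ^ (?n - k')" .
    have "(\<Sum>E | E \<subseteq> insert M D \<and> card E = k. q ^ cross_inversions E (insert M D - E)) =
      (if k \<le> ?n then qfact ?n / (qfact k * qfact (?n - k)) else 0) + qfact ?n / (qfact k' * qfact (?n - k')) * q ^ (?n - k')"
      unfolding split A[symmetric] B[symmetric]
      by (rule sum.union_disjoint) (use insert.hyps(1) M in auto)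
    also have "\<dots> = qfact (Suc ?n) / (qfact k * qfact (Suc ?n - k))"
    proof (cases "k \<le> ?n")
      case True
      define l where "l = ?n - k"
      have n: "?n = k' + Suc l" using True Suc by (simp add: l_def)
      have "qn (Suc ?n) = qn (Suc k' + Suc l)" by (simp add: n)
      also have "\<dots> = qn (Suc l) + q ^ Suc l * qn (Suc k')" by (rule qn_add)
      finally have N: "qn (Suc ?n) = qn (Suc l) + q ^ Suc l * qn (Suc k')" .
      have "?n - k = l" "?n - k' = Suc l" "Suc ?n - k = Suc l" using True Suc by (simp_all add: l_def)
      then show ?thesis using True by (simp only: Suc if_True) (simp add: qfact_Suc N field_simps)
    next
      case False
      then have "?n = k'" using k' Suc by simp
      then show ?thesis using Suc False by simp
    qed
    finally show ?thesis using M insert.hyps(1) by simp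
  qed
qed

definition tree_weight :: "ltree \<Rightarrow> 'a" where
  "tree_weight t = q ^ list_inversions (dec_word t)"

lemma sum_trees_by_root:
  assumes W: "strict W" and D: "finite D" "D \<noteq> {}"
  defines "V \<equiv> \<lambda>i. take i W @ drop (Suc i) W"
  shows "(\<Sum>t\<in>rooted_below W D x. tree_weight t) =
    (\<Sum>i | i < length W \<and> \<not> snd (W ! i) \<and> fst (W ! i) < x. \<Sum>j\<le>length (V i). \<Sum>E\<in>Pow (D - {Max D}).
      \<Sum>a\<in>rooted_below (take j (V i)) E (fst (W ! i)). \<Sum>b\<in>rooted_above (drop j (V i)) (D - {Max D} - E) (fst (W ! i)).
        tree_weight (Node a (Max D) (fst (W ! i)) b))"
proof -
  let ?I = "{i. i < length W \<and> \<not> snd (W ! i) \<and> fst (W ! i) < x}"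
  let ?D = "D - {Max D}"
  let ?R = "\<lambda>i j E. rooted_below (take j (V i)) E (fst (W ! i)) \<times> rooted_above (drop j (V i)) (?D - E) (fst (W ! i))"
  let ?S = "SIGMA i:?I. SIGMA j:{..length (V i)}. SIGMA E:Pow ?D. ?R i j E"
  let ?N = "\<lambda>(i, j, E, a, b). Node a (Max D) (fst (W ! i)) b"
  have fin: "finite (rooted_below U E y)" "finite (rooted_above U E y)" for U E y
    using finite_labelled[of U E] by (auto simp: rooted_below_def rooted_above_def)
  have V: "strict (V i)" for i unfolding V_def by (rule strict_remove[OF W])
  have "(\<Sum>i\<in>?I. \<Sum>j\<le>length (V i). \<Sum>E\<in>Pow ?D.
      \<Sum>a\<in>rooted_below (take j (V i)) E (fst (W ! i)). \<Sum>b\<in>rooted_above (drop j (V i)) (?D - E) (fst (W ! i)).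
        tree_weight (Node a (Max D) (fst (W ! i)) b)) = (\<Sum>z\<in>?S. tree_weight (?N z))"
    using D fin by (simp add: sum.Sigma sum.cartesian_product split_beta)
  also have "\<dots> = (\<Sum>t\<in>rooted_below W D x. tree_weight t)"
  proof (rule sum.reindex_cong[symmetric])
    show "inj_on ?N ?S"
    proof (rule inj_onI)
      fix z z' assume z: "z \<in> ?S" "z' \<in> ?S" "?N z = ?N z'"
      obtain i j E a b where zz: "z = (i, j, E, a, b)" by (cases z)
      obtain i' j' E' a' b' where zz': "z' = (i', j', E', a', b')" by (cases z')
      have ab: "a' = a" "b' = b" "fst (W ! i') = fst (W ! i)" using z(3) by (auto simp: zz zz')
      have i: "i < length W" "i' < length W" using z(1,2) by (auto simp: zz zz')
      then have "i' = i" using ab(3) strict_distinct[OF W] nth_eq_iff_index_eq[of "map fst W" i' i] by simp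
      have a1: "a \<in> labelled (take j (V i)) E" using z(1) by (auto simp: zz rooted_below_def)
      have a2: "a \<in> labelled (take j' (V i)) E'" using z(2) ab \<open>i' = i\<close> by (auto simp: zz' rooted_below_def)
      have "E' = E" using a1 a2 by (simp add: labelled_def)
      have "card (fst ` set (take k (V i))) = k" if "k \<le> length (V i)" for k
        using distinct_card[OF strict_distinct[OF strict_take_drop(1)[OF V, of k]]] that by simp
      moreover have "fst ` set (take j (V i)) = fst ` set (take j' (V i))" using a1 a2 by (simp add: labelled_def)
      moreover have "j \<le> length (V i)" "j' \<le> length (V i)" using z(1,2) \<open>i' = i\<close> by (auto simp: zz zz')
      ultimately have "j' = j" by metis
      then show "z = z'" using ab \<open>i' = i\<close> \<open>E' = E\<close> by (simp add: zz zz')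
    qed
    show "rooted_below W D x = ?N ` ?S"
    proof (intro equalityI subsetI)
      fix t assume t: "t \<in> rooted_below W D x"
      then have tl: "t \<in> labelled W D" "lr_root t < x" by (auto simp: rooted_below_def)
      have "dec_word t \<noteq> []" using tl(1) D by (auto simp: labelled_def)
      then obtain a d m b where tN: "t = Node a d m b" by (cases t) auto
      have N: "Node a d m b \<in> labelled W D" using tl tN by simp
      have d: "d = Max D" by (rule Max_dec[OF N])
      obtain i j where ij: "i < length W" "\<not> snd (W ! i)" "fst (W ! i) = m" "j \<le> length (V i)"
        "a \<in> labelled (take j (V i)) (set (dec_word a))" "b \<in> labelled (drop j (V i)) (set (dec_word b))"
        using Node_labelledD[OF W N] unfolding V_def by blast
      have dd: "?D - set (dec_word a) = set (dec_word b)" "set (dec_word a) \<subseteq> ?D" "lr_root a < m" "m < lr_root b"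
        using N unfolding d[symmetric] by (auto simp: labelled_def)
      have "(i, j, set (dec_word a), a, b) \<in> ?S"
        using ij dd tl(2) tN by (auto simp: rooted_below_def rooted_above_def)
      moreover have "t = ?N (i, j, set (dec_word a), a, b)" using tN d ij by simp
      ultimately show "t \<in> ?N ` ?S" by blast
    next
      fix t assume "t \<in> ?N ` ?S"
      then obtain i j E a b where z: "(i, j, E, a, b) \<in> ?S" and t: "t = Node a (Max D) (fst (W ! i)) b" by auto
      have "t \<in> labelled W D" unfolding t
        by (rule Node_labelledI[OF W, where j = j and E = E and F = "?D - E"])
          (use z D in \<open>auto simp: rooted_below_def rooted_above_def V_def\<close>)
      then show "t \<in> rooted_below W D x" using z by (auto simp: t rooted_below_def)
    qed
  qed simp
  finally show ?thesis by simp
qed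

text \<open>
  The recursive definition of \<open>below\<close>, unfolded over trees: a tree is given by its root ball, a cut of the remaining
  word, the set \<open>E\<close> of decreasing labels of the left subtree, and the two subtrees; its decreasing root label
  is the maximum of \<open>D\<close>.
\<close>

theorem sum_rooted_below:
  assumes "strict W" "finite D" "card D = balls (map snd W)"
  shows "(\<Sum>t\<in>rooted_below W D x. tree_weight t) = qfact (card D) * below (map snd W) (position W x)"
  using assms
proof (induction "length W" arbitrary: W D x rule: less_induct)
  case less
  note W = less.prems(1)
  show ?case
  proof (cases "D = {}")
    case True
    then have nb: "False \<notin> set (map snd W)" using less.prems(3) by (simp add: count_list_0_iff)
    then have f: "filter snd W = W" by (intro filter_True) (force simp: image_iff)
    show ?thesis
    proof (cases "map snd W = [True]")
      case wT: True
      then obtain l where Wl: "W = [(l, True)]" by (auto simp: map_eq_Cons_conv)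
      have L: "labelled W D = {Leaf l}"
      proof (intro equalityI subsetI)
        fix t assume "t \<in> labelled W D"
        then show "t \<in> {Leaf l}" using True by (cases t) (auto simp: labelled_def Wl)
      qed (simp add: labelled_def Wl True)
      have R: "rooted_below W D x = (if l < x then {Leaf l} else {})"
        unfolding rooted_below_def L by (simp add: Collect_conv_if)
      have "position W x = (if l < x then 1 else 0)" by (simp add: Wl position_def)
      then show ?thesis unfolding R wT using True by (simp add: tree_weight_def)
    next
      case False
      have "labelled W D = {}"
      proof (rule ccontr)
        assume "labelled W D \<noteq> {}"
        then obtain t where t: "t \<in> labelled W D" by blast
        then have "dec_word t = []" using True by (simp add: labelled_def)
        then obtain l where "t = Leaf l" by (cases t) auto
        then have "map fst W = [l]" using t f by (simp add: labelled_def)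
        then obtain c where "W = [(l, c)]" by (auto simp: map_eq_Cons_conv)
        then show False using False nb by simp
      qed
      then show ?thesis using nb False by (simp add: rooted_below_def below_no_ball)
    qed
  next
    case False
    let ?D = "D - {Max D}"
    let ?w = "map snd W"
    define n where "n = card ?D"
    have MD: "Max D \<in> D" using False less.prems by simp
    have cD: "card D = Suc n" using MD less.prems(2) unfolding n_def by (metis card_Suc_Diff1)
    define V where "V i = take i W @ drop (Suc i) W" for i
    have strictV: "strict (V i)" for i unfolding V_def by (rule strict_remove[OF W])
    have inner: "(\<Sum>j\<le>length (V i). \<Sum>E\<in>Pow ?D.
      \<Sum>a\<in>rooted_below (take j (V i)) E (fst (W ! i)). \<Sum>b\<in>rooted_above (drop j (V i)) (?D - E) (fst (W ! i)).
        tree_weight (Node a (Max D) (fst (W ! i)) b)) = qfact (Suc n) * root_weight (remove_at i ?w) i"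
      if i: "i < length W" "\<not> snd (W ! i)" for i
    proof -
      let ?m = "fst (W ! i)"
      let ?v = "remove_at i ?w"
      let ?T = "\<lambda>j E. \<Sum>a\<in>rooted_below (take j (V i)) E ?m. \<Sum>b\<in>rooted_above (drop j (V i)) (?D - E) ?m.
        tree_weight (Node a (Max D) ?m b)"
      have v: "map snd (V i) = ?v" by (simp add: V_def remove_at_def take_map drop_map)
      have vl: "length ?v = length (V i)" unfolding v[symmetric] by simp
      have bv: "balls ?v = n" using balls_remove[of i ?w] i less.prems(3) cD by simp
      have VW: "length (V i) < length W" using i by (simp add: V_def)
      have IHb: "(\<Sum>a\<in>rooted_below (take j (V i)) E y. tree_weight a) =
          qfact (card E) * below (take j ?v) (position (take j (V i)) y)"
        if "E \<subseteq> ?D" "card E = balls (take j ?v)" for E j y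
      proof -
        have "(\<Sum>a\<in>rooted_below (take j (V i)) E y. tree_weight a) =
          qfact (card E) * below (map snd (take j (V i))) (position (take j (V i)) y)"
          by (rule less.hyps) (use that VW strict_take_drop(1)[OF strictV] less.prems(2) v in \<open>auto simp: take_map[symmetric] intro: finite_subset\<close>)
        then show ?thesis by (simp add: take_map[symmetric] v)
      qed
      have IHd: "(\<Sum>b\<in>rooted_below (drop j (V i)) E y. tree_weight b) =
          qfact (card E) * below (drop j ?v) (position (drop j (V i)) y)"
        if "E \<subseteq> ?D" "card E = balls (drop j ?v)" for E j y
      proof -
        have "(\<Sum>b\<in>rooted_below (drop j (V i)) E y. tree_weight b) =
          qfact (card E) * below (map snd (drop j (V i))) (position (drop j (V i)) y)"
          by (rule less.hyps) (use that VW strict_take_drop(2)[OF strictV] less.prems(2) v in \<open>auto simp: drop_map[symmetric] intro: finite_subset\<close>)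
        then show ?thesis by (simp add: drop_map[symmetric] v)
      qed
      have IHa: "(\<Sum>b\<in>rooted_above (drop j (V i)) E ?m. tree_weight b) = qfact (card E) * above (drop j ?v) (i - j)"
        if E: "E \<subseteq> ?D" "card E = balls (drop j ?v)" for E j
      proof -
        let ?U = "drop j (V i)"
        let ?B = "Suc (Max (insert 0 (fst ` set ?U)))"
        have lr: "lr_root b \<in> fst ` set ?U" if "b \<in> labelled ?U E" for b
          using that lr_root_in[of b] by (simp add: labelled_def)
        have ne: "lr_root b \<noteq> ?m" if "b \<in> labelled ?U E" for b
          using lr[OF that] position_take_drop(3)[OF W i(1), folded V_def] by (metis imageE in_set_dropD)
        have big: "lr_root b < ?B" if "b \<in> labelled ?U E" for b
          using lr[OF that] by (simp add: le_imp_less_Suc)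
        have "rooted_below ?U E ?B = rooted_below ?U E ?m \<union> rooted_above ?U E ?m"
          unfolding rooted_below_def rooted_above_def using ne big by (auto simp: neq_iff)
        then have "(\<Sum>b\<in>rooted_below ?U E ?B. tree_weight b) = (\<Sum>b\<in>rooted_below ?U E ?m. tree_weight b) + (\<Sum>b\<in>rooted_above ?U E ?m. tree_weight b)"
          using finite_labelled[of ?U E]
          by (simp only:) (rule sum.union_disjoint; auto simp: rooted_below_def rooted_above_def)
        moreover have "position ?U ?B = length ?U"
          by (rule position_all) (simp add: le_imp_less_Suc)
        moreover have "position ?U ?m = i - j"
          using position_take_drop(2)[OF W i(1)] by (simp add: V_def)
        ultimately show ?thesis unfolding IHd[OF E] above_def by (simp add: vl algebra_simps)
      qed
      have piece: "(\<Sum>E\<in>Pow ?D. ?T j E) = qfact n * (q ^ balls (drop j ?v) * below (take j ?v) i * above (drop j ?v) (i - j))" for j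
      proof -
        let ?k = "balls (take j ?v)" and ?l = "balls (drop j ?v)"
        have kl: "?k + ?l = n" using bv by (metis append_take_drop_id count_list_append)
        have zero: "?T j E = 0" if "E \<in> Pow ?D" "card E \<noteq> ?k" for E
        proof -
          have "rooted_below (take j (V i)) E ?m = {}"
            using labelled_card[OF _ strict_take_drop(1)[OF strictV]] that(2)
            by (force simp: rooted_below_def take_map[symmetric] v[symmetric])
          then show ?thesis by simp
        qed
        have "(\<Sum>E\<in>Pow ?D. ?T j E) =
          (\<Sum>E | E \<subseteq> ?D \<and> card E = ?k. ?T j E)"
          by (rule sum.mono_neutral_right) (use less.prems(2) zero in auto)
        also have "\<dots> = (\<Sum>E | E \<subseteq> ?D \<and> card E = ?k. q ^ cross_inversions E (?D - E) *
          (q ^ ?l * (qfact ?k * below (take j ?v) i) * (qfact ?l * above (drop j ?v) (i - j))))"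
        proof (intro sum.cong refl)
          fix E assume "E \<in> {E. E \<subseteq> ?D \<and> card E = ?k}"
          then have E: "E \<subseteq> ?D" "card E = ?k" by auto
          have fE: "finite E" using E less.prems(2) finite_subset by blast
          have cE: "card (?D - E) = ?l" using E fE kl n_def by (simp add: card_Diff_subset)
          have "?T j E =
            (\<Sum>a\<in>rooted_below (take j (V i)) E ?m. \<Sum>b\<in>rooted_above (drop j (V i)) (?D - E) ?m.
              q ^ cross_inversions E (?D - E) * q ^ ?l * (tree_weight a * tree_weight b))"
          proof (intro sum.cong refl)
            fix a b assume a: "a \<in> rooted_below (take j (V i)) E ?m" and b: "b \<in> rooted_above (drop j (V i)) (?D - E) ?m"
            have da: "distinct (dec_word a)" "set (dec_word a) = E" using a by (auto simp: rooted_below_def labelled_def)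
            have db: "distinct (dec_word b)" "set (dec_word b) = ?D - E" using b by (auto simp: rooted_above_def labelled_def)
            have "e < Max D" if "e \<in> ?D" for e
              using Max_ge[OF less.prems(2), of e] that by (auto simp: le_less)
            then have "\<forall>e\<in>set (dec_word a) \<union> set (dec_word b). e < Max D"
              using da(2) db(2) E(1) by blast
            then have "list_inversions (dec_word a @ Max D # dec_word b) =
              list_inversions (dec_word a) + list_inversions (dec_word b) + cross_inversions E (?D - E) + ?l"
              using list_inversions_Node[OF da(1) db(1)] distinct_card[OF db(1)] cE da(2) db(2) by simp
            then show "tree_weight (Node a (Max D) ?m b) = q ^ cross_inversions E (?D - E) * q ^ ?l * (tree_weight a * tree_weight b)"
              by (simp add: tree_weight_def power_add mult_ac)
          qed
          also have "\<dots> = q ^ cross_inversions E (?D - E) * q ^ ?l *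
            ((\<Sum>a\<in>rooted_below (take j (V i)) E ?m. tree_weight a) * (\<Sum>b\<in>rooted_above (drop j (V i)) (?D - E) ?m. tree_weight b))"
            unfolding sum_product by (simp add: sum_distrib_left)
          also have "(\<Sum>b\<in>rooted_above (drop j (V i)) (?D - E) ?m. tree_weight b) = qfact ?l * above (drop j ?v) (i - j)"
            using IHa[of "?D - E" j] cE by auto
          also have "(\<Sum>a\<in>rooted_below (take j (V i)) E ?m. tree_weight a) = qfact ?k * below (take j ?v) i"
          proof -
            have "below (take j ?v) (min i j) = below (take j ?v) i"
            proof (cases "i \<le> j")
              case False
              then have "length (take j ?v) \<le> j" "length (take j ?v) \<le> i" by auto
              then show ?thesis using False below_saturated[of "take j ?v" j] below_saturated[of "take j ?v" i] by simp
            qed (simp add: min_def)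
            then show ?thesis using IHb[of E j ?m] E position_take_drop(1)[OF W i(1), of j] by (simp add: V_def)
          qed
          finally show "?T j E =
            q ^ cross_inversions E (?D - E) * (q ^ ?l * (qfact ?k * below (take j ?v) i) * (qfact ?l * above (drop j ?v) (i - j)))"
            by (simp only: mult_ac)
        qed
        also have "\<dots> = qfact n / (qfact ?k * qfact ?l) * (q ^ ?l * (qfact ?k * below (take j ?v) i) * (qfact ?l * above (drop j ?v) (i - j)))"
        proof -
          have "n - ?k = ?l" "?k \<le> n" using kl by simp_all
          then show ?thesis unfolding sum_distrib_right[symmetric]
            using sum_cross_inversions[of ?D ?k] less.prems(2) by (simp add: n_def)
        qed
        also have "\<dots> = qfact n * (q ^ ?l * below (take j ?v) i * above (drop j ?v) (i - j))" by simp
        finally show ?thesis .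
      qed
      have "(\<Sum>j\<le>length (V i). qfact n * (q ^ balls (drop j ?v) * below (take j ?v) i * above (drop j ?v) (i - j))) =
        qfact n * splits ?v (\<lambda>a b. q ^ balls b * below a i * above b (i - length a))"
        unfolding splits_def sum_distrib_left vl by (intro sum.cong refl) (auto simp: vl min_def)
      also have "\<dots> = qfact (Suc n) * root_weight ?v i"
        unfolding root_weight_def bv by (simp add: qfact_Suc)
      finally show ?thesis unfolding piece .
    qed
    have "(\<Sum>t\<in>rooted_below W D x. tree_weight t) =
      (\<Sum>i | i < length W \<and> \<not> snd (W ! i) \<and> fst (W ! i) < x. qfact (Suc n) * root_weight (remove_at i ?w) i)"
      unfolding sum_trees_by_root[OF W less.prems(2) False] V_def[symmetric]
      by (intro sum.cong refl) (use inner in auto)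
    also have "{i. i < length W \<and> \<not> snd (W ! i) \<and> fst (W ! i) < x} = {i. i < position W x \<and> i < length ?w \<and> \<not> ?w ! i}"
      using strict_less_position[OF W] by auto
    also have "(\<Sum>i | i < position W x \<and> i < length ?w \<and> \<not> ?w ! i. qfact (Suc n) * root_weight (remove_at i ?w) i) =
      qfact (Suc n) * below ?w (position W x)"
    proof -
      have "False \<in> set ?w" using cD less.prems(3) by (metis count_notin nat.distinct(1))
      then show ?thesis unfolding sum_distrib_left[symmetric] by (simp only: below_ball)
    qed
    finally show ?thesis unfolding cD .
  qed
qed

end

section \<open>Contents and inversions\<close>

fun number :: "nat \<Rightarrow> bool list \<Rightarrow> (nat \<times> bool) list" where
  "number k [] = []"
| "number k (c # w) = (k, c) # number (Suc k) w"

fun leaf_positions :: "nat \<Rightarrow> nat list \<Rightarrow> nat list" where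
  "leaf_positions k [] = [k]"
| "leaf_positions k (c # d) = k # leaf_positions (Suc (k + c)) d"

lemma map_snd_number [simp]: "map snd (number k w) = w" by (induction w arbitrary: k) simp_all
lemma map_fst_number: "map fst (number k w) = [k..<k + length w]"
  by (induction w arbitrary: k) (simp_all add: upt_rec)

lemma leaves_number_word: "map fst (filter snd (number k (word d))) = leaf_positions k d"
proof (induction d arbitrary: k)
  case (Cons c d)
  have "map fst (filter snd (number k (replicate c False @ w))) = map fst (filter snd (number (k + c) w))" for k w
    by (induction c arbitrary: k) simp_all
  then show ?case using Cons by simp
qed simp

text \<open>
  The recursive form of \<open>content\<close>, as a function of the leaf labels.
\<close>

fun gaps :: "nat list \<Rightarrow> nat list" where
  "gaps (x # y # zs) = (y - x - 1) # gaps (y # zs)"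
| "gaps _ = []"

lemma content_gaps: "content t = gaps (leaf_word t)"
proof -
  have "map (\<lambda>i. ls ! (i + 1) - ls ! i - 1) [0..<length ls - 1] = gaps ls" for ls :: "nat list"
  proof (induction ls rule: gaps.induct)
    case (1 x y zs)
    have "[0..<length (x # y # zs) - 1] = 0 # map Suc [0..<length (y # zs) - 1]"
      by (simp add: map_Suc_upt upt_conv_Cons del: upt_Suc)
    then show ?case using 1 by (simp add: o_def del: upt_Suc)
  qed simp_all
  then show ?thesis by (simp add: content_def Let_def)
qed

lemma hd_leaf_positions [simp]: "hd (leaf_positions k d) = k" by (cases d) simp_all

lemma gaps_leaf_positions: "gaps (leaf_positions k d) = d"
proof (induction d arbitrary: k)
  case (Cons c d)
  obtain zs where "leaf_positions (Suc (k + c)) d = Suc (k + c) # zs" by (cases d) auto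
  then show ?case using Cons[of "Suc (k + c)"] by simp
qed simp

lemma leaf_positions_gaps: "sorted_wrt (<) ls \<Longrightarrow> ls \<noteq> [] \<Longrightarrow> leaf_positions (hd ls) (gaps ls) = ls"
  by (induction ls rule: gaps.induct) auto

text \<open>
  A list of leaf labels is determined by its gaps and its first entry, which must be 1 as the smallest of all labels.
\<close>

lemma bilabeled_trees_labelled:
  assumes c: "c \<in> weight_seqs r"
  shows "bilabeled_trees r c = labelled (number 1 (word c)) {1..r}"
proof -
  have len: "length (word c) = 2 * r + 1" using c by (simp add: weight_seqs_def length_word)
  have set: "fst ` set (number 1 (word c)) = {1..2 * r + 1}"
  proof -
    have "fst ` set (number 1 (word c)) = set (map fst (number 1 (word c)))" by simp
    also have "\<dots> = {1..<1 + (2 * r + 1)}" unfolding map_fst_number len by (simp only: set_upt)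
    finally show ?thesis by auto
  qed
  show ?thesis
  proof (intro equalityI subsetI)
    fix t assume "t \<in> bilabeled_trees r c"
    then have t: "bilabeled r t" "gaps (leaf_word t) = c" by (auto simp: bilabeled_trees_def content_gaps)
    have s: "sorted_wrt (<) (leaf_word t)" "lr_local t" "set (lr_word t) = {1..2 * r + 1}" using t by (auto simp: bilabeled_def)
    have "hd (leaf_word t) \<le> 1" using lr_between_leaves[OF s(2,1), of 1] s(3) by simp
    moreover have "hd (leaf_word t) \<in> {1..2 * r + 1}" using leaf_word_subset[of t] s(3) hd_in_set[OF leaf_word_nonempty] by blast
    ultimately have "hd (leaf_word t) = 1" by simp
    then have "leaf_word t = leaf_positions 1 c" using leaf_positions_gaps[OF s(1) leaf_word_nonempty] t(2) by simp
    then show "t \<in> labelled (number 1 (word c)) {1..r}"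
      using t(1) set by (simp add: labelled_def leaves_number_word bilabeled_def)
  next
    fix t assume t: "t \<in> labelled (number 1 (word c)) {1..r}"
    then have l: "leaf_word t = leaf_positions 1 c" by (simp add: labelled_def leaves_number_word)
    have "sorted_wrt (<) (leaf_positions k d)" for k d
    proof -
      have "leaf_positions k d = map fst (filter snd (number k (word d)))" by (rule leaves_number_word[symmetric])
      moreover have "sorted_wrt (<) (map fst (number k (word d)))" unfolding map_fst_number by simp
      moreover have "sorted_wrt (<) (map fst W) \<Longrightarrow> sorted_wrt (<) (map fst (filter snd W))" for W :: "(nat \<times> bool) list"
        by (induction W) auto
      ultimately show ?thesis by simp
    qed
    moreover have "length (dec_word t) = r" using t distinct_card[of "dec_word t"] by (simp add: labelled_def)
    ultimately show "t \<in> bilabeled_trees r c"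
      using t set by (simp add: labelled_def bilabeled_trees_def bilabeled_def content_gaps l gaps_leaf_positions leaves_number_word)
  qed
qed

lemma card_list_inversions:
  "card {(i, j). i < j \<and> j < length w \<and> w ! j < w ! i} = list_inversions w"
proof (induction w)
  case (Cons x xs)
  let ?P = "{(i, j). i < j \<and> j < length xs \<and> xs ! j < xs ! i}"
  have fin: "finite ?P" by (rule finite_subset[of _ "{..length xs} \<times> {..length xs}"]) auto
  have "{(i, j). i < j \<and> j < length (x # xs) \<and> (x # xs) ! j < (x # xs) ! i} =
    (\<lambda>j. (0, Suc j)) ` {j. j < length xs \<and> xs ! j < x} \<union> map_prod Suc Suc ` ?P" (is "?A = ?B \<union> ?C")
  proof (intro equalityI subsetI)
    fix p assume "p \<in> ?A"
    then obtain i j where p: "p = (i, j)" "i < j" "j < length (x # xs)" "(x # xs) ! j < (x # xs) ! i" by auto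
    then obtain j' where j: "j = Suc j'" by (cases j) auto
    show "p \<in> ?B \<union> ?C" using p j by (cases i) auto
  qed auto
  moreover have "card (?B \<union> ?C) = card ?B + card ?C"
    by (rule card_Un_disjoint) (use fin in auto)
  moreover have "card ?B = length (filter (\<lambda>y. y < x) xs)"
    by (simp add: card_image inj_on_def length_filter_conv_card)
  moreover have "card ?C = card ?P" by (rule card_image) (auto simp: inj_on_def)
  ultimately show ?case using Cons by simp
qed simp

lemma inversions_tree_perm:
  assumes "length (dec_word t) = r"
  shows "inversions r (tree_perm t) = list_inversions (dec_word t)"
proof -
  let ?w = "dec_word t"
  have "{(i, j). 1 \<le> i \<and> i < j \<and> j \<le> r \<and> tree_perm t i > tree_perm t j} =
     map_prod Suc Suc ` {(i, j). i < j \<and> j < length ?w \<and> ?w ! j < ?w ! i}" (is "?A = ?f ` ?B")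
  proof (intro equalityI subsetI)
    fix p assume "p \<in> ?A"
    then obtain i j where p: "p = (i, j)" "1 \<le> i" "i < j" "j \<le> r" "tree_perm t i > tree_perm t j" by auto
    then have "(i - 1, j - 1) \<in> ?B" using assms by (auto simp: tree_perm_def)
    moreover have "p = ?f (i - 1, j - 1)" using p by simp
    ultimately show "p \<in> ?f ` ?B" by blast
  qed (use assms in \<open>auto simp: tree_perm_def\<close>)
  moreover have "card (?f ` ?B) = card ?B" by (rule card_image) (auto simp: inj_on_def)
  ultimately show ?thesis by (simp add: inversions_def card_list_inversions)
qed

context q_field
begin

lemma sum_bilabeled_trees:
  assumes c: "c \<in> weight_seqs r"
  shows "(\<Sum>t\<in>bilabeled_trees r c. q ^ inversions r (tree_perm t)) = qfact r * content_total c"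
proof -
  let ?W = "number 1 (word c)"
  have len: "length (word c) = 2 * r + 1" using c by (simp add: weight_seqs_def length_word)
  have strict: "strict ?W" by (simp only: map_fst_number sorted_wrt_upt)
  have range: "fst p < 2 * r + 2" if "p \<in> set ?W" for p
  proof -
    have "fst p \<in> set (map fst ?W)" using that by simp
    then have "fst p \<in> {1..<1 + (2 * r + 1)}" by (simp only: map_fst_number len set_upt)
    then show ?thesis by simp
  qed
  have "lr_root t < 2 * r + 2" if "t \<in> labelled ?W {1..r}" for t
    using that lr_root_in[of t] range by (auto simp: labelled_def)
  then have "rooted_below ?W {1..r} (2 * r + 2) = bilabeled_trees r c"
    unfolding bilabeled_trees_labelled[OF c] by (auto simp: rooted_below_def)
  moreover have "position ?W (2 * r + 2) = length (word c)"
    using position_all[OF range] by (metis length_map map_snd_number)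
  moreover have "card {1..r} = balls (map snd ?W)" using c by (simp add: balls_word weight_seqs_def)
  ultimately have "(\<Sum>t\<in>bilabeled_trees r c. tree_weight t) = qfact r * content_total c"
    using sum_rooted_below[OF strict, of "{1..r}" "2 * r + 2"] by (simp add: content_total_def)
  moreover have "tree_weight t = q ^ inversions r (tree_perm t)" if "t \<in> bilabeled_trees r c" for t
    using that inversions_tree_perm[of t r] by (simp add: tree_weight_def bilabeled_trees_def bilabeled_def)
  ultimately show ?thesis by simp
qed

end

section \<open>From polynomials to the field of fractions\<close>

definition list_pairs :: "nat \<Rightarrow> nat \<Rightarrow> (nat \<times> nat) set" where
  "list_pairs d n = {(i, j). i + d < j \<and> j < n}"

lemma finite_list_pairs [simp]: "finite (list_pairs d n)"
  by (rule finite_subset[of _ "{..n} \<times> {..n}"]) (auto simp: list_pairs_def)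

lemma prod_list_pairs_Cons:
  fixes g :: "'b \<Rightarrow> 'b \<Rightarrow> 'a :: comm_monoid_mult"
  shows "(\<Prod>(i, j)\<in>list_pairs d (length (x # xs)). g ((x # xs) ! i) ((x # xs) ! j)) =
    (\<Prod>y\<leftarrow>drop d xs. g x y) * (\<Prod>(i, j)\<in>list_pairs d (length xs). g (xs ! i) (xs ! j))"
proof -
  let ?B = "(\<lambda>j. (0, Suc j)) ` {d..<length xs}" and ?C = "map_prod Suc Suc ` list_pairs d (length xs)"
  have "list_pairs d (length (x # xs)) = ?B \<union> ?C"
  proof (intro equalityI subsetI)
    fix p assume "p \<in> list_pairs d (length (x # xs))"
    then obtain i j where p: "p = (i, j)" "i + d < j" "j < length (x # xs)" by (auto simp: list_pairs_def)
    then obtain j' where j: "j = Suc j'" by (cases j) auto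
    show "p \<in> ?B \<union> ?C"
    proof (cases i)
      case (Suc i')
      then have "(i', j') \<in> list_pairs d (length xs)" using p j by (auto simp: list_pairs_def)
      then show ?thesis using p j Suc by (auto intro!: image_eqI[of _ _ "(i', j')"])
    qed (use p j in auto)
  qed (auto simp: list_pairs_def)
  moreover have "?B \<inter> ?C = {}" by auto
  ultimately have "(\<Prod>(i, j)\<in>list_pairs d (length (x # xs)). g ((x # xs) ! i) ((x # xs) ! j)) =
    (\<Prod>(i, j)\<in>?B. g ((x # xs) ! i) ((x # xs) ! j)) * (\<Prod>(i, j)\<in>?C. g ((x # xs) ! i) ((x # xs) ! j))"
    by (simp add: prod.union_disjoint)
  also have "(\<Prod>(i, j)\<in>?B. g ((x # xs) ! i) ((x # xs) ! j)) = (\<Prod>j\<in>{d..<length xs}. g x (xs ! j))"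
    by (subst prod.reindex) (auto simp: inj_on_def)
  also have "\<dots> = (\<Prod>y\<leftarrow>drop d xs. g x y)"
  proof -
    have "(\<Prod>y\<leftarrow>drop d xs. g x y) = (\<Prod>i = 0..<length xs - d. g x (xs ! (d + i)))"
      by (simp add: prod.list_conv_set_nth)
    also have "\<dots> = (\<Prod>j\<in>{d..<length xs}. g x (xs ! j))"
      by (rule prod.reindex_bij_witness[of _ "\<lambda>j. j - d" "\<lambda>i. d + i"]) auto
    finally show ?thesis by simp
  qed
  also have "(\<Prod>(i, j)\<in>?C. g ((x # xs) ! i) ((x # xs) ! j)) = (\<Prod>(i, j)\<in>list_pairs d (length xs). g (xs ! i) (xs ! j))"
    by (subst prod.reindex) (auto simp: inj_on_def intro!: prod.cong)
  finally show ?thesis .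
qed

definition index_pairs :: "nat \<Rightarrow> (nat \<times> nat) set" where
  "index_pairs n = {(i, j). 1 \<le> i \<and> i < j \<and> j \<le> n}"

lemma finite_index_pairs [simp]: "finite (index_pairs n)"
  by (rule finite_subset[of _ "{..n} \<times> {..n}"]) (auto simp: index_pairs_def)

text \<open>
  After the transposition the factor of a pair is, up to sign, the factor of the pair of images.
  The sign is negative for the pair \<open>(a, b)\<close> and, for each \<open>c\<close> between \<open>a\<close> and \<open>b\<close>, for the two pairs
  \<open>(a, c)\<close> and \<open>(c, b)\<close>, an odd number in all.
\<close>

lemma vandermonde_transpose:
  fixes f :: "nat \<Rightarrow> 'a :: comm_ring_1"
  assumes ab: "a < b" "a \<in> {1..n}" "b \<in> {1..n}"
  shows "(\<Prod>(i, j)\<in>index_pairs n. f (transpose a b i) - f (transpose a b j)) = - (\<Prod>(i, j)\<in>index_pairs n. f i - f j)"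
proof -
  let ?t = "transpose a b"
  let ?s = "\<lambda>(i, j). (min (?t i) (?t j), max (?t i) (?t j))"
  have t_in: "?t i \<in> {1..n}" if "i \<in> {1..n}" for i using that ab by (auto simp: transpose_def)
  have t_neq: "?t i \<noteq> ?t j" if "i < j" for i j
    using that by (metis less_irrefl transpose_involutory)
  let ?e = "\<lambda>(i, j). if ?t j < ?t i then - 1 else 1 :: 'a"
  have "(\<Prod>(i, j)\<in>index_pairs n. f (?t i) - f (?t j)) = (\<Prod>p\<in>index_pairs n. ?e p * (\<lambda>(i, j). f i - f j) (?s p))"
    using t_neq by (intro prod.cong) (auto simp: min_def max_def index_pairs_def)
  also have "\<dots> = (\<Prod>p\<in>index_pairs n. ?e p) * (\<Prod>p\<in>index_pairs n. (\<lambda>(i, j). f i - f j) (?s p))"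
    by (rule prod.distrib)
  also have "(\<Prod>p\<in>index_pairs n. (\<lambda>(i, j). f i - f j) (?s p)) = (\<Prod>(i, j)\<in>index_pairs n. f i - f j)"
  proof -
    have mem: "?s p \<in> index_pairs n" and inv: "?s (?s p) = p" if p: "p \<in> index_pairs n" for p
    proof -
      obtain i j where ij: "p = (i, j)" "i < j" "i \<in> {1..n}" "j \<in> {1..n}" using p by (auto simp: index_pairs_def)
      show "?s p \<in> index_pairs n" using t_in[OF ij(3)] t_in[OF ij(4)] t_neq[OF ij(2)] ij
        by (auto simp: index_pairs_def min_def max_def)
      show "?s (?s p) = p" using ij by (auto simp: min_def max_def)
    qed
    have "bij_betw ?s (index_pairs n) (index_pairs n)"
      by (rule bij_betw_byWitness[where f' = ?s]) (use mem inv in blast)+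
    then show ?thesis by (rule prod.reindex_bij_betw)
  qed
  also have "(\<Prod>p\<in>index_pairs n. ?e p) = - 1"
  proof -
    let ?M = "{a<..<b}"
    have "{(i, j) \<in> index_pairs n. ?t j < ?t i} = insert (a, b) (Pair a ` ?M \<union> (\<lambda>c. (c, b)) ` ?M)"
      using ab by (auto simp: index_pairs_def transpose_def split: if_splits)
    moreover have "card (insert (a, b) (Pair a ` ?M \<union> (\<lambda>c. (c, b)) ` ?M)) = Suc (card ?M + card ?M)"
    proof -
      have "card (Pair a ` ?M \<union> (\<lambda>c. (c, b)) ` ?M) = card (Pair a ` ?M) + card ((\<lambda>c. (c, b)) ` ?M)"
        by (rule card_Un_disjoint) auto
      also have "\<dots> = card ?M + card ?M" by (simp add: card_image inj_on_def)
      finally show ?thesis by (subst card_insert_disjoint) auto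
    qed
    ultimately have card: "card {(i, j) \<in> index_pairs n. ?t j < ?t i} = Suc (card ?M + card ?M)" by simp
    have "(\<Prod>p\<in>index_pairs n. ?e p) = (\<Prod>p\<in>{(i, j) \<in> index_pairs n. ?t j < ?t i}. - 1)"
      by (rule prod.mono_neutral_cong_right) (auto split: if_splits)
    also have "\<dots> = - 1" unfolding prod_constant card by (simp add: power_add mult_2[symmetric] power_mult_distrib[symmetric])
    finally show ?thesis .
  qed
  finally show ?thesis by simp
qed

lemma vandermonde_permute:
  fixes f :: "nat \<Rightarrow> 'a :: comm_ring_1"
  assumes "\<sigma> permutes {1..n}"
  shows "(\<Prod>(i, j)\<in>index_pairs n. f (\<sigma> i) - f (\<sigma> j)) = of_int (sign \<sigma>) * (\<Prod>(i, j)\<in>index_pairs n. f i - f j)"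
  using assms finite_atLeastAtMost
proof (induction arbitrary: f rule: permutes_induct)
  case (swap a b p)
  have "(\<Prod>(i, j)\<in>index_pairs n. f (transpose a b i) - f (transpose a b j)) = - (\<Prod>(i, j)\<in>index_pairs n. f i - f j)"
  proof (cases "a < b")
    case False
    then show ?thesis using vandermonde_transpose[of b a n f] swap by (simp add: transpose_commute)
  qed (use vandermonde_transpose swap in blast)
  moreover have "sign (transpose a b \<circ> p) = - sign p"
  proof -
    have "permutation p" using \<open>p permutes {1..n}\<close> permutation_permutes by blast
    then show ?thesis using \<open>a \<noteq> b\<close> by (simp add: sign_compose sign_swap_id permutation_swap_id)
  qed
  ultimately show ?case using swap.IH[of "\<lambda>i. f (transpose a b i)"] by (simp add: o_def)
qed (simp_all add: sign_id)

lemma permute_vars_lookup: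
  assumes "bij \<sigma>"
  shows "Poly_Mapping.lookup (permute_vars \<sigma> f) m = Poly_Mapping.lookup f (Poly_Mapping.map_key \<sigma> m)"
  unfolding permute_vars_def by (simp add: map_key.rep_eq[OF inj_map_key[OF assms]])

lemma bij_map_key:
  fixes \<sigma> :: "nat \<Rightarrow> nat"
  assumes "bij \<sigma>"
  shows "bij (Poly_Mapping.map_key \<sigma> :: (nat \<Rightarrow>\<^sub>0 nat) \<Rightarrow> _)"
proof (rule bijI[OF inj_map_key[OF assms]])
  have i: "inj \<sigma>" "inj (inv \<sigma>)" using assms by (auto intro: bij_is_inj bij_imp_bij_inv)
  have "Poly_Mapping.map_key \<sigma> (Poly_Mapping.map_key (inv \<sigma>) m) = m" for m :: "nat \<Rightarrow>\<^sub>0 nat"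
    by (rule poly_mapping_eqI) (simp add: map_key.rep_eq i inv_f_f)
  then show "surj (Poly_Mapping.map_key \<sigma> :: (nat \<Rightarrow>\<^sub>0 nat) \<Rightarrow> _)" by (metis surjI)
qed

lemma permute_vars_add: "bij \<sigma> \<Longrightarrow> permute_vars \<sigma> (f + g) = permute_vars \<sigma> f + permute_vars \<sigma> g"
  by (rule poly_mapping_eqI) (simp add: permute_vars_lookup lookup_add)

lemma permute_vars_diff: "bij \<sigma> \<Longrightarrow> permute_vars \<sigma> (f - g) = permute_vars \<sigma> f - permute_vars \<sigma> g"
  by (rule poly_mapping_eqI) (simp add: permute_vars_lookup lookup_minus)

text \<open>
  Renaming variables is an additive bijection of the exponent vectors, along which the convolution sum is reindexed.
\<close>

lemma permute_vars_mult:
  assumes "bij \<sigma>"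
  shows "permute_vars \<sigma> (f * g) = permute_vars \<sigma> f * permute_vars \<sigma> g"
proof (rule poly_mapping_eqI)
  fix m
  let ?h = "Poly_Mapping.map_key \<sigma> :: (nat \<Rightarrow>\<^sub>0 nat) \<Rightarrow> _"
  note h = bij_map_key[OF assms]
  have eq: "?h m = ?h l + ?h k \<longleftrightarrow> m = l + k" for l k
    using bij_is_inj[OF h] map_key_plus[OF bij_is_inj[OF assms], of l k] by (metis injD)
  have "Poly_Mapping.lookup (permute_vars \<sigma> (f * g)) m =
    (\<Sum>l. Poly_Mapping.lookup f l * (\<Sum>k. Poly_Mapping.lookup g k when ?h m = l + k))"
    by (simp add: permute_vars_lookup[OF assms] lookup_mult)
  also have "\<dots> = (\<Sum>l. Poly_Mapping.lookup f (?h l) * (\<Sum>k. Poly_Mapping.lookup g k when ?h m = ?h l + k))"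
    by (rule Sum_any.reindex_cong[OF h]) (simp add: o_def)
  also have "\<dots> = (\<Sum>l. Poly_Mapping.lookup f (?h l) * (\<Sum>k. Poly_Mapping.lookup g (?h k) when m = l + k))"
  proof -
    have "(\<Sum>k. Poly_Mapping.lookup g k when ?h m = ?h l + k) = (\<Sum>k. Poly_Mapping.lookup g (?h k) when m = l + k)" for l
      by (rule Sum_any.reindex_cong[OF h]) (simp add: o_def eq)
    then show ?thesis by simp
  qed
  also have "\<dots> = Poly_Mapping.lookup (permute_vars \<sigma> f * permute_vars \<sigma> g) m"
    by (simp add: lookup_mult permute_vars_lookup[OF assms])
  finally show "Poly_Mapping.lookup (permute_vars \<sigma> (f * g)) m = Poly_Mapping.lookup (permute_vars \<sigma> f * permute_vars \<sigma> g) m" .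
qed

lemma permute_vars_of_qpoly:
  assumes "bij \<sigma>"
  shows "permute_vars \<sigma> (of_qpoly p) = of_qpoly p"
proof -
  have "Poly_Mapping.map_key \<sigma> (0 :: nat \<Rightarrow>\<^sub>0 nat) = 0" by (simp add: map_key_zero[OF bij_is_inj[OF assms]])
  then show ?thesis unfolding permute_vars_def of_qpoly_def
    by (metis map_key_single[OF inj_map_key[OF assms]])
qed

lemma of_qpoly_simps: "of_qpoly 0 = 0" "of_qpoly 1 = 1" "of_qpoly (a + b) = of_qpoly a + of_qpoly b"
  "of_qpoly (a * b) = of_qpoly a * of_qpoly b" "of_qpoly a = of_qpoly b \<longleftrightarrow> a = b"
proof -
  show "of_qpoly a = of_qpoly b \<longleftrightarrow> a = b"
    unfolding of_qpoly_def by (metis lookup_single_eq)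
qed (simp_all add: of_qpoly_def single_add mult_single)

lemma of_qpoly_power: "of_qpoly (a ^ k) = of_qpoly a ^ k" by (induction k) (simp_all add: of_qpoly_simps)
lemma of_qpoly_sum: "of_qpoly (\<Sum>x\<in>A. f x) = (\<Sum>x\<in>A. of_qpoly (f x))"
  by (induction A rule: infinite_finite_induct) (simp_all add: of_qpoly_simps)

lemma permute_vars_1: "bij \<sigma> \<Longrightarrow> permute_vars \<sigma> 1 = 1"
  using permute_vars_of_qpoly[of \<sigma> 1] by (simp add: of_qpoly_simps)

lemma permute_vars_0: "bij \<sigma> \<Longrightarrow> permute_vars \<sigma> 0 = 0"
  using permute_vars_of_qpoly[of \<sigma> 0] by (simp add: of_qpoly_simps)

lemma permute_vars_prod: "bij \<sigma> \<Longrightarrow> permute_vars \<sigma> (\<Prod>x\<in>A. f x) = (\<Prod>x\<in>A. permute_vars \<sigma> (f x))"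
  by (induction A rule: infinite_finite_induct) (simp_all add: permute_vars_1 permute_vars_mult)

lemma permute_vars_sum: "bij \<sigma> \<Longrightarrow> permute_vars \<sigma> (\<Sum>x\<in>A. f x) = (\<Sum>x\<in>A. permute_vars \<sigma> (f x))"
  by (induction A rule: infinite_finite_induct) (simp_all add: permute_vars_0 permute_vars_add)

lemma permute_vars_power: "bij \<sigma> \<Longrightarrow> permute_vars \<sigma> (f ^ k) = permute_vars \<sigma> f ^ k"
  by (induction k) (simp_all add: permute_vars_1 permute_vars_mult)

lemma to_fract_prod: "to_fract (\<Prod>x\<in>A. f x) = (\<Prod>x\<in>A. to_fract (f x))"
  by (induction A rule: infinite_finite_induct) simp_all

lemma to_fract_sum: "to_fract (\<Sum>x\<in>A. f x) = (\<Sum>x\<in>A. to_fract (f x))"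
  by (induction A rule: infinite_finite_induct) simp_all

lemma to_fract_power: "to_fract (f ^ k) = to_fract f ^ k"
  by (induction k) simp_all

lemma to_fract_of_int: "to_fract (of_int k) = of_int k"
proof -
  have "to_fract (of_nat n) = of_nat n" for n by (induction n) simp_all
  then show ?thesis by (cases k rule: int_cases2) simp_all
qed

context q_field
begin

lemma kernel_conv_prod:
  "kernel xs = (\<Prod>(i, j)\<in>list_pairs 1 (length xs). q * xs ! i - xs ! j) / (\<Prod>(i, j)\<in>list_pairs 0 (length xs). xs ! i - xs ! j)"
proof (induction xs)
  case (Cons x xs)
  show ?case unfolding kernel.simps Cons
    using prod_list_pairs_Cons[of "\<lambda>x y. q * x - y" x xs 1] prod_list_pairs_Cons[of "\<lambda>x y. x - y" x xs 0]
    by (simp add: drop_Suc)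
qed (simp add: list_pairs_def)

lemma flag_product_conv_prod:
  "length c \<le> length xs \<Longrightarrow> flag_product c s xs = (\<Prod>i<length c. (s + (\<Sum>j\<le>i. xs ! j)) ^ (c ! i))"
proof (induction c arbitrary: s xs)
  case (Cons k c)
  then obtain x xs' where xs: "xs = x # xs'" by (cases xs) auto
  have "(\<Prod>i<length (k # c). (s + (\<Sum>j\<le>i. xs ! j)) ^ ((k # c) ! i)) =
    (s + x) ^ k * (\<Prod>i<length c. (s + (\<Sum>j\<le>Suc i. xs ! j)) ^ (c ! i))"
    by (simp add: prod.lessThan_Suc_shift xs del: prod.lessThan_Suc sum.atMost_Suc)
  also have "(\<Prod>i<length c. (s + (\<Sum>j\<le>Suc i. xs ! j)) ^ (c ! i)) = (\<Prod>i<length c. (s + x + (\<Sum>j\<le>i. xs' ! j)) ^ (c ! i))"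
    by (simp add: sum.atMost_Suc_shift xs add.assoc del: sum.atMost_Suc)
  finally show ?case using Cons.IH[of xs' "s + x"] Cons.prems by (simp add: xs)
qed simp

lemma kernel_index:
  "kernel (map y [1..<Suc n]) = (\<Prod>(i, j)\<in>{(i, j). 1 \<le> i \<and> i + 1 < j \<and> j \<le> n}. q * y i - y j) / (\<Prod>(i, j)\<in>index_pairs n. y i - y j)"
proof -
  have *: "(\<Prod>(i, j)\<in>list_pairs d n. g (map y [1..<Suc n] ! i) (map y [1..<Suc n] ! j)) =
    (\<Prod>(i, j)\<in>{(i, j). 1 \<le> i \<and> i + d < j \<and> j \<le> n}. g (y i) (y j))" for d and g :: "'a \<Rightarrow> 'a \<Rightarrow> 'a"
    by (rule prod.reindex_bij_witness[of _ "\<lambda>(i, j). (i - 1, j - 1)" "\<lambda>(i, j). (Suc i, Suc j)"])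
      (auto simp: list_pairs_def simp del: upt_Suc)
  have "length (map y [1..<Suc n]) = n" by simp
  then show ?thesis unfolding kernel_conv_prod index_pairs_def
    using *[of "\<lambda>x y. q * x - y" 1] *[of "\<lambda>x y. x - y" 0] by (simp del: upt_Suc)
qed

lemma flag_product_index:
  assumes "length c = r" "r \<le> n"
  shows "flag_product c 0 (map y [1..<Suc n]) = (\<Prod>i = 1..r. (\<Sum>j = 1..i. y j) ^ (c ! (i - 1)))"
proof -
  have "flag_product c 0 (map y [1..<Suc n]) = (\<Prod>i<r. (\<Sum>j\<le>i. map y [1..<Suc n] ! j) ^ (c ! i))"
    using flag_product_conv_prod[of c "map y [1..<Suc n]" 0] assms by (simp del: upt_Suc)
  also have "\<dots> = (\<Prod>i<r. (\<Sum>j = 1..Suc i. y j) ^ (c ! i))"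
  proof (intro prod.cong refl arg_cong2[of _ _ _ _ "(^)"])
    fix i assume i: "i \<in> {..<r}"
    show "(\<Sum>j\<le>i. map y [1..<Suc n] ! j) = (\<Sum>j = 1..Suc i. y j)"
      by (rule sum.reindex_bij_witness[of _ "\<lambda>j. j - 1" Suc]) (use i assms in \<open>auto simp del: upt_Suc\<close>)
  qed
  also have "\<dots> = (\<Prod>i = 1..r. (\<Sum>j = 1..i. y j) ^ (c ! (i - 1)))"
    by (rule prod.reindex_bij_witness[of _ "\<lambda>i. i - 1" Suc]) auto
  finally show ?thesis .
qed

end

lemma orderings_permutes:
  fixes x :: "nat \<Rightarrow> 'b"
  assumes "inj_on x {1..n}"
  shows "bij_betw (\<lambda>\<sigma>. map (\<lambda>i. x (\<sigma> i)) [1..<Suc n]) {\<sigma>. \<sigma> permutes {1..n}} (permutations_of_set (x ` {1..n}))"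
proof -
  let ?F = "\<lambda>\<sigma>. map (\<lambda>i. x (\<sigma> i)) [1..<Suc n]"
  have inj: "inj_on ?F {\<sigma>. \<sigma> permutes {1..n}}"
  proof (rule inj_onI, rule ext)
    fix \<sigma> \<tau> i assume st: "\<sigma> \<in> {\<sigma>. \<sigma> permutes {1..n}}" "\<tau> \<in> {\<sigma>. \<sigma> permutes {1..n}}" "?F \<sigma> = ?F \<tau>"
    show "\<sigma> i = \<tau> i"
    proof (cases "i \<in> {1..n}")
      case True
      then have "x (\<sigma> i) = x (\<tau> i)" using st(3) by (auto simp del: upt_Suc)
      moreover have "\<sigma> i \<in> {1..n}" "\<tau> i \<in> {1..n}" using st True by (simp_all only: mem_Collect_eq permutes_in_image)
      ultimately show ?thesis using assms by (metis inj_onD)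
    next
      case False
      then show ?thesis using st by (simp add: permutes_not_in)
    qed
  qed
  have "?F ` {\<sigma>. \<sigma> permutes {1..n}} \<subseteq> permutations_of_set (x ` {1..n})"
  proof
    fix xs assume "xs \<in> ?F ` {\<sigma>. \<sigma> permutes {1..n}}"
    then obtain \<sigma> where s: "\<sigma> permutes {1..n}" "xs = ?F \<sigma>" by auto
    have i: "\<sigma> ` {1..n} = {1..n}" by (rule permutes_image[OF s(1)])
    have set: "set [1..<Suc n] = {1..n}" by auto
    have "set xs = x ` \<sigma> ` {1..n}" unfolding s(2) set_map set by auto
    moreover have "distinct xs"
    proof -
      have "inj_on (x \<circ> \<sigma>) {1..n}"
        by (rule comp_inj_on[OF permutes_inj_on[OF s(1)]]) (use assms i in simp)
      then show ?thesis unfolding s(2) distinct_map set by (simp add: o_def del: upt_Suc)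
    qed
    ultimately show "xs \<in> permutations_of_set (x ` {1..n})" using i by (simp add: permutations_of_set_def)
  qed
  moreover have "card (?F ` {\<sigma>. \<sigma> permutes {1..n}}) = card (permutations_of_set (x ` {1..n}))"
    using card_image[OF inj] card_permutations[of "{1..n}" n] assms by (simp add: card_image)
  ultimately have "?F ` {\<sigma>. \<sigma> permutes {1..n}} = permutations_of_set (x ` {1..n})"
    by (intro card_subset_eq) auto
  then show ?thesis using inj by (simp add: bij_betw_def)
qed

text \<open>
  The polynomial \<open>1 + q + \<dots> + q\<^bsup>n-1\<^esup>\<close> is not zero, as its value at \<open>q = 1\<close> is \<open>n\<close>.
\<close>

lemma q_field_generic: "q_field (to_fract (of_qpoly q_var))"
proof
  fix n :: nat assume "0 < n"
  have "(\<Sum>i<n. to_fract (of_qpoly q_var) ^ i) = to_fract (of_qpoly (\<Sum>i<n. q_var ^ i))"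
    by (simp add: to_fract_sum of_qpoly_sum of_qpoly_power to_fract_power)
  moreover have "(\<Sum>i<n. q_var ^ i) \<noteq> 0"
  proof
    assume "(\<Sum>i<n. q_var ^ i) = 0"
    then have "poly (\<Sum>i<n. q_var ^ i) 1 = 0" by simp
    then show False using \<open>0 < n\<close> by (simp add: poly_sum q_var_def)
  qed
  moreover have "of_qpoly p \<noteq> 0" if "p \<noteq> 0" for p
    using that of_qpoly_simps(1,5) by metis
  ultimately show "(\<Sum>i<n. to_fract (of_qpoly q_var) ^ i) \<noteq> 0" by simp
qed

theorem theorem7p1:
  fixes r :: nat and c :: "nat list"
  assumes "1 \<le> r" and "c \<in> weight_seqs r"
  shows "remixed_eulerian r c =
    of_qpoly (\<Sum>t \<in> bilabeled_trees r c. q_var ^ inversions r (tree_perm t))"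
proof -
  define q where "q = to_fract (of_qpoly q_var)"
  interpret q_field q unfolding q_def by (rule q_field_generic)
  define n where "n = r + 1"
  define x where "x i = to_fract (X i)" for i
  define S where "S = x ` {1..n}"
  define f where "f = (\<Prod>i = 1..r. (\<Sum>j = 1..i. X j) ^ (c ! (i - 1)))"
  define K where "K = (\<Prod>(i, j) \<in> {(i, j). 1 \<le> i \<and> i + 1 < j \<and> j \<le> n}. of_qpoly q_var * X i - X j)"
  define V where "V = (\<Prod>(i, j)\<in>index_pairs n. x i - x j)"
  let ?p = "\<Sum>t \<in> bilabeled_trees r c. q_var ^ inversions r (tree_perm t)"
  have c: "length c = r" "sum_list c = r" using assms(2) by (auto simp: weight_seqs_def)
  have inj: "inj_on x {1..n}" by (auto simp: inj_on_def x_def X_eq_iff)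
  have S: "finite S" "0 \<notin> S" "card S = Suc (length c)"
  proof -
    have "X i \<noteq> 0" for i by (metis X_def lookup_single_eq lookup_zero zero_neq_one)
    then show "0 \<notin> S" by (auto simp: S_def x_def)
    show "finite S" "card S = Suc (length c)" using inj c by (simp_all add: S_def card_image n_def)
  qed
  have q1: "q \<noteq> 1"
  proof
    assume "q = 1"
    then have "to_fract (of_qpoly q_var) = to_fract (of_qpoly 1)" by (simp add: q_def of_qpoly_simps)
    then have "q_var = 1" by (simp only: to_fract_eq_iff of_qpoly_simps(5))
    then show False by (simp add: q_var_def one_pCons)
  qed
  have vV: "to_fract (vandermonde n) = V"
    unfolding vandermonde_def V_def index_pairs_def to_fract_prod by (intro prod.cong) (auto simp: x_def)
  have V0: "V \<noteq> 0" unfolding vV[symmetric] using vandermonde_nonzero by simp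
  (* Permuting the variables changes the Vandermonde product by the sign, so the signed summand
     becomes the value of an unsigned expression at the permuted variables. *)
  have summand: "to_fract (of_int (sign \<sigma>) * permute_vars \<sigma> (f * K)) =
    V * (flag_product c 0 (map (\<lambda>i. x (\<sigma> i)) [1..<Suc n]) * kernel (map (\<lambda>i. x (\<sigma> i)) [1..<Suc n]))"
    if \<sigma>: "\<sigma> permutes {1..n}" for \<sigma>
  proof -
    have b: "bij \<sigma>" by (rule permutes_bij[OF \<sigma>])
    have "to_fract (permute_vars \<sigma> f) = (\<Prod>i = 1..r. (\<Sum>j = 1..i. x (\<sigma> j)) ^ (c ! (i - 1)))"
      by (simp add: f_def permute_vars_prod permute_vars_power permute_vars_sum permute_vars_X b to_fract_prod to_fract_power to_fract_sum x_def)
    also have "\<dots> = flag_product c 0 (map (\<lambda>i. x (\<sigma> i)) [1..<Suc n])"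
      using flag_product_index[of c r n "\<lambda>i. x (\<sigma> i)"] c by (simp add: n_def)
    finally have 1: "to_fract (permute_vars \<sigma> f) = flag_product c 0 (map (\<lambda>i. x (\<sigma> i)) [1..<Suc n])" .
    have 2: "to_fract (permute_vars \<sigma> K) = (\<Prod>(i, j) \<in> {(i, j). 1 \<le> i \<and> i + 1 < j \<and> j \<le> n}. q * x (\<sigma> i) - x (\<sigma> j))"
      unfolding K_def permute_vars_prod[OF b] to_fract_prod
      by (intro prod.cong refl) (auto simp: permute_vars_diff permute_vars_mult permute_vars_X permute_vars_of_qpoly b q_def x_def)
    let ?s = "of_int (sign \<sigma>) :: qx_poly fract"
    have V: "(\<Prod>(i, j)\<in>index_pairs n. x (\<sigma> i) - x (\<sigma> j)) = ?s * V"
      unfolding V_def by (rule vandermonde_permute[OF \<sigma>])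
    have "?s * ?s = of_int (sign \<sigma> * sign \<sigma>)" by (simp only: of_int_mult)
    then have ss: "?s * ?s = 1" by simp
    then have s0: "?s \<noteq> 0" by (metis mult_zero_left zero_neq_one)
    have "V * kernel (map (\<lambda>i. x (\<sigma> i)) [1..<Suc n]) = V * (to_fract (permute_vars \<sigma> K) / (?s * V))"
      unfolding kernel_index[of "\<lambda>i. x (\<sigma> i)"] V 2 ..
    also have "\<dots> = ?s * to_fract (permute_vars \<sigma> K)"
      using V0 s0 ss by (simp add: field_simps)
    finally have 3: "V * kernel (map (\<lambda>i. x (\<sigma> i)) [1..<Suc n]) = ?s * to_fract (permute_vars \<sigma> K)" .
    have "to_fract (of_int (sign \<sigma>) * permute_vars \<sigma> (f * K)) = ?s * (to_fract (permute_vars \<sigma> f) * to_fract (permute_vars \<sigma> K))"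
      by (simp add: to_fract_of_int permute_vars_mult b)
    also have "\<dots> = to_fract (permute_vars \<sigma> f) * (V * kernel (map (\<lambda>i. x (\<sigma> i)) [1..<Suc n]))"
      unfolding 3 by (simp only: mult_ac)
    finally show ?thesis unfolding 1 by (simp only: mult_ac)
  qed
  have "to_fract (\<Sum>\<sigma> | \<sigma> permutes {1..n}. of_int (sign \<sigma>) * permute_vars \<sigma> (f * K)) =
    (\<Sum>\<sigma> | \<sigma> permutes {1..n}. V * (flag_product c 0 (map (\<lambda>i. x (\<sigma> i)) [1..<Suc n]) * kernel (map (\<lambda>i. x (\<sigma> i)) [1..<Suc n])))"
    unfolding to_fract_sum by (intro sum.cong refl) (use summand in auto)
  also have "\<dots> = (\<Sum>xs\<in>permutations_of_set S. V * (flag_product c 0 xs * kernel xs))"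
    unfolding S_def by (rule sum.reindex_bij_betw[OF orderings_permutes[OF inj]])
  also have "\<dots> = V * bracket c 0 S" by (simp add: bracket_def sum_distrib_left)
  also have "bracket c 0 S = qfact r * content_total c"
    using bracket_eq[OF q1 S, of 0] c by simp
  also have "\<dots> = (\<Sum>t\<in>bilabeled_trees r c. q ^ inversions r (tree_perm t))"
    by (rule sum_bilabeled_trees[OF assms(2), symmetric])
  also have "\<dots> = to_fract (of_qpoly ?p)"
    by (simp add: q_def to_fract_sum of_qpoly_sum of_qpoly_power to_fract_power)
  finally have "vandermonde n * of_qpoly ?p = (\<Sum>\<sigma> | \<sigma> permutes {1..n}. of_int (sign \<sigma>) * permute_vars \<sigma> (f * K))"
    unfolding vV[symmetric] to_fract_mult[symmetric] to_fract_eq_iff ..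
  then have "divided_difference n (f * K) = of_qpoly ?p" by (rule divided_difference_eqI)
  then show ?thesis by (simp add: remixed_eulerian_def q_bracket_def f_def K_def n_def)
qed

end
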